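(* Let $n \geq 4$ and let $I \subseteq \{1,\ldots,n\}$ satisfy the (NG)-condition. Let $R$ be an integral domain which is either of characteristic zero, or of the form $R=\mathbb{F}_q[t,f_1(t)^{-1},\ldots,f_{\ell-1}(t)^{-1}]$, where $q$ is a prime power, $\ell \geq 2$, and $f_1(t),\ldots,f_{\ell-1}(t)\in \mathbb{F}_q[t]$ are monic irreducible and pairwise coprime. If $\mathbf{S}^I_n(R)$ is finitely generated, then $\mathbf{S}^I_n(R)$ has property $R_\infty$.
   Context: For a group $G$ and $\varphi\in\mathrm{Aut}(G)$, two elements $g,h\in G$ are $\varphi$-twisted conjugate if $g=xh\varphi(x)^{-1}$ for some $x\in G$; the number of equivalence classes is the Reidemeister number $R(\varphi)\in\mathbb{Z}_{>0}\cup\{\infty\}$. A group $G$ has property $R_\infty$ if $R(\varphi)=\infty$ for every $\varphi\in\mathrm{Aut}(G)$. For a commutative unital ring $R$ with unit group $U(R)$, an integer $n\ge 2$ and $I\subseteq\{1,\ldots,n\}$, $\mathbf{S}^I_n(R)\le \mathrm{GL}_n(R)$ is the group of all upper triangular $n\times n$ matrices over $R$ whose diagonal entries lie in $U(R)$ and whose $j$-th diagonal entry equals $1$ for every $j\notin I$. A set $I\subseteq\{1,\ldots,n\}$ satisfies the (NG)-condition if for every $i\in\{1,\ldots,n-1\}$, $i\notin I$ implies $i+1\in I$. *)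

theory Defs
  imports "HOL-Algebra.Group" "HOL-Algebra.Generated_Groups"
    "HOL-Computational_Algebra.Polynomial" "HOL-Computational_Algebra.Polynomial_Factorial"
    "HOL-Computational_Algebra.Fraction_Field"
begin

(* n x n matrices over R are functions nat => nat => R, indexed by {1..n},
   and zero outside {1..n} x {1..n}. *)

definition mat_mult :: "nat \<Rightarrow> (nat \<Rightarrow> nat \<Rightarrow> 'a::comm_ring_1) \<Rightarrow> (nat \<Rightarrow> nat \<Rightarrow> 'a) \<Rightarrow> nat \<Rightarrow> nat \<Rightarrow> 'a" where
  "mat_mult n A B = (\<lambda>i j. if i \<in> {1..n} \<and> j \<in> {1..n} then (\<Sum>k=1..n. A i k * B k j) else 0)"

definition mat_one :: "nat \<Rightarrow> nat \<Rightarrow> nat \<Rightarrow> 'a::comm_ring_1" where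
  "mat_one n = (\<lambda>i j. if i \<in> {1..n} \<and> i = j then 1 else 0)"

definition S_set :: "nat \<Rightarrow> nat set \<Rightarrow> (nat \<Rightarrow> nat \<Rightarrow> 'a::comm_ring_1) set" where
  "S_set n I = {A. (\<forall>i j. (i \<notin> {1..n} \<or> j \<notin> {1..n}) \<longrightarrow> A i j = 0)
                 \<and> (\<forall>i\<in>{1..n}. \<forall>j\<in>{1..n}. j < i \<longrightarrow> A i j = 0)
                 \<and> (\<forall>i\<in>{1..n}. A i i dvd 1)
                 \<and> (\<forall>j\<in>{1..n} - I. A j j = 1)}"

definition S_group :: "nat \<Rightarrow> nat set \<Rightarrow> (nat \<Rightarrow> nat \<Rightarrow> 'a::comm_ring_1) monoid" where
  "S_group n I = \<lparr>carrier = S_set n I, monoid.mult = mat_mult n, monoid.one = mat_one n\<rparr>"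

definition NG_condition :: "nat \<Rightarrow> nat set \<Rightarrow> bool" where
  "NG_condition n I \<longleftrightarrow> (\<forall>i\<in>{1..n-1}. i \<notin> I \<longrightarrow> i + 1 \<in> I)"

definition finitely_generated :: "('g, 'b) monoid_scheme \<Rightarrow> bool" where
  "finitely_generated G \<longleftrightarrow> (\<exists>S. finite S \<and> S \<subseteq> carrier G \<and> generate G S = carrier G)"

definition twisted_conj :: "('g, 'b) monoid_scheme \<Rightarrow> ('g \<Rightarrow> 'g) \<Rightarrow> ('g \<times> 'g) set" where
  "twisted_conj G \<phi> = {(g, h). g \<in> carrier G \<and> h \<in> carrier G \<and>
      (\<exists>x\<in>carrier G. g = x \<otimes>\<^bsub>G\<^esub> h \<otimes>\<^bsub>G\<^esub> inv\<^bsub>G\<^esub> (\<phi> x))}"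

definition reidemeister_infinite :: "('g, 'b) monoid_scheme \<Rightarrow> ('g \<Rightarrow> 'g) \<Rightarrow> bool" where
  "reidemeister_infinite G \<phi> \<longleftrightarrow> infinite (carrier G // twisted_conj G \<phi>)"

definition property_R_infinity :: "('g, 'b) monoid_scheme \<Rightarrow> bool" where
  "property_R_infinity G \<longleftrightarrow> (\<forall>\<phi>\<in>iso G G. reidemeister_infinite G \<phi>)"

(* F_q[t, f_1^{-1}, ..., f_m^{-1}] as a subring of the fraction field F_q(t) *)
definition loc_poly_ring :: "'f::{field,finite} poly list \<Rightarrow> 'f poly fract set" where
  "loc_poly_ring fs = {Fract p (\<Prod>i<length fs. (fs ! i) ^ e i) | p e. True}"

definition ring_iso_to :: "('a::comm_ring_1 \<Rightarrow> 'b::comm_ring_1) \<Rightarrow> 'b set \<Rightarrow> bool" where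
  "ring_iso_to h S \<longleftrightarrow> bij_betw h UNIV S \<and> h 1 = 1 \<and>
     (\<forall>x y. h (x + y) = h x + h y) \<and> (\<forall>x y. h (x * y) = h x * h y)"

end

theory Submission
  imports Defs
begin

text \<open>
  Let \<open>\<phi>\<close> be an automorphism of the triangular group and \<open>U\<close> its unitriangular part. The subgroup \<open>F\<close>
  generated by \<open>U\<close> and the scalars in the group consists of the left Engel elements, so \<open>\<phi>\<close> acts on \<open>F\<close> and
  on its second centre. The commutator pairing of these two groups takes values in the root group \<open>E 1 n\<close>
  and only sees the first and the last superdiagonal entry of elements of \<open>F\<close>. Comparing torus weights
  (this uses the (NG)-condition, \<open>n \<ge> 4\<close> and a unit different from 1) shows that \<open>\<phi>\<close> preserves or swaps these
  two entries, and the bilinearity of the pairing forces it to act on both by one and the same ring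
  automorphism \<open>\<sigma>\<close> of \<open>R\<close>, up to unit factors.

  Finitely many twisted classes would make the image of \<open>1 - \<sigma>\<close> (or \<open>1 - \<sigma>\<^sup>2\<close> in case of a swap) of finite index
  in the additive group of \<open>R\<close>: the unit factor is removed by a twist with a torus element, and only finitely
  many torus parts of conjugating elements matter. This is impossible for an infinite finitely generated
  domain \<open>R\<close>. Indeed, the ideals \<open>K\<^sub>k\<close> generated by all \<open>x ^ Suc k - x\<close> are invariant and of finite index, and they contain
  strictly descending chains of arbitrary length, because \<open>R\<close> is residually finite. The identity elements
  of the ideals in such a chain, taken modulo the smallest one, are fixed by \<open>\<sigma>\<close>, and in a finite
  abelian group the kernel and the cokernel of \<open>1 - \<sigma>\<close> have the same size.
\<close>

section \<open>Residual finiteness of finitely generated domains\<close>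

text \<open>Finite generation of the group passes to the ring: the matrix entries of finitely many
  generators and their inverses generate \<open>R\<close>. About \<open>\<sigma>\<close> nothing is
  known except that it is an automorphism, so no single maximal ideal can be assumed invariant. This
  is why the finite quotients are cut out by an identity. If \<open>x ^ Suc k = x\<close> holds in a
  finite ring with \<open>k \<ge> 1\<close>, the ring is reduced, hence a product of finite fields,
  and each of its ideals has a unique identity element; uniqueness makes these elements fixed.
  Residual finiteness is proved by adjoining ring generators one at a time. The induction needs more
  than an ideal avoiding a given element: the element has to be cancellable modulo the ideal. The
  comparison of kernel and cokernel is used twice. Before its additive use it is applied to the unit
  group, where it shows that \<open>\<sigma>\<close> (or \<open>\<sigma> \<circ> \<sigma>\<close>)
  fixes only finitely many units; this bounds the torus parts of the conjugating elements.\<close>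

definition sub_ring :: "'a::comm_ring_1 set \<Rightarrow> bool" where
  "sub_ring A \<longleftrightarrow> 1 \<in> A \<and> (\<forall>x\<in>A. \<forall>y\<in>A. x + y \<in> A \<and> x * y \<in> A \<and> - x \<in> A)"

definition ideal_in :: "'a::comm_ring_1 set \<Rightarrow> 'a set \<Rightarrow> bool" where
  "ideal_in A M \<longleftrightarrow> M \<subseteq> A \<and> 0 \<in> M \<and> (\<forall>x\<in>M. \<forall>y\<in>M. x + y \<in> M) \<and> (\<forall>a\<in>A. \<forall>x\<in>M. a * x \<in> M)"

definition fin_index :: "'a::comm_ring_1 set \<Rightarrow> 'a set \<Rightarrow> bool" where
  "fin_index A M \<longleftrightarrow> (\<exists>W. finite W \<and> W \<subseteq> A \<and> (\<forall>z\<in>A. \<exists>w\<in>W. z - w \<in> M))"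

definition polys_over :: "'a::zero set \<Rightarrow> 'a poly set" where
  "polys_over N = {P. \<forall>i. coeff P i \<in> N}"

definition adjoin :: "'a::comm_ring_1 set \<Rightarrow> 'a \<Rightarrow> 'a set" where
  "adjoin A x = (\<lambda>P. poly P x) ` polys_over A"

primrec gen_ring :: "'a::comm_ring_1 list \<Rightarrow> 'a set" where
  "gen_ring [] = range of_int"
| "gen_ring (x # xs) = adjoin (gen_ring xs) x"

text \<open>Stronger than \<open>a \<notin> M\<close>: multiplication by \<open>a\<close> is
  injective modulo \<open>M\<close>, so no power of \<open>a\<close> lies in \<open>M\<close>. The
  ideal need not be prime or radical; only this cancellation has to survive the adjunction of an
  element.\<close>

definition residual :: "'a::comm_ring_1 set \<Rightarrow> bool" where
  "residual A \<longleftrightarrow> (\<forall>a\<in>A. a \<noteq> 0 \<longrightarrow> (\<exists>M. ideal_in A M \<and> fin_index A M \<and> 1 \<notin> M \<and>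
     (\<forall>z\<in>A. a * z \<in> M \<longrightarrow> z \<in> M)))"

section \<open>Closure properties of subrings, ideals and polynomials over them\<close>

lemma sub_ring_one: "sub_ring A \<Longrightarrow> 1 \<in> A"
  and sub_ring_add: "sub_ring A \<Longrightarrow> x \<in> A \<Longrightarrow> y \<in> A \<Longrightarrow> x + y \<in> A"
  and sub_ring_mult: "sub_ring A \<Longrightarrow> x \<in> A \<Longrightarrow> y \<in> A \<Longrightarrow> x * y \<in> A"
  and sub_ring_uminus: "sub_ring A \<Longrightarrow> x \<in> A \<Longrightarrow> - x \<in> A"
  by (auto simp: sub_ring_def)

lemma sub_ring_zero: "sub_ring A \<Longrightarrow> 0 \<in> A"
  using sub_ring_add[of A 1 "-1"] sub_ring_one sub_ring_uminus by fastforce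

lemma sub_ring_power: "sub_ring A \<Longrightarrow> x \<in> A \<Longrightarrow> x ^ k \<in> A"
  by (induction k) (auto intro: sub_ring_one sub_ring_mult)

lemma sub_ring_sum: "sub_ring A \<Longrightarrow> (\<And>i. i \<in> I \<Longrightarrow> f i \<in> A) \<Longrightarrow> sum f I \<in> A"
  by (induction I rule: infinite_finite_induct) (auto intro: sub_ring_zero sub_ring_add)

lemma ideal_in_sub: "ideal_in A M \<Longrightarrow> x \<in> M \<Longrightarrow> x \<in> A"
  and ideal_in_zero: "ideal_in A M \<Longrightarrow> 0 \<in> M"
  and ideal_in_add: "ideal_in A M \<Longrightarrow> x \<in> M \<Longrightarrow> y \<in> M \<Longrightarrow> x + y \<in> M"
  and ideal_in_mult: "ideal_in A M \<Longrightarrow> a \<in> A \<Longrightarrow> x \<in> M \<Longrightarrow> a * x \<in> M"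
  and ideal_in_mult': "ideal_in A M \<Longrightarrow> a \<in> A \<Longrightarrow> x \<in> M \<Longrightarrow> x * a \<in> M"
  by (auto simp: ideal_in_def mult.commute)

lemma ideal_in_uminus: "sub_ring A \<Longrightarrow> ideal_in A M \<Longrightarrow> x \<in> M \<Longrightarrow> - x \<in> M"
  using ideal_in_mult[of A M "-1" x] sub_ring_one sub_ring_uminus by fastforce

lemma ideal_in_diff: "sub_ring A \<Longrightarrow> ideal_in A M \<Longrightarrow> x \<in> M \<Longrightarrow> y \<in> M \<Longrightarrow> x - y \<in> M"
  using ideal_in_add[of A M x "-y"] ideal_in_uminus by fastforce

lemma ideal_in_sum: "ideal_in A M \<Longrightarrow> (\<And>i. i \<in> I \<Longrightarrow> f i \<in> M) \<Longrightarrow> sum f I \<in> M"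
  by (induction I rule: infinite_finite_induct) (auto intro: ideal_in_zero ideal_in_add)

lemma ideal_in_self: "sub_ring A \<Longrightarrow> ideal_in A A"
  by (auto simp: ideal_in_def intro: sub_ring_zero sub_ring_add sub_ring_mult)

lemma sub_ring_UNIV: "sub_ring UNIV"
  by (simp add: sub_ring_def)

lemma polys_over_add: "ideal_in A N \<Longrightarrow> P \<in> polys_over N \<Longrightarrow> Q \<in> polys_over N \<Longrightarrow> P + Q \<in> polys_over N"
  by (auto simp: polys_over_def intro: ideal_in_add)

lemma polys_over_diff:
  "sub_ring A \<Longrightarrow> ideal_in A N \<Longrightarrow> P \<in> polys_over N \<Longrightarrow> Q \<in> polys_over N \<Longrightarrow> P - Q \<in> polys_over N"
  by (auto simp: polys_over_def intro: ideal_in_diff)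

lemma polys_over_mult:
  "ideal_in A N \<Longrightarrow> P \<in> polys_over N \<Longrightarrow> Q \<in> polys_over A \<Longrightarrow> P * Q \<in> polys_over N"
  by (auto simp: polys_over_def coeff_mult intro!: ideal_in_sum ideal_in_mult')

lemma polys_over_smult:
  "ideal_in A N \<Longrightarrow> P \<in> polys_over N \<Longrightarrow> a \<in> A \<Longrightarrow> smult a P \<in> polys_over N"
  by (auto simp: polys_over_def intro!: ideal_in_mult)

lemma polys_over_monom:
  "ideal_in A N \<Longrightarrow> c \<in> N \<Longrightarrow> monom c k \<in> polys_over N"
  by (auto simp: polys_over_def ideal_in_zero)

lemma polys_over_const:
  "ideal_in A N \<Longrightarrow> c \<in> N \<Longrightarrow> [:c:] \<in> polys_over N"
  using polys_over_monom[of A N c 0] by (simp add: monom_0)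

lemma polys_over_zero: "ideal_in A N \<Longrightarrow> 0 \<in> polys_over N"
  by (auto simp: polys_over_def ideal_in_zero)

lemma adjoinI: "P \<in> polys_over A \<Longrightarrow> poly P x \<in> adjoin A x"
  by (auto simp: adjoin_def)

lemma sub_ring_adjoin:
  assumes "sub_ring A"
  shows "sub_ring (adjoin A x)"
proof -
  note A = ideal_in_self[OF assms]
  have 1: "1 \<in> adjoin A x"
    using adjoinI[OF polys_over_const[OF A sub_ring_one[OF assms]], of x] by simp
  have "poly P x + poly Q x \<in> adjoin A x" "poly P x * poly Q x \<in> adjoin A x" "- poly P x \<in> adjoin A x"
    if "P \<in> polys_over A" "Q \<in> polys_over A" for P Q
    using adjoinI[OF polys_over_add[OF A that], of x] adjoinI[OF polys_over_mult[OF A that], of x]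
      adjoinI[OF polys_over_diff[OF assms A polys_over_zero[OF A] that(1)], of x] by simp_all
  then show ?thesis using 1 by (auto simp: sub_ring_def adjoin_def)
qed

lemma adjoin_base: "sub_ring A \<Longrightarrow> a \<in> A \<Longrightarrow> a \<in> adjoin A x"
  using adjoinI[OF polys_over_const[OF ideal_in_self], of A a x] by simp

lemma adjoin_elem: "sub_ring A \<Longrightarrow> x \<in> adjoin A x"
  using adjoinI[OF polys_over_monom[OF ideal_in_self, of A 1 1], of x]
  by (simp add: sub_ring_one poly_monom)

lemma sub_ring_gen_ring: "sub_ring (gen_ring xs)"
proof (induction xs)
  case Nil
  have "of_int x + of_int y \<in> range (of_int :: int \<Rightarrow> 'a)" "of_int x * of_int y \<in> range (of_int :: int \<Rightarrow> 'a)"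
    "- of_int x \<in> range (of_int :: int \<Rightarrow> 'a)" "1 \<in> range (of_int :: int \<Rightarrow> 'a)" for x y
    by (metis of_int_add range_eqI, metis of_int_mult range_eqI, metis of_int_minus range_eqI, metis of_int_1 range_eqI)
  then show ?case by (auto simp: sub_ring_def)
qed (simp add: sub_ring_adjoin)

lemma gen_ring_contains: "set xs \<subseteq> gen_ring xs"
  by (induction xs) (auto intro: adjoin_base sub_ring_gen_ring adjoin_elem)

section \<open>Division with remainder and extension of ideals to an adjoined element\<close>

text \<open>Each step multiplies by the leading coefficient of \<open>m\<close>, so that the top
  terms cancel although \<open>m\<close> is not monic. Quotient and remainder stay over the ideal
  \<open>N\<close> when \<open>P\<close> is over \<open>N\<close>; this is what later shows that an
  extended ideal is proper.\<close>

lemma pseudo_division: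
  fixes m :: "'a::idom poly"
  assumes A: "sub_ring A" and N: "ideal_in A N" and m: "m \<in> polys_over A" "degree m \<ge> 1"
    and P: "P \<in> polys_over N"
  shows "\<exists>k. \<exists>Q\<in>polys_over N. \<exists>S\<in>polys_over N.
    smult (lead_coeff m ^ k) P = Q * m + S \<and> degree S < degree m"
  using P
proof (induction "degree P" arbitrary: P rule: less_induct)
  case less
  let ?l = "lead_coeff m"
  have l: "?l \<in> A" using m by (auto simp: polys_over_def)
  show ?case
  proof (cases "degree P < degree m")
    case True
    then show ?thesis using less.prems polys_over_zero[OF N]
      by (intro exI[of _ 0] bexI[of _ 0] bexI[of _ P]) auto
  next
    case False
    let ?q = "monom (lead_coeff P) (degree P - degree m)"
    have q: "?q \<in> polys_over N"
      using less.prems by (intro polys_over_monom[OF N]) (auto simp: polys_over_def)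
    define P' where "P' = smult ?l P - ?q * m"
    have P': "P' \<in> polys_over N"
      unfolding P'_def by (intro polys_over_diff[OF A N] polys_over_smult[OF N] polys_over_mult[OF N] q m less.prems l)
    have m0: "m \<noteq> 0" using m by auto
    have P0: "P \<noteq> 0" using False m by auto
    have le: "degree P' \<le> degree P"
      unfolding P'_def
      using False degree_mult_le[of ?q m] degree_monom_le[of "lead_coeff P" "degree P - degree m"]
      by (intro degree_diff_le) (auto simp: degree_smult_le intro: order_trans)
    have c0: "coeff P' (degree P) = 0"
      unfolding P'_def using False by (simp add: coeff_monom_mult)
    have lt: "degree P' < degree P"
    proof (rule ccontr)
      assume "\<not> degree P' < degree P"
      then have "degree P' = degree P" using le by simp
      then have "P' = 0" using c0 by (metis leading_coeff_0_iff)
      then show False using \<open>degree P' = degree P\<close> False m by simp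
    qed
    obtain k Q S where *: "Q \<in> polys_over N" "S \<in> polys_over N"
      "smult (?l ^ k) P' = Q * m + S" "degree S < degree m"
      using less.hyps[OF lt P'] by blast
    have "smult (?l ^ Suc k) P = smult (?l ^ k) P' + smult (?l ^ k) (?q * m)"
      unfolding P'_def by (simp add: smult_diff_right mult.commute)
    also have "\<dots> = (Q + smult (?l ^ k) ?q) * m + S"
      by (simp add: * algebra_simps)
    finally show ?thesis
      using * polys_over_add[OF N *(1) polys_over_smult[OF N q sub_ring_power[OF A l]]] by blast
  qed
qed

text \<open>Replaces inversion in the fraction field. Among the polynomials whose value at
  \<open>x\<close> is a non-zero multiple of \<open>f\<close>, one of least degree is constant:
  otherwise a Euclidean step against \<open>m\<close> would produce either a smaller one or a
  polynomial of degree below \<open>degree m\<close> vanishing at \<open>x\<close>.\<close>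

lemma algebraic_divides_const:
  fixes x :: "'a::idom"
  assumes A: "sub_ring A" and m: "m \<in> polys_over A" "m \<noteq> 0" "poly m x = 0"
    and min: "\<And>P. P \<in> polys_over A \<Longrightarrow> P \<noteq> 0 \<Longrightarrow> poly P x = 0 \<Longrightarrow> degree m \<le> degree P"
    and f: "f \<in> adjoin A x" "f \<noteq> 0"
  shows "\<exists>c\<in>A. c \<noteq> 0 \<and> (\<exists>h\<in>adjoin A x. h * f = c)"
proof -
  note AA = ideal_in_self[OF A]
  note sr = sub_ring_adjoin[OF A, of x]
  have d1: "degree m \<ge> 1"
  proof (rule ccontr)
    assume "\<not> ?thesis"
    then obtain c where "m = [:c:]" by (metis degree_eq_zeroE not_one_le_zero less_one not_le)
    then show False using m by simp
  qed
  define X where "X = {G \<in> polys_over A. poly G x \<noteq> 0 \<and> (\<exists>h\<in>adjoin A x. poly G x = h * f)}"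
  obtain F where F: "F \<in> polys_over A" "f = poly F x" using f by (auto simp: adjoin_def)
  have "F \<in> X" using F f sub_ring_one[OF sr] by (auto simp: X_def intro!: bexI[of _ 1])
  then obtain G where G: "G \<in> X" "\<And>G'. G' \<in> X \<Longrightarrow> degree G \<le> degree G'"
    by (metis arg_min_natI arg_min_nat_le[of "\<lambda>z. z \<in> X" _ degree])
  then have GA: "G \<in> polys_over A" and Gx: "poly G x \<noteq> 0" by (auto simp: X_def)
  obtain h where h: "h \<in> adjoin A x" "poly G x = h * f" using G by (auto simp: X_def)
  have lm: "lead_coeff m \<in> A" "lead_coeff G \<in> A" using m GA by (auto simp: polys_over_def)
  obtain k Q S where S: "Q \<in> polys_over A" "S \<in> polys_over A"
      "smult (lead_coeff m ^ k) G = Q * m + S" "degree S < degree m"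
    using pseudo_division[OF A AA m(1) d1 GA] by blast
  have "poly S x = lead_coeff m ^ k * (h * f)"
    using arg_cong[OF S(3), of "\<lambda>p. poly p x"] m h by simp
  moreover have "lead_coeff m ^ k * h \<in> adjoin A x"
    using h lm by (intro sub_ring_mult[OF sr] sub_ring_power[OF sr] adjoin_base[OF A lm(1)])
  ultimately have "S \<in> X" using S Gx h m unfolding X_def by (auto simp: mult.assoc[symmetric])
  then have Gd: "degree G < degree m" using G(2)[of S] S by simp
  show ?thesis
  proof (cases "degree G = 0")
    case True
    then obtain c where c: "G = [:c:]" by (metis degree_eq_zeroE)
    then have "c \<in> A" using GA by (auto simp: polys_over_def dest: spec[of _ 0])
    then show ?thesis using c h Gx by (intro bexI[of _ c]) auto
  next
    case False
    then obtain k Q S where S: "Q \<in> polys_over A" "S \<in> polys_over A"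
      "smult (lead_coeff G ^ k) m = Q * G + S" "degree S < degree G"
      using pseudo_division[OF A AA GA _ m(1)] by force
    have Sx: "poly S x = - poly Q x * poly G x"
      using arg_cong[OF S(3), of "\<lambda>p. poly p x"] m by (simp add: add_eq_0_iff2)
    have S0: "poly S x = 0"
    proof (rule ccontr)
      assume "poly S x \<noteq> 0"
      moreover have "poly S x = (- poly Q x * h) * f" using Sx h by simp
      moreover have "- poly Q x * h \<in> adjoin A x"
        using S h by (intro sub_ring_mult[OF sr] sub_ring_uminus[OF sr] adjoinI)
      ultimately have "S \<in> X" using S unfolding X_def by blast
      then show False using G(2)[of S] S by simp
    qed
    then have "poly Q x = 0" using Sx Gx by simp
    have "S = 0" using min[OF S(2) _ S0] S Gd by force
    have G0: "G \<noteq> 0" using False by auto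
    then have "Q \<noteq> 0" using S \<open>S = 0\<close> m by auto
    then have "degree m = degree Q + degree G"
      using arg_cong[OF S(3), of degree] \<open>S = 0\<close> G0 by (simp add: degree_mult_eq)
    moreover have "degree m \<le> degree Q" using min[OF S(1) \<open>Q \<noteq> 0\<close> \<open>poly Q x = 0\<close>] .
    ultimately show ?thesis using False by simp
  qed
qed


text \<open>The ideal lying over \<open>M\<close> in \<open>A[x]\<close>: the contraction of the ideal generated by \<open>M\<close> and \<open>m(x)\<close>
  in the localisation at \<open>e\<close>.\<close>

definition over_ideal :: "'a::comm_ring_1 set \<Rightarrow> 'a \<Rightarrow> 'a set \<Rightarrow> 'a \<Rightarrow> 'a poly \<Rightarrow> 'a set" where
  "over_ideal A x M e m = {z \<in> adjoin A x. \<exists>k. \<exists>Y\<in>polys_over M. \<exists>Q\<in>polys_over A.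
     e ^ k * z = poly Y x + poly Q x * poly m x}"

lemma ideal_in_over_ideal:
  fixes x :: "'a::idom"
  assumes A: "sub_ring A" and M: "ideal_in A M" and e: "e \<in> A" and m: "m \<in> polys_over A"
  shows "ideal_in (adjoin A x) (over_ideal A x M e m)"
proof -
  note AA = ideal_in_self[OF A]
  note sr = sub_ring_adjoin[OF A, of x]
  let ?J = "over_ideal A x M e m"
  have 0: "0 \<in> ?J" unfolding over_ideal_def
    using polys_over_zero[OF M] polys_over_zero[OF AA] sub_ring_zero[OF sr]
    by (auto intro!: exI[of _ 0] bexI[of _ 0])
  have add: "z + z' \<in> ?J" if z: "z \<in> ?J" "z' \<in> ?J" for z z'
  proof -
    obtain k Y Q where 1: "Y \<in> polys_over M" "Q \<in> polys_over A" "e ^ k * z = poly Y x + poly Q x * poly m x"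
      using z(1) by (auto simp: over_ideal_def)
    obtain k' Y' Q' where 2: "Y' \<in> polys_over M" "Q' \<in> polys_over A" "e ^ k' * z' = poly Y' x + poly Q' x * poly m x"
      using z(2) by (auto simp: over_ideal_def)
    have "e ^ (k + k') * (z + z') = e ^ k' * (e ^ k * z) + e ^ k * (e ^ k' * z')"
      by (simp add: power_add algebra_simps)
    also have "\<dots> = poly (smult (e ^ k') Y + smult (e ^ k) Y') x + poly (smult (e ^ k') Q + smult (e ^ k) Q') x * poly m x"
      unfolding 1(3) 2(3) by (simp add: algebra_simps)
    finally have eq: "e ^ (k + k') * (z + z') = \<dots>" .
    have "smult (e ^ k') Y + smult (e ^ k) Y' \<in> polys_over M"
      by (intro polys_over_add[OF M] polys_over_smult[OF M] 1 2 sub_ring_power[OF A e])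
    moreover have "smult (e ^ k') Q + smult (e ^ k) Q' \<in> polys_over A"
      by (intro polys_over_add[OF AA] polys_over_smult[OF AA] 1 2 sub_ring_power[OF A e])
    moreover have "z + z' \<in> adjoin A x" using z by (auto simp: over_ideal_def intro: sub_ring_add[OF sr])
    ultimately show ?thesis using eq unfolding over_ideal_def by blast
  qed
  have mult: "a * z \<in> ?J" if a: "a \<in> adjoin A x" and z: "z \<in> ?J" for a z
  proof -
    obtain k Y Q where 1: "Y \<in> polys_over M" "Q \<in> polys_over A" "e ^ k * z = poly Y x + poly Q x * poly m x"
      using z(1) by (auto simp: over_ideal_def)
    obtain P where P: "P \<in> polys_over A" "a = poly P x" using a by (auto simp: adjoin_def)
    have "e ^ k * (a * z) = a * (e ^ k * z)" by (simp add: algebra_simps)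
    also have "\<dots> = poly (Y * P) x + poly (Q * P) x * poly m x"
      unfolding 1(3) P(2) by (simp add: algebra_simps)
    finally have "e ^ k * (a * z) = \<dots>" .
    moreover have "Y * P \<in> polys_over M" "Q * P \<in> polys_over A"
      by (intro polys_over_mult[OF M] polys_over_mult[OF AA] 1 P)+
    moreover have "a * z \<in> adjoin A x" using z a by (auto simp: over_ideal_def intro: sub_ring_mult[OF sr])
    ultimately show ?thesis unfolding over_ideal_def by blast
  qed
  show ?thesis unfolding ideal_in_def using 0 add mult by (auto simp: over_ideal_def)
qed

lemma over_ideal_saturated:
  assumes A: "sub_ring A" and z: "z \<in> adjoin A x" "e * z \<in> over_ideal A x M e m"
  shows "z \<in> over_ideal A x M e m"
proof -
  obtain k Y Q where 1: "Y \<in> polys_over M" "Q \<in> polys_over A"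
      "e ^ k * (e * z) = poly Y x + poly Q x * poly m x"
    using z(2) by (auto simp: over_ideal_def)
  then have "e ^ Suc k * z = poly Y x + poly Q x * poly m x" by (simp add: mult.assoc mult.left_commute)
  then show ?thesis using 1 z(1) unfolding over_ideal_def by blast
qed

text \<open>A set of pairwise incongruent elements that cannot be enlarged represents every class;
  the bound \<open>N\<close> guarantees that one of greatest size exists.\<close>

lemma fin_indexI_card:
  assumes A: "sub_ring A" and M: "ideal_in A M"
    and N: "\<And>T. T \<subseteq> A \<Longrightarrow> finite T \<Longrightarrow> card T > N \<Longrightarrow> \<exists>s\<in>T. \<exists>t\<in>T. s \<noteq> t \<and> s - t \<in> M"
  shows "fin_index A M"
proof -
  define P where "P T \<longleftrightarrow> T \<subseteq> A \<and> finite T \<and> (\<forall>s\<in>T. \<forall>t\<in>T. s \<noteq> t \<longrightarrow> s - t \<notin> M)" for T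
  have bd: "card T < Suc N" if "P T" for T
    using N[of T] that unfolding P_def by (meson not_less_eq)
  have "P {}" by (simp add: P_def)
  then obtain T where T': "P T" and max: "\<And>T'. P T' \<Longrightarrow> card T' \<le> card T"
    using ex_has_greatest_nat[of P "{}" card "Suc N"] bd by auto
  note T = T'[unfolded P_def]
  have "\<exists>w\<in>T. z - w \<in> M" if z: "z \<in> A" for z
  proof (rule ccontr)
    assume *: "\<not> (\<exists>w\<in>T. z - w \<in> M)"
    then have zT: "z \<notin> T" using ideal_in_zero[OF M] by force
    have "w - z \<notin> M" if "w \<in> T" for w
      using * that ideal_in_uminus[OF A M, of "w - z"] by auto
    then have "P (insert z T)" using T z * unfolding P_def by auto
    then have "card (insert z T) \<le> card T" using max by blast
    then show False using zT T by simp
  qed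
  then show ?thesis unfolding fin_index_def using T by blast
qed

text \<open>The power of the leading coefficient needed to reduce \<open>z\<close> modulo
  \<open>m\<close> depends on \<open>z\<close>, so no uniform system of representatives is at hand.
  The counting criterion looks at finitely many elements at a time: they share an exponent
  \<open>k\<close>, their remainders show at most \<open>card D\<close> coefficient patterns modulo
  \<open>M\<close>, and saturation cancels \<open>e ^ k\<close> from the difference of two elements
  with equal pattern.\<close>

lemma fin_index_over_ideal:
  fixes x :: "'a::idom"
  assumes A: "sub_ring A" and M: "ideal_in A M" and MF: "fin_index A M"
    and e: "e \<in> A" "e = lead_coeff m * c" and c: "c \<in> A" and m: "m \<in> polys_over A" "degree m \<ge> 1"
  shows "fin_index (adjoin A x) (over_ideal A x M e m)"
proof -
  note AA = ideal_in_self[OF A]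
  note sr = sub_ring_adjoin[OF A, of x]
  note J = ideal_in_over_ideal[OF A M e(1) m(1), of x]
  let ?J = "over_ideal A x M e m" and ?l = "lead_coeff m"
  have l: "?l \<in> A" using m by (auto simp: polys_over_def)
  obtain W where W: "finite W" "W \<subseteq> A" "\<forall>z\<in>A. \<exists>w\<in>W. z - w \<in> M"
    using MF by (auto simp: fin_index_def)
  then obtain g where g: "\<And>z. z \<in> A \<Longrightarrow> g z \<in> W \<and> z - g z \<in> M" by metis
  define D where "D = {..<degree m} \<rightarrow>\<^sub>E W"
  have D: "finite D" unfolding D_def using W by (intro finite_PiE) auto
  have red: "\<exists>S\<in>polys_over A. degree S < degree m \<and> e ^ k * z - poly S x \<in> ?J" 
    if z: "z \<in> adjoin A x" and k: "\<exists>Q\<in>polys_over A. \<exists>S\<in>polys_over A. ?l ^ k * z = poly Q x * poly m x + poly S x \<and> degree S < degree m" for z k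
  proof -
    obtain Q S where 1: "Q \<in> polys_over A" "S \<in> polys_over A" "?l ^ k * z = poly Q x * poly m x + poly S x" "degree S < degree m"
      using k by blast
    \<comment> \<open>The factor \<open>c ^ k\<close> turns the power of the leading coefficient
      into \<open>e ^ k\<close>.\<close>
    have "e ^ 0 * (e ^ k * z - poly (smult (c ^ k) S) x) = c ^ k * (?l ^ k * z) - poly (smult (c ^ k) S) x"
      using e by (simp add: power_mult_distrib mult_ac)
    also have "\<dots> = poly 0 x + poly (smult (c ^ k) Q) x * poly m x"
      unfolding 1(3) by (simp add: algebra_simps)
    finally have eq: "e ^ 0 * (e ^ k * z - poly (smult (c ^ k) S) x) = \<dots>" .
    have s: "smult (c ^ k) S \<in> polys_over A" "smult (c ^ k) Q \<in> polys_over A"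
      by (intro polys_over_smult[OF AA] 1 sub_ring_power[OF A c])+
    have "e ^ k * z - poly (smult (c ^ k) S) x \<in> adjoin A x"
      using ideal_in_diff[OF sr ideal_in_self[OF sr] sub_ring_mult[OF sr sub_ring_power[OF sr adjoin_base[OF A e(1)]] z] adjoinI[OF s(1)]] .
    then have "e ^ k * z - poly (smult (c ^ k) S) x \<in> ?J"
      unfolding over_ideal_def using eq s polys_over_zero[OF M] by blast
    then show ?thesis using s 1 degree_smult_le[of "c ^ k" S] by (intro bexI[of _ "smult (c ^ k) S"]) auto
  qed
  have ex: "\<exists>k. \<exists>Q\<in>polys_over A. \<exists>S\<in>polys_over A. ?l ^ k * z = poly Q x * poly m x + poly S x \<and> degree S < degree m"
    if z: "z \<in> adjoin A x" for z
  proof -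
    obtain P where P: "P \<in> polys_over A" "z = poly P x" using z by (auto simp: adjoin_def)
    obtain k Q S where QS: "Q \<in> polys_over A" "S \<in> polys_over A"
      "smult (?l ^ k) P = Q * m + S" "degree S < degree m"
      using pseudo_division[OF A AA m P(1)] by blast
    have "?l ^ k * z = poly Q x * poly m x + poly S x"
      using arg_cong[OF QS(3), of "\<lambda>p. poly p x"] P(2) by simp
    then show ?thesis using QS by blast
  qed
  have mono: "\<exists>Q\<in>polys_over A. \<exists>S\<in>polys_over A. ?l ^ (k + j) * z = poly Q x * poly m x + poly S x \<and> degree S < degree m"
    if k: "\<exists>Q\<in>polys_over A. \<exists>S\<in>polys_over A. ?l ^ k * z = poly Q x * poly m x + poly S x \<and> degree S < degree m" for z k j
  proof -
    obtain Q S where 1: "Q \<in> polys_over A" "S \<in> polys_over A" "?l ^ k * z = poly Q x * poly m x + poly S x" "degree S < degree m"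
      using k by blast
    have "?l ^ (k + j) * z = ?l ^ j * (?l ^ k * z)" by (simp add: power_add)
    also have "\<dots> = poly (smult (?l ^ j) Q) x * poly m x + poly (smult (?l ^ j) S) x"
      unfolding 1(3) by (simp add: algebra_simps)
    finally show ?thesis
      using polys_over_smult[OF AA _ sub_ring_power[OF A l], of _ j] 1 degree_smult_le[of "?l ^ j" S]
      by (meson le_less_trans)
  qed
  show ?thesis
  proof (rule fin_indexI_card[OF sr J, of "card D"])
    fix T assume T: "T \<subseteq> adjoin A x" "finite T" "card T > card D"
    obtain kk where kk: "\<And>z. z \<in> T \<Longrightarrow> \<exists>Q\<in>polys_over A. \<exists>S\<in>polys_over A. ?l ^ kk z * z = poly Q x * poly m x + poly S x \<and> degree S < degree m"
      using ex T(1) by (metis subsetD)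
    define k where "k = sum kk T"
    have "\<exists>Q\<in>polys_over A. \<exists>S\<in>polys_over A. ?l ^ k * z = poly Q x * poly m x + poly S x \<and> degree S < degree m" if "z \<in> T" for z
      using mono[OF kk[OF that], of "k - kk z"] member_le_sum[OF that, of kk] T(2) by (simp add: k_def)
    then have "\<exists>S\<in>polys_over A. degree S < degree m \<and> e ^ k * z - poly S x \<in> ?J" if "z \<in> T" for z
      using red T(1) that by blast
    then obtain SS where SS: "\<And>z. z \<in> T \<Longrightarrow> SS z \<in> polys_over A \<and> degree (SS z) < degree m \<and> e ^ k * z - poly (SS z) x \<in> ?J"
      by metis
    define h where "h z = (\<lambda>i\<in>{..<degree m}. g (coeff (SS z) i))" for z
    have "h z \<in> D" if "z \<in> T" for z
      unfolding h_def D_def using SS[OF that] g by (intro restrict_PiE_iff[THEN iffD2]) (auto simp: polys_over_def)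
    then have "h ` T \<subseteq> D" by blast
    then have "\<not> inj_on h T" using card_inj_on_le[of h T D] D T by auto
    then obtain s t where st: "s \<in> T" "t \<in> T" "s \<noteq> t" "h s = h t" by (auto simp: inj_on_def)
    have "coeff (SS s - SS t) i \<in> M" for i
    proof (cases "i < degree m")
      case True
      have "g (coeff (SS s) i) = g (coeff (SS t) i)" using fun_cong[OF st(4), of i] True by (simp add: h_def)
      moreover have "coeff (SS s) i - g (coeff (SS s) i) \<in> M" "coeff (SS t) i - g (coeff (SS t) i) \<in> M"
        using g SS st by (auto simp: polys_over_def)
      ultimately show ?thesis using ideal_in_diff[OF A M] by fastforce
    next
      case False
      then show ?thesis using SS[OF st(1)] SS[OF st(2)] ideal_in_zero[OF M] by (simp add: coeff_eq_0)
    qed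
    then have d: "SS s - SS t \<in> polys_over M" by (simp add: polys_over_def)
    then have dA: "SS s - SS t \<in> polys_over A" using ideal_in_sub[OF M] by (auto simp: polys_over_def)
    have "poly (SS s - SS t) x \<in> ?J"
      unfolding over_ideal_def using d adjoinI[OF dA, of x] polys_over_zero[OF AA]
      by (intro CollectI conjI exI[of _ 0] bexI[of _ "SS s - SS t"] bexI[of _ 0]) auto
    then have "(e ^ k * s - poly (SS s) x) - (e ^ k * t - poly (SS t) x) + poly (SS s - SS t) x \<in> ?J"
      using SS[OF st(1)] SS[OF st(2)]
      by (intro ideal_in_add[OF J _ \<open>poly (SS s - SS t) x \<in> ?J\<close>]
          ideal_in_diff[OF sr J, of "e ^ k * s - poly (SS s) x" "e ^ k * t - poly (SS t) x"]) blast+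
    then have "e ^ k * (s - t) \<in> ?J" by (simp add: algebra_simps)
    moreover have "e ^ k * z \<in> ?J \<Longrightarrow> z \<in> adjoin A x \<Longrightarrow> z \<in> ?J" for z k
    proof (induction k)
      case (Suc k)
      then show ?case
        using over_ideal_saturated[OF A, of "e ^ k * z" x e M m]
          sub_ring_mult[OF sr sub_ring_power[OF sr adjoin_base[OF A e(1)]]] by (simp add: mult.assoc)
    qed simp
    moreover have "s - t \<in> adjoin A x" using st T ideal_in_diff[OF sr ideal_in_self[OF sr]] by blast
    ultimately show "\<exists>s\<in>T. \<exists>t\<in>T. s \<noteq> t \<and> s - t \<in> ?J" using st by blast
  qed
qed

lemma saturated_power_notin:
  assumes "sub_ring A" "e \<in> A" "1 \<notin> M" "\<And>z. z \<in> A \<Longrightarrow> e * z \<in> M \<Longrightarrow> z \<in> M"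
  shows "e ^ k \<notin> M"
  by (induction k) (use assms sub_ring_power[OF assms(1,2)] in auto)

text \<open>For algebraic \<open>x\<close> the element \<open>e\<close> combines the leading
  coefficient of \<open>m\<close> with a constant multiple \<open>c\<close> of \<open>f\<close>;
  cancelling \<open>e\<close> then implies cancelling \<open>f\<close>. For transcendental
  \<open>x\<close> a relation is imposed instead. In both cases the point is
  \<open>1 \<notin> ?J\<close>, which is reduced to the coefficients, where the saturation of
  \<open>M\<close> applies.\<close>

lemma residual_adjoin:
  fixes x :: "'a::idom"
  assumes A: "sub_ring A" and R: "residual A"
  shows "residual (adjoin A x)"
  unfolding residual_def
proof (intro ballI impI)
  note AA = ideal_in_self[OF A]
  note sr = sub_ring_adjoin[OF A, of x]
  fix f assume f: "f \<in> adjoin A x" "f \<noteq> 0"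
  show "\<exists>M. ideal_in (adjoin A x) M \<and> fin_index (adjoin A x) M \<and> 1 \<notin> M \<and>
     (\<forall>z\<in>adjoin A x. f * z \<in> M \<longrightarrow> z \<in> M)"
  proof (cases "\<exists>P\<in>polys_over A. P \<noteq> 0 \<and> poly P x = 0")
    case True
    let ?X = "\<lambda>P. P \<in> polys_over A \<and> P \<noteq> 0 \<and> poly P x = 0"
    obtain m where m: "m \<in> polys_over A" "m \<noteq> 0" "poly m x = 0"
      and min: "\<And>P. P \<in> polys_over A \<Longrightarrow> P \<noteq> 0 \<Longrightarrow> poly P x = 0 \<Longrightarrow> degree m \<le> degree P"
      using True exists_least_iff[of "\<lambda>d. \<exists>P. ?X P \<and> degree P = d"] by (metis not_le)
    have d1: "degree m \<ge> 1"
    proof (rule ccontr)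
      assume "\<not> ?thesis"
      then obtain c where "m = [:c:]" by (metis degree_eq_zeroE not_one_le_zero less_one not_le)
      then show False using m by simp
    qed
    obtain c h where c: "c \<in> A" "c \<noteq> 0" "h \<in> adjoin A x" "h * f = c"
      using algebraic_divides_const[OF A m min f] by blast
    let ?l = "lead_coeff m"
    define e where "e = ?l * c"
    have l: "?l \<in> A" using m by (auto simp: polys_over_def)
    have e: "e \<in> A" "e \<noteq> 0" using m l c sub_ring_mult[OF A] by (auto simp: e_def)
    obtain M where M: "ideal_in A M" "fin_index A M" "1 \<notin> M" and sat: "\<And>z. z \<in> A \<Longrightarrow> e * z \<in> M \<Longrightarrow> z \<in> M"
      using R e unfolding residual_def by blast
    let ?J = "over_ideal A x M e m"
    note J = ideal_in_over_ideal[OF A M(1) e(1) m(1), of x]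
    have "1 \<notin> ?J"
    proof
      assume "1 \<in> ?J"
      then obtain k Y where Y: "Y \<in> polys_over M" "e ^ k = poly Y x" using m by (auto simp: over_ideal_def)
      \<comment> \<open>Dividing \<open>Y\<close> keeps the remainder \<open>S\<close> over
        \<open>M\<close>. Minimality of \<open>m\<close> forces \<open>S\<close> to be the constant
        \<open>?l ^ j * e ^ k\<close>, so that a power of \<open>e\<close> would lie in
        \<open>M\<close>.\<close>
      obtain j Q S where S: "Q \<in> polys_over M" "S \<in> polys_over M"
        "smult (?l ^ j) Y = Q * m + S" "degree S < degree m"
        using pseudo_division[OF A M(1) m(1) d1 Y(1)] by blast
      have Sx: "poly S x = ?l ^ j * e ^ k" using arg_cong[OF S(3), of "\<lambda>p. poly p x"] m Y by simp
      define D where "D = S - [:?l ^ j * e ^ k:]"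
      have SA: "S \<in> polys_over A" using S ideal_in_sub[OF M(1)] by (auto simp: polys_over_def)
      have "D \<in> polys_over A" unfolding D_def
        by (intro polys_over_diff[OF A AA] SA polys_over_const[OF AA] sub_ring_mult[OF A] sub_ring_power[OF A] l e(1))
      moreover have "poly D x = 0" using Sx by (simp add: D_def)
      moreover have "degree D < degree m" unfolding D_def
        using S d1 by (intro degree_diff_less) auto
      ultimately have "D = 0" using min[of D] by force
      then have "coeff S 0 = ?l ^ j * e ^ k" by (simp add: D_def)
      then have "?l ^ j * e ^ k \<in> M" using S(2) by (metis (mono_tags, lifting) mem_Collect_eq polys_over_def)
      then have "c ^ j * (?l ^ j * e ^ k) \<in> M" using ideal_in_mult[OF M(1) sub_ring_power[OF A c(1)]] by blast
      then have "e ^ (j + k) \<in> M" by (simp add: e_def power_add power_mult_distrib mult_ac)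
      then show False using saturated_power_notin[OF A e(1) M(3) sat] by blast
    qed
    moreover have "z \<in> ?J" if z: "z \<in> adjoin A x" "f * z \<in> ?J" for z
    proof -
      have "?l * h \<in> adjoin A x" using sub_ring_mult[OF sr adjoin_base[OF A l] c(3)] .
      then have "(?l * h) * (f * z) \<in> ?J" using ideal_in_mult[OF J] z by blast
      moreover have "(?l * h) * (f * z) = e * z" unfolding e_def c(4)[symmetric] by (simp add: mult_ac)
      ultimately have "e * z \<in> ?J" by simp
      then show ?thesis using over_ideal_saturated[OF A z(1)] by blast
    qed
    ultimately show ?thesis
      using J fin_index_over_ideal[OF A M(1,2) e(1) e_def c(1) m(1) d1, of x] by blast
  next
    case False
    obtain F where F: "F \<in> polys_over A" "f = poly F x" using f by (auto simp: adjoin_def)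
    have F0: "F \<noteq> 0" using F f by auto
    \<comment> \<open>modulo \<open>1 + x f\<close> the element \<open>f\<close> is invertible\<close>
    define m where "m = 1 + monom 1 1 * F"
    have mA: "m \<in> polys_over A" unfolding m_def
      using polys_over_const[OF AA sub_ring_one[OF A]]
      by (intro polys_over_add[OF AA] polys_over_mult[OF AA] polys_over_monom[OF AA] F sub_ring_one[OF A]) (simp add: one_pCons)
    have dm1: "degree (monom 1 1 * F) = Suc (degree F)"
      using F0 by (simp add: degree_mult_eq degree_monom_eq)
    have dm: "degree m = Suc (degree F)" unfolding m_def using dm1 by (simp add: degree_add_eq_right)
    let ?l = "lead_coeff m"
    have "m \<noteq> 0" using dm by auto
    then have l: "?l \<in> A" "?l \<noteq> 0" using mA by (auto simp: polys_over_def)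
    obtain M where M: "ideal_in A M" "fin_index A M" "1 \<notin> M" and sat: "\<And>z. z \<in> A \<Longrightarrow> ?l * z \<in> M \<Longrightarrow> z \<in> M"
      using R l unfolding residual_def by blast
    let ?J = "over_ideal A x M ?l m"
    note J = ideal_in_over_ideal[OF A M(1) l(1) mA, of x]
    have "1 \<notin> ?J"
    proof
      assume "1 \<in> ?J"
      then obtain k Y Q where Y: "Y \<in> polys_over M" "Q \<in> polys_over A" "?l ^ k = poly Y x + poly Q x * poly m x"
        by (auto simp: over_ideal_def)
      define D where "D = Y + Q * m - [:?l ^ k:]"
      have YA: "Y \<in> polys_over A" using Y ideal_in_sub[OF M(1)] by (auto simp: polys_over_def)
      have "D \<in> polys_over A" unfolding D_def
        by (intro polys_over_diff[OF A AA] polys_over_add[OF AA] polys_over_mult[OF AA] YA Y mA polys_over_const[OF AA] sub_ring_power[OF A] l(1))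
      moreover have "poly D x = 0" using Y by (simp add: D_def)
      ultimately have "D = 0" using False by blast
      then have eq: "Y + Q * m = [:?l ^ k:]" by (simp add: D_def)
      \<comment> \<open>Modulo \<open>M\<close> the product \<open>Q * m\<close> is constant. At the
        largest \<open>i\<close> with \<open>coeff Q i \<notin> M\<close>, its coefficient in degree
        \<open>i + degree m\<close> is congruent to \<open>?l * coeff Q i\<close>, and it has to
        vanish because \<open>degree m > 0\<close>; saturation by \<open>?l\<close> then excludes
        such an \<open>i\<close>.\<close>
      have QM: "coeff Q i \<in> M" for i
      proof (rule ccontr)
        assume i: "coeff Q i \<notin> M"
        have "coeff Q j \<notin> M \<Longrightarrow> j \<le> degree Q" for j using ideal_in_zero[OF M(1)] by (metis coeff_eq_0 not_le)
        then obtain i where i: "coeff Q i \<notin> M" "\<And>j. coeff Q j \<notin> M \<Longrightarrow> j \<le> i"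
          using i ex_has_greatest_nat[of "\<lambda>i. coeff Q i \<notin> M" i id "Suc (degree Q)"] by (auto simp: less_Suc_eq_le)
        have "coeff (Q * m) (i + degree m) = (\<Sum>j\<le>i + degree m. coeff Q j * coeff m (i + degree m - j))"
          by (simp add: coeff_mult)
        also have "\<dots> = coeff Q i * ?l + (\<Sum>j\<in>{..i + degree m} - {i}. coeff Q j * coeff m (i + degree m - j))"
          by (subst sum.remove[of _ i]) auto
        finally have c: "coeff (Q * m) (i + degree m) = \<dots>" .
        have "coeff Q j * coeff m (i + degree m - j) \<in> M" if "j \<noteq> i" for j
        proof (cases "j < i")
          case True
          then have "coeff m (i + degree m - j) = 0" by (intro coeff_eq_0) auto
          then show ?thesis using ideal_in_zero[OF M(1)] by simp
        next
          case False
          then have "coeff Q j \<in> M" using i(2)[of j] that by auto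
          then show ?thesis using mA by (intro ideal_in_mult'[OF M(1)]) (auto simp: polys_over_def)
        qed
        then have s: "(\<Sum>j\<in>{..i + degree m} - {i}. coeff Q j * coeff m (i + degree m - j)) \<in> M"
          by (intro ideal_in_sum[OF M(1)]) auto
        have "coeff Y (i + degree m) + coeff (Q * m) (i + degree m) = 0"
          using arg_cong[OF eq, of "\<lambda>p. coeff p (i + degree m)"] dm by simp
        then have "?l * coeff Q i = - (coeff Y (i + degree m) + (\<Sum>j\<in>{..i + degree m} - {i}. coeff Q j * coeff m (i + degree m - j)))"
          using c by (simp add: algebra_simps eq_neg_iff_add_eq_0)
        moreover have "\<dots> \<in> M" using Y(1) s
          by (intro ideal_in_uminus[OF A M(1)] ideal_in_add[OF M(1)]) (auto simp: polys_over_def)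
        ultimately have "?l * coeff Q i \<in> M" by simp
        then show False using sat[of "coeff Q i"] Y(2) i(1) by (auto simp: polys_over_def)
      qed
      have "coeff Y 0 + coeff Q 0 * coeff m 0 \<in> M" using Y QM mA
        by (intro ideal_in_add[OF M(1)] ideal_in_mult'[OF M(1)]) (auto simp: polys_over_def)
      moreover have "coeff Y 0 + coeff Q 0 * coeff m 0 = ?l ^ k"
        using arg_cong[OF eq, of "\<lambda>p. coeff p 0"] by (simp add: coeff_mult)
      ultimately show False using saturated_power_notin[OF A l(1) M(3) sat] by metis
    qed
    moreover have "z \<in> ?J" if z: "z \<in> adjoin A x" "f * z \<in> ?J" for z
    proof -
      have mJ: "poly m x \<in> ?J"
        unfolding over_ideal_def using adjoinI[OF mA, of x] polys_over_zero[OF M(1)] polys_over_const[OF AA sub_ring_one[OF A]]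
        by (intro CollectI conjI exI[of _ 0] bexI[of _ 0] bexI[of _ "[:1:]"]) auto
      have "z * poly m x - x * (f * z) \<in> ?J"
        by (intro ideal_in_diff[OF sr J] ideal_in_mult[OF J z(1) mJ] ideal_in_mult[OF J adjoin_elem[OF A] z(2)])
      then show ?thesis using F(2) by (simp add: m_def poly_monom algebra_simps)
    qed
    moreover have "?l = ?l * 1" by simp
    ultimately show ?thesis
      using J fin_index_over_ideal[OF A M(1,2) l(1) _ sub_ring_one[OF A] mA, of x] dm by auto
  qed
qed

text \<open>If a positive integer vanishes in the ring, the image of the integers is finite and the
  zero ideal serves, the ring being a domain. Otherwise the modulus \<open>\<bar>i\<bar> + 1\<close>
  is coprime to \<open>i\<close>, and it is at least 2 because \<open>i\<close> is non-zero.\<close>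

lemma residual_of_int: "residual (range (of_int :: int \<Rightarrow> 'a::idom))"
  unfolding residual_def
proof (intro ballI impI)
  fix a :: 'a assume a: "a \<in> range of_int" "a \<noteq> 0"
  let ?Z = "range (of_int :: int \<Rightarrow> 'a)"
  obtain i where i: "a = of_int i" using a by auto
  show "\<exists>M. ideal_in ?Z M \<and> fin_index ?Z M \<and> 1 \<notin> M \<and> (\<forall>z\<in>?Z. a * z \<in> M \<longrightarrow> z \<in> M)"
  proof (cases "\<exists>q>0. of_int q = (0::'a)")
    case True
    then obtain q where q: "q > 0" "of_int q = (0::'a)" by blast
    have "of_int z = (of_int (z mod q) :: 'a)" for z
      using q by (metis add.left_neutral mult_zero_left of_int_add of_int_mult div_mult_mod_eq mult_not_zero)
    then have "fin_index ?Z {0}"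
      unfolding fin_index_def using q
      by (intro exI[of _ "of_int ` {0..<q}"]) (auto intro!: image_eqI[of _ _ "_ mod q"])
    then show ?thesis using a by (intro exI[of _ "{0}"]) (auto simp: ideal_in_def intro: range_eqI[of _ _ 0])
  next
    case False
    have inj: "of_int y = (of_int z :: 'a) \<longleftrightarrow> y = z" for y z
    proof
      assume "of_int y = (of_int z :: 'a)"
      then have "of_int (y - z) = (0::'a)" "of_int (z - y) = (0::'a)" by simp_all
      then have "\<not> y - z > 0" "\<not> z - y > 0" using False by blast+
      then show "y = z" by simp
    qed simp
    define q where "q = \<bar>i\<bar> + 1"
    have q: "q \<ge> 2" using i a(2) inj[of i 0] by (simp add: q_def)
    have cop: "coprime q i"
    proof -
      have "d dvd 1" if "d dvd q" "d dvd i" for d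
      proof -
        have "d dvd (\<bar>i\<bar> + 1) - \<bar>i\<bar>" using that unfolding q_def by (intro dvd_diff) auto
        then show ?thesis by simp
      qed
      then show ?thesis by (intro coprimeI) auto
    qed
    define M :: "'a set" where "M = of_int ` {z. q dvd z}"
    have mem: "of_int z \<in> M \<longleftrightarrow> q dvd z" for z by (auto simp: M_def inj)
    have "ideal_in ?Z M"
    proof -
      have "0 \<in> M" using mem[of 0] by simp
      moreover have "x + y \<in> M" if xy: "x \<in> M" "y \<in> M" for x y
      proof -
        obtain i j where "x = of_int i" "q dvd i" "y = of_int j" "q dvd j" using xy by (auto simp: M_def)
        then show ?thesis using mem[of "i + j"] by simp
      qed
      moreover have "a * x \<in> M" if ax: "a \<in> ?Z" "x \<in> M" for a x
      proof -
        obtain i j where "a = of_int i" "x = of_int j" "q dvd j" using ax by (auto simp: M_def)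
        then show ?thesis using mem[of "i * j"] by simp
      qed
      ultimately show ?thesis unfolding ideal_in_def by (auto simp: M_def)
    qed
    moreover have "fin_index ?Z M"
      unfolding fin_index_def using q
    proof (intro exI[of _ "of_int ` {0..<q}"] conjI ballI)
      fix z assume "z \<in> ?Z"
      then obtain j where j: "z = of_int j" by auto
      have "z - of_int (j mod q) \<in> M" using mem[of "j - j mod q"] j by simp
      then show "\<exists>w\<in>of_int ` {0..<q}. z - w \<in> M" using q by auto
    qed auto
    moreover have "1 \<notin> M" using mem[of 1] q by simp
    moreover have "z \<in> M" if z: "z \<in> ?Z" "a * z \<in> M" for z
    proof -
      obtain j where j: "z = of_int j" using z by auto
      then have "q dvd i * j" using z(2) i mem[of "i * j"] by simp
      then show ?thesis using j mem cop by (simp add: coprime_dvd_mult_right_iff)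
    qed
    ultimately show ?thesis by blast
  qed
qed

lemma residual_gen_ring: "residual (gen_ring xs :: 'a::idom set)"
  by (induction xs) (auto intro: residual_of_int residual_adjoin sub_ring_gen_ring)

section \<open>Automorphisms of finitely generated domains\<close>

text \<open>Modelled on the identity \<open>x ^ q = x\<close> of a field with
  \<open>q = Suc k\<close> elements. For \<open>k \<ge> 1\<close> the quotient ring has no nilpotent
  elements other than 0.\<close>

definition frob_ideal :: "nat \<Rightarrow> 'a::comm_ring_1 set" where
  "frob_ideal k = \<Inter> {J. ideal_in UNIV J \<and> (\<forall>x. x ^ Suc k - x \<in> J)}"

lemma ideal_in_frob_ideal: "ideal_in UNIV (frob_ideal k)"
  unfolding frob_ideal_def ideal_in_def by auto

lemma frob_ideal_gen: "x ^ Suc k - x \<in> frob_ideal k"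
  unfolding frob_ideal_def by auto

lemma frob_ideal_least: "ideal_in UNIV J \<Longrightarrow> (\<And>x. x ^ Suc k - x \<in> J) \<Longrightarrow> frob_ideal k \<subseteq> J"
  unfolding frob_ideal_def by auto

lemma one_minus_power_dvd: "k dvd l \<Longrightarrow> (1 - x ^ k) dvd (1 - (x::'a::comm_ring_1) ^ l)"
proof -
  assume "k dvd l"
  then obtain j where "l = k * j" by auto
  then have "x ^ l = (x ^ k) ^ j" by (simp add: power_mult)
  then show ?thesis by (metis one_diff_power_eq dvd_triv_left)
qed

lemma frob_ideal_dvd:
  assumes "k dvd l"
  shows "frob_ideal l \<subseteq> (frob_ideal k :: 'a::comm_ring_1 set)"
proof (rule frob_ideal_least[OF ideal_in_frob_ideal])
  fix x :: 'a
  obtain c where c: "1 - x ^ l = (1 - x ^ k) * c" using one_minus_power_dvd[OF assms, of x] by auto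
  have "x ^ Suc l - x = - x * (1 - x ^ l)" by (simp add: algebra_simps)
  also have "\<dots> = c * (x ^ Suc k - x)" unfolding c by (simp add: algebra_simps)
  also have "\<dots> \<in> frob_ideal k" by (rule ideal_in_mult[OF ideal_in_frob_ideal _ frob_ideal_gen]) simp
  finally show "x ^ Suc l - x \<in> frob_ideal k" .
qed

text \<open>Modulo \<open>K\<close> a polynomial in the new generator \<open>x\<close> is brought to
  degree at most \<open>k\<close> by replacing \<open>x ^ Suc k\<close> by \<open>x\<close>, and its
  coefficients are replaced by representatives from the smaller ring. \<open>K\<close> is an ideal
  of the whole ring throughout, while \<open>W\<close> is taken inside the subring generated so
  far.\<close>

lemma fin_index_gen_ring:
  fixes K :: "'a::comm_ring_1 set"
  assumes K: "ideal_in UNIV K" and k: "k \<ge> 1" and pw: "\<And>x. x ^ Suc k - x \<in> K"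
  shows "\<exists>W. finite W \<and> W \<subseteq> gen_ring xs \<and> (\<forall>z\<in>gen_ring xs. \<exists>w\<in>W. z - w \<in> K)"
proof (induction xs)
  case Nil
  \<comment> \<open>The identity at the argument 2 puts this integer into \<open>K\<close>; it is
    positive because \<open>k \<ge> 1\<close>.\<close>
  define q :: int where "q = 2 ^ Suc k - 2"
  have "(2::int) ^ 1 < 2 ^ Suc k" by (intro power_strict_increasing) (use k in auto)
  then have q: "q > 0" by (simp add: q_def)
  have qK: "(of_int q :: 'a) \<in> K" using pw[of 2] by (simp add: q_def)
  show ?case
  proof (intro exI[of _ "of_int ` {0..<q}"] conjI ballI)
    fix z :: 'a assume "z \<in> gen_ring []"
    then obtain j where j: "z = of_int j" by auto
    have "j - j mod q = (j div q) * q" by (simp add: minus_mod_eq_div_mult)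
    then have "z - of_int (j mod q) = of_int (j div q) * of_int q" unfolding j
      by (metis of_int_diff of_int_mult)
    then have "z - of_int (j mod q) \<in> K" using ideal_in_mult[OF K _ qK] by simp
    then show "\<exists>w\<in>of_int ` {0..<q}. z - w \<in> K" using q by auto
  qed auto
next
  case (Cons x xs)
  let ?A = "gen_ring xs"
  note A = sub_ring_gen_ring[of xs]
  note AA = ideal_in_self[OF A]
  obtain W where W: "finite W" "W \<subseteq> ?A" "\<forall>z\<in>?A. \<exists>w\<in>W. z - w \<in> K" using Cons.IH by blast
  then obtain g where g: "\<And>z. z \<in> ?A \<Longrightarrow> g z \<in> W \<and> z - g z \<in> K" by metis
  define s where "s b = (\<Sum>j\<le>k. b j * x ^ j)" for b :: "nat \<Rightarrow> 'a"
  define V where "V = s ` ({..k} \<rightarrow>\<^sub>E W)"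
  have fV: "finite V" unfolding V_def using W by (intro finite_imageI finite_PiE) auto
  have VA: "V \<subseteq> gen_ring (x # xs)"
  proof -
    note sr = sub_ring_adjoin[OF A, of x]
    have "s b \<in> adjoin ?A x" if "b \<in> {..k} \<rightarrow>\<^sub>E W" for b
      unfolding s_def
    proof (intro sub_ring_sum[OF sr] sub_ring_mult[OF sr] sub_ring_power[OF sr] adjoin_elem[OF A])
      fix j assume "j \<in> {..k}"
      then show "b j \<in> adjoin ?A x" using that W(2) by (intro adjoin_base[OF A]) auto
    qed
    then show ?thesis by (auto simp: V_def)
  qed
  have red: "\<exists>v\<in>V. s b - v \<in> K" if b: "\<And>j. j \<le> k \<Longrightarrow> b j \<in> ?A" for b
  proof
    define b' where "b' = (\<lambda>j\<in>{..k}. g (b j))"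
    show "s b' \<in> V" unfolding V_def b'_def using b g by (intro imageI restrict_PiE_iff[THEN iffD2]) auto
    have "s b - s b' = (\<Sum>j\<le>k. x ^ j * (b j - b' j))"
      by (simp add: s_def sum_subtractf algebra_simps)
    also have "\<dots> \<in> K" using b g by (intro ideal_in_sum[OF K] ideal_in_mult[OF K]) (auto simp: b'_def)
    finally show "s b - s b' \<in> K" .
  qed
  have "\<exists>v\<in>V. poly P x - v \<in> K" if "P \<in> polys_over ?A" for P
    using that
  proof (induction P)
    case 0
    have "s (\<lambda>_. 0) = 0" by (simp add: s_def)
    then show ?case using red[of "\<lambda>_. 0"] sub_ring_zero[OF A] by simp
  next
    case (pCons a P)
    have "a \<in> ?A" and "P \<in> polys_over ?A"
      using pCons.prems by (auto simp: polys_over_def dest: spec[of _ 0] spec[of _ "Suc _"] split: nat.splits)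
    then obtain v where v: "v \<in> V" "poly P x - v \<in> K" using pCons.IH by blast
    then obtain b where b: "b \<in> {..k} \<rightarrow>\<^sub>E W" "v = s b" by (auto simp: V_def)
    have bA: "b j \<in> ?A" if "j \<le> k" for j using b that W(2) by auto
    \<comment> \<open>The coefficients of \<open>a + x * s b\<close> after
      \<open>b k * x ^ Suc k\<close> has been replaced by \<open>b k * x\<close>.\<close>
    define c where "c j = (if j = 0 then a else b (j - 1)) + (if j = 1 then b k else 0)" for j
    have "s c = (\<Sum>j\<le>k. (if j = 0 then a else b (j - 1)) * x ^ j) + (\<Sum>j\<le>k. (if j = 1 then b k else 0) * x ^ j)"
      unfolding s_def c_def by (simp only: sum.distrib[symmetric] distrib_right)
    also have "(\<Sum>j\<le>k. (if j = 1 then b k else 0) * x ^ j) = b k * x"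
    proof -
      have "(\<Sum>j\<le>k. (if j = 1 then b k else 0) * x ^ j) = (\<Sum>j\<le>k. if j = 1 then b k * x else 0)"
        by (intro sum.cong) auto
      then show ?thesis using k by simp
    qed
    also have "(\<Sum>j\<le>k. (if j = 0 then a else b (j - 1)) * x ^ j) = a + (\<Sum>j<k. b j * x ^ Suc j)"
    proof -
      obtain k' where k': "k = Suc k'" using k by (cases k) auto
      show ?thesis unfolding k' by (subst sum.atMost_Suc_shift) (simp add: lessThan_Suc_atMost)
    qed
    finally have sc: "s c = a + (\<Sum>j<k. b j * x ^ Suc j) + b k * x" .
    have "x * s b = (\<Sum>j\<le>k. b j * x ^ Suc j)" by (simp add: s_def sum_distrib_left mult_ac)
    also have "\<dots> = (\<Sum>j<k. b j * x ^ Suc j) + b k * x ^ Suc k"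
      using sum.lessThan_Suc[of "\<lambda>j. b j * x ^ Suc j" k] by (simp only: lessThan_Suc_atMost)
    finally have xs: "a + x * s b - s c = b k * (x ^ Suc k - x)" unfolding sc by (simp add: algebra_simps)
    then have 1: "a + x * s b - s c \<in> K" using ideal_in_mult[OF K _ pw] by simp
    have 2: "x * (poly P x - s b) \<in> K" using ideal_in_mult[OF K, of x] v b by simp
    have "c j \<in> ?A" if "j \<le> k" for j
      unfolding c_def using that bA k \<open>a \<in> ?A\<close> sub_ring_zero[OF A] by (auto intro!: sub_ring_add[OF A])
    then obtain u where u: "u \<in> V" "s c - u \<in> K" using red[of c] by blast
    have "(a + x * s b - s c) + x * (poly P x - s b) + (s c - u) \<in> K"
      using ideal_in_add[OF K ideal_in_add[OF K 1 2] u(2)] .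
    then have "poly (pCons a P) x - u \<in> K" by (simp add: algebra_simps)
    then show ?case using u by blast
  qed
  then show ?case using fV VA by (intro exI[of _ V]) (auto simp: adjoin_def)
qed

lemma fin_index_frob_ideal:
  fixes xs :: "'a::comm_ring_1 list"
  assumes "gen_ring xs = UNIV" "k \<ge> 1"
  shows "fin_index UNIV (frob_ideal k :: 'a set)"
  using fin_index_gen_ring[OF ideal_in_frob_ideal assms(2) frob_ideal_gen, of xs] assms(1)
  unfolding fin_index_def by simp

lemma ideal_in_radical:
  fixes M :: "'a::comm_ring_1 set"
  assumes M: "ideal_in UNIV M"
  shows "ideal_in UNIV {z. \<exists>j. z ^ j \<in> M}"
proof -
  have up: "z ^ j \<in> M" if "z ^ i \<in> M" "i \<le> j" for z :: 'a and i j
    using ideal_in_mult[OF M UNIV_I that(1), of "z ^ (j - i)"] that(2) by (simp flip: power_add)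
  have "\<exists>j. (x + y) ^ j \<in> M" if "x ^ i \<in> M" "y ^ j \<in> M" for x y :: 'a and i j
  proof
    have "of_nat (i + j choose k) * x ^ k * y ^ (i + j - k) \<in> M" if k: "k \<le> i + j" for k
    proof (cases "k \<ge> i")
      case True
      then show ?thesis using ideal_in_mult[OF M UNIV_I up[OF \<open>x ^ i \<in> M\<close> True], of "of_nat (i + j choose k) * y ^ (i + j - k)"]
        by (simp add: mult_ac)
    next
      case False
      then have "i + j - k \<ge> j" by simp
      then show ?thesis using ideal_in_mult[OF M UNIV_I up[OF \<open>y ^ j \<in> M\<close>], of "i + j - k" "of_nat (i + j choose k) * x ^ k"]
        by (simp add: mult_ac)
    qed
    then show "(x + y) ^ (i + j) \<in> M" unfolding binomial_ring by (intro ideal_in_sum[OF M]) auto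
  qed
  moreover have "(a * x) ^ i \<in> M" if "x ^ i \<in> M" for a x :: 'a and i
    using ideal_in_mult[OF M UNIV_I that] by (simp add: power_mult_distrib)
  ultimately show ?thesis unfolding ideal_in_def using ideal_in_zero[OF M] 
    by (auto intro: exI[of _ 1]) blast+
qed

text \<open>Take \<open>M\<close> modulo which \<open>a\<close> can be cancelled. The powers of any
  \<open>x\<close> repeat modulo \<open>M\<close> within the first \<open>N + 1\<close> of them, and
  the factorial of \<open>N\<close> is divisible by every possible period. With this
  \<open>k\<close> each \<open>x ^ Suc k - x\<close> is nilpotent modulo \<open>M\<close>, so
  \<open>frob_ideal k\<close> lies in the radical of \<open>M\<close>, which does not contain
  \<open>a\<close>.\<close>

lemma frob_ideal_residual:
  fixes a :: "'a::idom"
  assumes "gen_ring xs = (UNIV :: 'a set)" "a \<noteq> 0"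
  shows "\<exists>k\<ge>1. a \<notin> frob_ideal k"
proof -
  obtain M where M: "ideal_in UNIV M" "fin_index UNIV M" "(1::'a) \<notin> M" and sat: "\<And>z. a * z \<in> M \<Longrightarrow> z \<in> M"
    using residual_gen_ring[of xs] assms unfolding residual_def by auto
  obtain W where W: "finite W" "\<forall>z. \<exists>w\<in>W. z - w \<in> M" using M(2) unfolding fin_index_def by auto
  then obtain g where g: "\<And>z. g z \<in> W \<and> z - g z \<in> M" by metis
  define N where "N = card W"
  have N1: "N \<ge> 1" using W g unfolding N_def by (metis card_0_eq empty_iff less_one not_le)
  define k :: nat where "k = fact N"
  have gen: "x ^ Suc k - x \<in> {z. \<exists>j. z ^ j \<in> M}" for x
  proof -
    have "\<not> inj_on (\<lambda>i. g (x ^ i)) {..N}"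
    proof
      assume "inj_on (\<lambda>i. g (x ^ i)) {..N}"
      then have "card {..N} \<le> card W" by (rule card_inj_on_le) (use g W in auto)
      then show False by (simp add: N_def)
    qed
    then obtain i' j' where "i' \<le> N" "j' \<le> N" "i' \<noteq> j'" "g (x ^ i') = g (x ^ j')" by (auto simp: inj_on_def)
    then obtain i j where ij: "i < j" "j \<le> N" "g (x ^ i) = g (x ^ j)" by (metis linorder_neqE_nat)
    have "(x ^ i - g (x ^ i)) - (x ^ j - g (x ^ j)) \<in> M"
      by (rule ideal_in_diff[OF sub_ring_UNIV M(1)]) (use g in auto)
    then have "x ^ i - x ^ j \<in> M" using ij by simp
    moreover have "x ^ j = x ^ i * x ^ (j - i)" using ij by (simp flip: power_add)
    ultimately have 1: "x ^ i * (1 - x ^ (j - i)) \<in> M" by (simp add: algebra_simps)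
    have "(j - i) dvd k" unfolding k_def using ij by (intro dvd_fact) auto
    then obtain c where c: "1 - x ^ k = (1 - x ^ (j - i)) * c" using one_minus_power_dvd by blast
    \<comment> \<open>The exponent \<open>N\<close> covers the preperiod \<open>i\<close> and, being
      positive, leaves one factor divisible by \<open>1 - x ^ (j - i)\<close>.\<close>
    have e: "(x * (1 - x ^ k)) ^ N = (x ^ (N - i) * (c * (1 - x ^ k) ^ (N - 1))) * (x ^ i * (1 - x ^ (j - i)))"
    proof -
      have "x ^ N = x ^ (N - i) * x ^ i" using ij by (simp flip: power_add)
      moreover have "(1 - x ^ k) ^ N = (1 - x ^ k) ^ (N - 1) * ((1 - x ^ (j - i)) * c)"
        using N1 c by (cases N) (simp_all add: mult.commute)
      ultimately show ?thesis by (simp add: power_mult_distrib mult_ac)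
    qed
    have "(x * (1 - x ^ k)) ^ N \<in> M" unfolding e by (rule ideal_in_mult[OF M(1) UNIV_I 1])
    moreover have "x ^ Suc k - x = - 1 * (x * (1 - x ^ k))" by (simp add: algebra_simps)
    ultimately have "(x ^ Suc k - x) ^ N \<in> M"
      using ideal_in_mult[OF M(1) UNIV_I, of "(x * (1 - x ^ k)) ^ N" "(-1) ^ N"]
      by (metis power_mult_distrib)
    then show ?thesis by blast
  qed
  have "frob_ideal k \<subseteq> {z. \<exists>j. z ^ j \<in> M}"
    by (rule frob_ideal_least[OF ideal_in_radical[OF M(1)] gen])
  moreover have "a ^ j \<notin> M" for j
    using saturated_power_notin[OF sub_ring_UNIV _ M(3)] sat by blast
  moreover have "k \<ge> 1" by (simp add: k_def)
  ultimately show ?thesis by blast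
qed

text \<open>The kernel and the cokernel of \<open>f\<close> have the same size on the finite quotient described by \<open>cl\<close>.\<close>

lemma card_fixed_le_card_cosets:
  assumes G: "comm_group G" and f: "f \<in> hom G G"
    and fin: "finite (cl ` carrier G)"
    and canc: "\<And>x y z. x \<in> carrier G \<Longrightarrow> y \<in> carrier G \<Longrightarrow> z \<in> carrier G \<Longrightarrow>
        cl (x \<otimes>\<^bsub>G\<^esub> z) = cl (y \<otimes>\<^bsub>G\<^esub> z) \<longleftrightarrow> cl x = cl y"
    and fcl: "\<And>x y. x \<in> carrier G \<Longrightarrow> y \<in> carrier G \<Longrightarrow> cl x = cl y \<Longrightarrow> cl (f x) = cl (f y)"
    and W: "finite W" "W \<subseteq> carrier G"
    and cov: "\<And>g. g \<in> carrier G \<Longrightarrow> \<exists>w\<in>W. \<exists>x\<in>carrier G. g = w \<otimes>\<^bsub>G\<^esub> f x"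
    and E: "finite E" "E \<subseteq> carrier G" "inj_on cl E" and Ef: "\<And>e. e \<in> E \<Longrightarrow> cl (f e) = cl \<one>\<^bsub>G\<^esub>"
  shows "card E \<le> card W"
proof -
  interpret comm_group G by fact
  have fc: "f x \<in> carrier G" if "x \<in> carrier G" for x using hom_in_carrier[OF f that] .
  define B where "B = cl ` f ` carrier G"
  have Bsub: "B \<subseteq> cl ` carrier G" using fc by (auto simp: B_def)
  then have finB: "finite B" using fin finite_subset by blast
  have "cl (f \<one>\<^bsub>G\<^esub>) \<in> B" by (auto simp: B_def)
  then have B0: "card B > 0" using finB by (auto simp: card_gt_0_iff)
  obtain r where r: "\<And>b. b \<in> B \<Longrightarrow> r b \<in> carrier G \<and> b = cl (f (r b))"
  proof -
    have "\<forall>b\<in>B. \<exists>x. x \<in> carrier G \<and> b = cl (f x)" by (auto simp: B_def)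
    then show ?thesis using that by metis
  qed
  \<comment> \<open>Upper bound for the number of classes: a member of \<open>W\<close> times a
    class in the image \<open>B\<close> of \<open>f\<close>.\<close>
  have "cl ` carrier G \<subseteq> (\<lambda>(w, b). cl (w \<otimes>\<^bsub>G\<^esub> f (r b))) ` (W \<times> B)"
  proof
    fix c assume "c \<in> cl ` carrier G"
    then obtain g where g: "g \<in> carrier G" "c = cl g" by blast
    then obtain w x where wx: "w \<in> W" "x \<in> carrier G" "g = w \<otimes>\<^bsub>G\<^esub> f x" using cov by blast
    have b: "cl (f x) \<in> B" using wx by (auto simp: B_def)
    have "cl (f x \<otimes>\<^bsub>G\<^esub> w) = cl (f (r (cl (f x))) \<otimes>\<^bsub>G\<^esub> w)"
      using canc[of "f x" "f (r (cl (f x)))" w] r[OF b] wx W fc by auto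
    then have "c = cl (w \<otimes>\<^bsub>G\<^esub> f (r (cl (f x))))"
      using g wx W fc r[OF b] by (simp add: m_comm subset_iff)
    then show "c \<in> (\<lambda>(w, b). cl (w \<otimes>\<^bsub>G\<^esub> f (r b))) ` (W \<times> B)" using b wx by force
  qed
  then have "card (cl ` carrier G) \<le> card (W \<times> B)" using surj_card_le[of "W \<times> B"] W finB by blast
  also have "\<dots> = card W * card B" by (simp add: card_cartesian_product)
  finally have up: "card (cl ` carrier G) \<le> card W * card B" .
  \<comment> \<open>Lower bound: the translates of \<open>E\<close> by preimages of the members of
    \<open>B\<close> are distinct, since \<open>f\<close> recovers \<open>b\<close> from such a
    product. The factor \<open>card B\<close> then cancels from both bounds.\<close>
  have "inj_on (\<lambda>(e, b). cl (e \<otimes>\<^bsub>G\<^esub> r b)) (E \<times> B)"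
  proof (rule inj_onI, clarify)
    fix e b e' b' assume *: "e \<in> E" "b \<in> B" "e' \<in> E" "b' \<in> B" "cl (e \<otimes>\<^bsub>G\<^esub> r b) = cl (e' \<otimes>\<^bsub>G\<^esub> r b')"
    have ee: "e \<in> carrier G" "e' \<in> carrier G" using * E by auto
    have key: "cl (f (e \<otimes>\<^bsub>G\<^esub> r b)) = b" if "e \<in> E" "b \<in> B" for e b
    proof -
      have c: "e \<in> carrier G" "r b \<in> carrier G" using that E r by auto
      have "cl (f e \<otimes>\<^bsub>G\<^esub> f (r b)) = cl (\<one>\<^bsub>G\<^esub> \<otimes>\<^bsub>G\<^esub> f (r b))" using canc[of "f e" "\<one>\<^bsub>G\<^esub>" "f (r b)"] Ef[OF that(1)] fc c by auto
      then show ?thesis using r[OF that(2)] hom_mult[OF f c] fc c by simp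
    qed
    have "cl (f (e \<otimes>\<^bsub>G\<^esub> r b)) = cl (f (e' \<otimes>\<^bsub>G\<^esub> r b'))" using * ee r by (intro fcl) auto
    then have "b = b'" using key * by simp
    then have "cl e = cl e'" using canc[of e e' "r b"] * ee r by auto
    then show "e = e' \<and> b = b'" using \<open>b = b'\<close> E(3) * by (auto simp: inj_on_def)
  qed
  then have "card (E \<times> B) \<le> card (cl ` carrier G)"
    by (rule card_inj_on_le) (use E r fin in auto)
  then have "card E * card B \<le> card W * card B" using up unfolding card_cartesian_product by linarith
  then show ?thesis using B0 by simp
qed

section \<open>Ring automorphisms and their action on residue classes\<close>

definition ring_automorphism :: "('a::comm_ring_1 \<Rightarrow> 'a) \<Rightarrow> bool" where
  "ring_automorphism \<sigma> \<longleftrightarrow> bij \<sigma> \<and> \<sigma> 1 = 1 \<and> (\<forall>x y. \<sigma> (x + y) = \<sigma> x + \<sigma> y) \<and> (\<forall>x y. \<sigma> (x * y) = \<sigma> x * \<sigma> y)"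

lemma ring_automorphismD:
  assumes "ring_automorphism \<sigma>"
  shows "bij \<sigma>" "\<sigma> 1 = 1" "\<sigma> (x + y) = \<sigma> x + \<sigma> y" "\<sigma> (x * y) = \<sigma> x * \<sigma> y" "\<sigma> 0 = 0" "\<sigma> (- x) = - \<sigma> x"
    "\<sigma> (x - y) = \<sigma> x - \<sigma> y" "\<sigma> (x ^ k) = \<sigma> x ^ k"
proof -
  show 1: "bij \<sigma>" "\<sigma> 1 = 1" "\<sigma> (x + y) = \<sigma> x + \<sigma> y" "\<sigma> (x * y) = \<sigma> x * \<sigma> y" for x y
    using assms by (auto simp: ring_automorphism_def)
  show 0: "\<sigma> 0 = 0" using 1(3)[of 0 0] by simp
  show m: "\<sigma> (- x) = - \<sigma> x" for x using 1(3)[of x "-x"] 0 by (simp add: eq_neg_iff_add_eq_0 add.commute)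
  show "\<sigma> (x - y) = \<sigma> x - \<sigma> y" using 1(3)[of x "-y"] m by simp
  show "\<sigma> (x ^ k) = \<sigma> x ^ k" using 1 by (induction k) auto
qed

lemma ring_automorphism_inv:
  assumes "ring_automorphism \<sigma>"
  shows "ring_automorphism (inv_into UNIV \<sigma>)"
proof -
  note s = ring_automorphismD[OF assms]
  have "surj \<sigma>" using s(1) by (rule bij_is_surj)
  have i: "inv_into UNIV \<sigma> (\<sigma> x) = x" for x using s(1) by (simp add: bij_is_inj)
  have j: "\<sigma> (inv_into UNIV \<sigma> x) = x" for x using \<open>surj \<sigma>\<close> by (simp add: surj_f_inv_f)
  have "inv_into UNIV \<sigma> (x + y) = inv_into UNIV \<sigma> x + inv_into UNIV \<sigma> y" "inv_into UNIV \<sigma> (x * y) = inv_into UNIV \<sigma> x * inv_into UNIV \<sigma> y" for x y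
    using i[of "inv_into UNIV \<sigma> x + inv_into UNIV \<sigma> y"] i[of "inv_into UNIV \<sigma> x * inv_into UNIV \<sigma> y"] by (simp_all add: s j)
  moreover have "inv_into UNIV \<sigma> 1 = 1" using i[of 1] s by simp
  ultimately show ?thesis using s(1) by (auto simp: ring_automorphism_def bij_imp_bij_inv)
qed

lemma ring_automorphism_comp:
  "ring_automorphism \<sigma> \<Longrightarrow> ring_automorphism \<tau> \<Longrightarrow> ring_automorphism (\<sigma> \<circ> \<tau>)"
  by (auto simp: ring_automorphism_def bij_comp)

lemma frob_ideal_automorphism:
  assumes "ring_automorphism \<sigma>" "x \<in> frob_ideal k"
  shows "\<sigma> x \<in> frob_ideal k"
proof -
  note s = ring_automorphismD[OF assms(1)]
  have "frob_ideal k \<subseteq> {x. \<sigma> x \<in> frob_ideal k}"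
  proof (rule frob_ideal_least)
    show "ideal_in UNIV {x. \<sigma> x \<in> frob_ideal k}"
      using ideal_in_frob_ideal[of k] by (auto simp: ideal_in_def s)
    show "x ^ Suc k - x \<in> {x. \<sigma> x \<in> frob_ideal k}" for x
      using frob_ideal_gen[of "\<sigma> x" k] by (simp add: s)
  qed
  then show ?thesis using assms(2) by blast
qed

definition residue_class :: "nat \<Rightarrow> 'a::comm_ring_1 \<Rightarrow> 'a set" where
  "residue_class k x = {y. x - y \<in> frob_ideal k}"

lemma residue_class_eq_iff: "residue_class k x = residue_class k y \<longleftrightarrow> x - y \<in> frob_ideal k"
proof
  note I = ideal_in_frob_ideal[of k]
  assume "residue_class k x = residue_class k y"
  moreover have "y \<in> residue_class k y" using ideal_in_zero[OF I] by (simp add: residue_class_def)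
  ultimately show "x - y \<in> frob_ideal k" by (auto simp: residue_class_def)
next
  note I = ideal_in_frob_ideal[of k]
  assume *: "x - y \<in> frob_ideal k"
  have "x - z \<in> frob_ideal k \<longleftrightarrow> y - z \<in> frob_ideal k" for z
    using ideal_in_add[OF I *, of "y - z"] ideal_in_diff[OF sub_ring_UNIV I _ *, of "x - z"] by auto
  then show "residue_class k x = residue_class k y" by (auto simp: residue_class_def)
qed

lemma finite_residue_classes:
  fixes xs :: "'a::comm_ring_1 list"
  assumes "gen_ring xs = UNIV" "k \<ge> 1"
  shows "finite (range (residue_class k :: 'a \<Rightarrow> _))"
proof -
  obtain W :: "'a set" where W: "finite W" "\<forall>z. \<exists>w\<in>W. z - w \<in> frob_ideal k"
    using fin_index_frob_ideal[OF assms] unfolding fin_index_def by auto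
  have "range (residue_class k) \<subseteq> residue_class k ` W" using W(2) by (auto simp: residue_class_eq_iff[symmetric])
  then show ?thesis using W(1) finite_subset by blast
qed

text \<open>Modulo \<open>frob_ideal l\<close> every element has an idempotent multiple \<open>x\<^sup>l\<close>, and finitely many
  idempotents have a join.\<close>

lemma frob_ideal_identity:
  fixes xs :: "'a::comm_ring_1 list" and I :: "'a set"
  assumes fg: "gen_ring xs = (UNIV :: 'a set)" and l: "l \<ge> 1" and I: "ideal_in UNIV I"
  shows "\<exists>e\<in>I. \<forall>x\<in>I. e * x - x \<in> frob_ideal l"
proof -
  note K = ideal_in_frob_ideal[of l]
  have "\<exists>e\<in>I. \<forall>x\<in>X. e * x - x \<in> frob_ideal l" if "finite X" "X \<subseteq> I" for X
    using that
  proof (induction X)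
    case empty
    then show ?case using ideal_in_zero[OF I] by blast
  next
    case (insert y X)
    then obtain e where e: "e \<in> I" "\<forall>x\<in>X. e * x - x \<in> frob_ideal l" by auto
    have y: "y \<in> I" using insert by auto
    define f where "f = y ^ l"
    have f: "f \<in> I" unfolding f_def using y l ideal_in_mult'[OF I UNIV_I y, of "y ^ (l - 1)"]
      by (simp add: power_eq_if)
    have "f * y - y \<in> frob_ideal l" using frob_ideal_gen[of y l] by (simp add: f_def mult.commute)
    then have "(1 - e) * (f * y - y) \<in> frob_ideal l" using ideal_in_mult[OF K] by blast
    then have "(e + f - e * f) * y - y \<in> frob_ideal l" by (simp add: algebra_simps)
    moreover have "(e + f - e * f) * x - x \<in> frob_ideal l" if "x \<in> X" for x
    proof -
      have "(1 - f) * (e * x - x) \<in> frob_ideal l" using ideal_in_mult[OF K UNIV_I] e that by blast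
      then show ?thesis by (simp add: algebra_simps)
    qed
    moreover have "e + f - e * f \<in> I"
      using e f by (intro ideal_in_diff[OF sub_ring_UNIV I] ideal_in_add[OF I] ideal_in_mult[OF I]) auto
    ultimately show ?case by auto
  qed
  note join = this
  have "finite (residue_class l ` I)" using finite_residue_classes[OF fg l] by (rule rev_finite_subset) auto
  then obtain X where X: "X \<subseteq> I" "finite X" "residue_class l ` I = residue_class l ` X"
    by (meson finite_subset_image subset_refl)
  obtain e where e: "e \<in> I" "\<forall>x\<in>X. e * x - x \<in> frob_ideal l" using join[OF X(2,1)] by blast
  have "e * x - x \<in> frob_ideal l" if "x \<in> I" for x
  proof -
    have "residue_class l x \<in> residue_class l ` X" unfolding X(3)[symmetric] using that by (rule imageI)
    then obtain x' where x': "x' \<in> X" "residue_class l x = residue_class l x'" by (elim imageE)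
    then have "(e - 1) * (x - x') + (e * x' - x') \<in> frob_ideal l"
      using e by (intro ideal_in_add[OF K] ideal_in_mult[OF K]) (auto simp: residue_class_eq_iff)
    then show ?thesis by (simp add: algebra_simps)
  qed
  then show ?thesis using e by blast
qed

text \<open>As \<open>x ^ Suc k - x\<close> has finitely many roots, it is non-zero for some
  \<open>x\<close> in an infinite domain. Residual finiteness gives an index \<open>k'\<close> whose
  ideal misses this element of \<open>frob_ideal k\<close>; passing to \<open>k * k'\<close> keeps
  divisibility, hence inclusion, along the list.\<close>

lemma frob_ideal_chain:
  fixes xs :: "'a::idom list"
  assumes fg: "gen_ring xs = (UNIV :: 'a set)" and inf: "infinite (UNIV :: 'a set)"
  shows "\<exists>ks. length ks = s \<and> (\<forall>k\<in>set ks. k \<ge> 1) \<and>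
    (\<forall>i<s. \<forall>j<i. ks ! j dvd ks ! i \<and> \<not> frob_ideal (ks ! j) \<subseteq> (frob_ideal (ks ! i) :: 'a set))"
proof (induction s)
  case (Suc s)
  then obtain ks where ks: "length ks = s" "\<forall>k\<in>set ks. k \<ge> 1"
    "\<forall>i<s. \<forall>j<i. ks ! j dvd ks ! i \<and> \<not> frob_ideal (ks ! j) \<subseteq> (frob_ideal (ks ! i) :: 'a set)" by blast
  \<comment> \<open>The last index of the chain, or 1 to start an empty one.\<close>
  define k where "k = (if s = 0 then 1 else ks ! (s - 1))"
  have k: "k \<ge> 1" using ks by (auto simp: k_def)
  have "finite {x::'a. poly (monom 1 (Suc k) - monom 1 1) x = 0}"
  proof (rule poly_roots_finite)
    have "coeff (monom 1 (Suc k) - monom 1 1 :: 'a poly) (Suc k) = 1" using k by simp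
    then show "monom 1 (Suc k) - monom 1 1 \<noteq> (0 :: 'a poly)" by (metis coeff_0 zero_neq_one)
  qed
  then have "{x::'a. poly (monom 1 (Suc k) - monom 1 1) x = 0} \<noteq> UNIV" using inf by metis
  then obtain x :: 'a where x: "x ^ Suc k - x \<noteq> 0" by (auto simp: poly_monom)
  obtain k' where k': "k' \<ge> 1" "x ^ Suc k - x \<notin> frob_ideal k'" using frob_ideal_residual[OF fg x] by blast
  define l where "l = k * k'"
  have l: "l \<ge> 1" "k dvd l" "k' dvd l" using k k' by (auto simp: l_def)
  have kl: "\<not> frob_ideal k \<subseteq> (frob_ideal l :: 'a set)"
    using frob_ideal_gen[of x k] k' frob_ideal_dvd[OF l(3), where 'a='a] by blast
  have "ks ! j dvd l \<and> \<not> frob_ideal (ks ! j) \<subseteq> (frob_ideal l :: 'a set)" if j: "j < s" for j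
  proof -
    have kk: "k = ks ! (s - 1)" using j by (simp add: k_def)
    have "ks ! j dvd k"
    proof (cases "j = s - 1")
      case False
      then show ?thesis using ks(3) j kk by auto
    qed (simp add: kk)
    then show ?thesis using l kl frob_ideal_dvd[of "ks ! j" k, where 'a='a] by (meson dvd_trans order_trans)
  qed
  then have "length (ks @ [l]) = Suc s \<and> (\<forall>k\<in>set (ks @ [l]). k \<ge> 1) \<and>
    (\<forall>i<Suc s. \<forall>j<i. (ks @ [l]) ! j dvd (ks @ [l]) ! i \<and> \<not> frob_ideal ((ks @ [l]) ! j) \<subseteq> (frob_ideal ((ks @ [l]) ! i) :: 'a set))"
    using ks l by (auto simp: nth_append less_Suc_eq)
  then show ?case by blast
qed simp

theorem infinite_additive_cosets:
  fixes xs :: "'a::idom list"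
  assumes fg: "gen_ring xs = (UNIV :: 'a set)" and inf: "infinite (UNIV :: 'a set)"
    and \<sigma>: "ring_automorphism (\<sigma> :: 'a \<Rightarrow> 'a)" and W: "finite W"
  shows "\<exists>r. \<forall>w\<in>W. \<forall>x. r \<noteq> w + (x - \<sigma> x)"
proof (rule ccontr)
  assume "\<not> ?thesis"
  then have cov: "\<And>r. \<exists>w\<in>W. \<exists>x. r = w + (x - \<sigma> x)" by blast
  note s = ring_automorphismD[OF \<sigma>]
  \<comment> \<open>One ideal more than the count of cosets permits.\<close>
  define n where "n = Suc (card W)"
  obtain ks where ks: "length ks = n" "\<forall>k\<in>set ks. k \<ge> 1"
    "\<forall>i<n. \<forall>j<i. ks ! j dvd ks ! i \<and> \<not> frob_ideal (ks ! j) \<subseteq> (frob_ideal (ks ! i) :: 'a set)"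
    using frob_ideal_chain[OF fg inf] by blast
  define l where "l = ks ! (n - 1)"
  have l: "l \<ge> 1" using ks by (simp add: l_def n_def)
  have dl: "ks ! i dvd l" if "i < n" for i
    using ks(3) that by (cases "i = n - 1") (auto simp: l_def n_def)
  note K = ideal_in_frob_ideal[of l, where 'a='a]
  have "\<forall>i. \<exists>e\<in>frob_ideal (ks ! i). \<forall>x\<in>frob_ideal (ks ! i). e * x - x \<in> (frob_ideal l :: 'a set)"
    using frob_ideal_identity[OF fg l ideal_in_frob_ideal] by blast
  then obtain e where e: "\<And>i. e i \<in> frob_ideal (ks ! i)"
    "\<And>i x. x \<in> frob_ideal (ks ! i) \<Longrightarrow> e i * x - x \<in> (frob_ideal l :: 'a set)" by metis
  \<comment> \<open>Uniqueness of an identity element: since the ideal is invariant,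
    \<open>e i\<close> and \<open>\<sigma> (e i)\<close> both act on it as the identity, and both
    are congruent to their product.\<close>
  have fixed: "e i - \<sigma> (e i) \<in> frob_ideal l" for i
  proof -
    let ?t = "inv_into UNIV \<sigma> (e i)"
    have t: "\<sigma> ?t = e i" using s(1) by (simp add: bij_is_surj surj_f_inv_f)
    have "?t \<in> frob_ideal (ks ! i)" using frob_ideal_automorphism[OF ring_automorphism_inv[OF \<sigma>] e(1)] .
    then have "\<sigma> (e i * ?t - ?t) \<in> frob_ideal l" using frob_ideal_automorphism[OF \<sigma> e(2)] by blast
    then have 1: "\<sigma> (e i) * e i - e i \<in> frob_ideal l" by (simp add: s t)
    have 2: "e i * \<sigma> (e i) - \<sigma> (e i) \<in> frob_ideal l" using e(2)[OF frob_ideal_automorphism[OF \<sigma> e(1)]] .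
    show ?thesis using ideal_in_diff[OF sub_ring_UNIV K 2 1] by (simp add: mult.commute)
  qed
  \<comment> \<open>If the two agreed, every \<open>x\<close> in the larger ideal would be congruent
    to \<open>x * e j\<close> and so lie in the smaller one.\<close>
  have less: "residue_class l (e i) \<noteq> residue_class l (e j)" if "i < j" "j < n" for i j
  proof
    assume "residue_class l (e i) = residue_class l (e j)"
    then have *: "e i - e j \<in> frob_ideal l" by (simp add: residue_class_eq_iff)
    have "frob_ideal (ks ! i) \<subseteq> (frob_ideal (ks ! j) :: 'a set)"
    proof
      fix x :: 'a assume x: "x \<in> frob_ideal (ks ! i)"
      have "x * (e i - e j) - (e i * x - x) \<in> frob_ideal l"
        by (intro ideal_in_diff[OF sub_ring_UNIV K] ideal_in_mult[OF K UNIV_I *] e(2) x)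
      then have "x - x * e j \<in> frob_ideal l" by (simp add: algebra_simps)
      then have "x - x * e j \<in> frob_ideal (ks ! j)" using frob_ideal_dvd[OF dl[OF that(2)], where 'a='a] by blast
      moreover have "x * e j \<in> frob_ideal (ks ! j)" using ideal_in_mult[OF ideal_in_frob_ideal UNIV_I e(1)] .
      ultimately show "x \<in> frob_ideal (ks ! j)" using ideal_in_add[OF ideal_in_frob_ideal] by fastforce
    qed
    then show False using ks(3) that by blast
  qed
  have dist: "i = j" if "i < n" "j < n" "residue_class l (e i) = residue_class l (e j)" for i j
    using less that by (metis linorder_neqE_nat)
  define E where "E = e ` {..<n}"
  have inje: "inj_on e {..<n}" using dist by (auto simp: inj_on_def)
  have cE: "card E = n" unfolding E_def using card_image[OF inje] by simp
  define G :: "'a monoid" where "G = \<lparr>carrier = UNIV, monoid.mult = (+), one = 0\<rparr>"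
  have "comm_group G"
    by (rule comm_groupI) (auto simp: G_def algebra_simps intro!: exI[of _ "- _"])
  moreover have "(\<lambda>x. x - \<sigma> x) \<in> hom G G" by (auto simp: hom_def G_def s)
  moreover have "finite (residue_class l ` carrier G)" using finite_residue_classes[OF fg l] by (simp add: G_def)
  moreover have "residue_class l (x - \<sigma> x) = residue_class l (y - \<sigma> y)" if xy: "residue_class l x = residue_class l y" for x y
  proof -
    have d: "x - y \<in> frob_ideal l" using xy by (simp add: residue_class_eq_iff)
    have "(x - y) - \<sigma> (x - y) \<in> frob_ideal l"
      using ideal_in_diff[OF sub_ring_UNIV K d frob_ideal_automorphism[OF \<sigma> d]] .
    then show ?thesis by (simp add: residue_class_eq_iff s algebra_simps)
  qed
  moreover have "inj_on (residue_class l) E" using dist by (auto simp: E_def inj_on_def)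
  ultimately have "card E \<le> card W"
    using fixed by (intro card_fixed_le_card_cosets[of G "\<lambda>x. x - \<sigma> x" "residue_class l" W E])
      (use W cov in \<open>auto simp: G_def residue_class_eq_iff E_def\<close>)
  then show False using cE by (simp add: n_def)
qed

text \<open>The count for the endomorphism \<open>u / \<sigma> u\<close> of the unit group: its
  kernel consists of the fixed units, and \<open>cov\<close> says that its image has at most
  \<open>card W\<close> cosets. The finite quotient is chosen last, so that
  \<open>Suc (card W)\<close> given fixed units stay distinct in it.\<close>

theorem finite_fixed_units:
  fixes xs :: "'a::idom list"
  assumes fg: "gen_ring xs = (UNIV :: 'a set)" and \<sigma>: "ring_automorphism (\<sigma> :: 'a \<Rightarrow> 'a)"
    and W: "finite W" "\<And>w. w \<in> W \<Longrightarrow> w dvd 1"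
    and cov: "\<And>u. u dvd 1 \<Longrightarrow> \<exists>w\<in>W. \<exists>x. x dvd 1 \<and> u * \<sigma> x = w * x"
  shows "finite {u. u dvd 1 \<and> \<sigma> u = u}"
proof (rule ccontr)
  assume "infinite {u. u dvd 1 \<and> \<sigma> u = u}"
  then obtain E where E: "finite E" "card E = Suc (card W)" "E \<subseteq> {u. u dvd 1 \<and> \<sigma> u = u}"
    using infinite_arbitrarily_large by blast
  note s = ring_automorphismD[OF \<sigma>]
  \<comment> \<open>An ideal containing one difference contains the product, so avoiding the single
    non-zero element \<open>a\<close> separates all of \<open>E\<close>.\<close>
  define a where "a = (\<Prod>(x, y)\<in>{(x, y). x \<in> E \<and> y \<in> E \<and> x \<noteq> y}. x - y)"
  have fE: "finite {(x, y). x \<in> E \<and> y \<in> E \<and> x \<noteq> y}"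
    by (rule finite_subset[of _ "E \<times> E"]) (use E in auto)
  have "a \<noteq> 0" unfolding a_def using fE by (auto simp: prod_zero_iff)
  then obtain k where k: "k \<ge> 1" "a \<notin> frob_ideal k" using frob_ideal_residual[OF fg] by blast
  note K = ideal_in_frob_ideal[of k, where 'a='a]
  have inj: "inj_on (residue_class k) E"
  proof (rule inj_onI, rule ccontr)
    fix x y assume xy: "x \<in> E" "y \<in> E" "residue_class k x = residue_class k y" "x \<noteq> y"
    have "(x - y) dvd a" unfolding a_def
      using dvd_prod_eqI[OF fE, of "(x, y)" "x - y" "\<lambda>(x, y). x - y"] xy by auto
    then show False using k xy ideal_in_mult'[OF K UNIV_I] by (auto simp: residue_class_eq_iff elim!: dvdE)
  qed
  define G :: "'a monoid" where "G = \<lparr>carrier = {u. u dvd 1}, monoid.mult = (*), one = 1\<rparr>"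
  have invu: "\<exists>v. v dvd 1 \<and> v * u = 1" if "u dvd 1" for u :: 'a
    using that by (metis dvd_def dvd_triv_right mult.commute)
  have G: "comm_group G"
  proof (rule comm_groupI)
    show "\<exists>y\<in>carrier G. y \<otimes>\<^bsub>G\<^esub> x = \<one>\<^bsub>G\<^esub>" if "x \<in> carrier G" for x
      using invu[of x] that by (auto simp: G_def)
  qed (auto simp: G_def mult_ac intro: mult_dvd_mono[of _ 1 _ 1, simplified])
  interpret G: comm_group G by fact
  have su: "\<sigma> u dvd 1" if "u dvd 1" for u using that s by (metis dvdE dvdI)
  have iG: "u * inv\<^bsub>G\<^esub> u = 1" "inv\<^bsub>G\<^esub> u dvd 1" if "u dvd 1" for u
    using G.r_inv[of u] G.inv_closed[of u] that by (auto simp: G_def)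
  define f where "f u = u * inv\<^bsub>G\<^esub> (\<sigma> u)" for u
  have f: "f \<in> hom G G"
  proof (rule homI)
    fix x y assume "x \<in> carrier G" "y \<in> carrier G"
    then have xy: "x dvd 1" "y dvd 1" by (auto simp: G_def)
    then show "f x \<in> carrier G" using iG(2) su by (auto simp: f_def G_def intro: mult_dvd_mono[of _ 1 _ 1, simplified])
    have "inv\<^bsub>G\<^esub> (\<sigma> x \<otimes>\<^bsub>G\<^esub> \<sigma> y) = inv\<^bsub>G\<^esub> (\<sigma> x) \<otimes>\<^bsub>G\<^esub> inv\<^bsub>G\<^esub> (\<sigma> y)"
      using su xy by (intro G.inv_mult) (auto simp: G_def)
    then show "f (x \<otimes>\<^bsub>G\<^esub> y) = f x \<otimes>\<^bsub>G\<^esub> f y" by (simp add: f_def G_def s mult_ac)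
  qed
  have fin: "finite (residue_class k ` carrier G)"
    using finite_residue_classes[OF fg k(1)] by (rule rev_finite_subset) auto
  have canc: "residue_class k (x * z) = residue_class k (y * z) \<longleftrightarrow> residue_class k x = residue_class k y"
    if z: "z dvd 1" for x y z :: 'a
  proof
    assume "residue_class k x = residue_class k y"
    then have "z * (x - y) \<in> frob_ideal k" using ideal_in_mult[OF K] by (simp add: residue_class_eq_iff)
    then show "residue_class k (x * z) = residue_class k (y * z)" by (simp add: residue_class_eq_iff algebra_simps)
  next
    assume "residue_class k (x * z) = residue_class k (y * z)"
    then have *: "x * z - y * z \<in> frob_ideal k" by (simp add: residue_class_eq_iff)
    obtain v where v: "v * z = 1" using invu[OF z] by blast
    have "v * (x * z - y * z) = (v * z) * (x - y)" by (simp add: algebra_simps)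
    then have "x - y \<in> frob_ideal k" using ideal_in_mult[OF K UNIV_I *, of v] v by simp
    then show "residue_class k x = residue_class k y" by (simp add: residue_class_eq_iff)
  qed
  have fcl: "residue_class k (f x) = residue_class k (f y)"
    if xy: "x dvd 1" "y dvd 1" and e: "residue_class k x = residue_class k y" for x y
  proof -
    have d: "x - y \<in> frob_ideal k" using e by (simp add: residue_class_eq_iff)
    have sd: "\<sigma> x - \<sigma> y \<in> frob_ideal k" using frob_ideal_automorphism[OF \<sigma> d] by (simp add: s)
    \<comment> \<open>The congruence between \<open>f x\<close> and \<open>f y\<close> is obtained
      with denominators cleared.\<close>
    have "\<sigma> y * (x - y) - y * (\<sigma> x - \<sigma> y) \<in> frob_ideal k"
      by (intro ideal_in_diff[OF sub_ring_UNIV K] ideal_in_mult[OF K UNIV_I] d sd)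
    then have d': "x * \<sigma> y - y * \<sigma> x \<in> frob_ideal k" by (simp add: algebra_simps)
    have ff: "f x * (\<sigma> x * \<sigma> y) = x * \<sigma> y" "f y * (\<sigma> x * \<sigma> y) = y * \<sigma> x"
      using iG(1)[OF su[OF xy(1)]] iG(1)[OF su[OF xy(2)]] unfolding f_def by (metis mult.assoc mult.commute mult_1)+
    have "f x * (\<sigma> x * \<sigma> y) - f y * (\<sigma> x * \<sigma> y) \<in> frob_ideal k" unfolding ff by (rule d')
    then have "residue_class k (f x * (\<sigma> x * \<sigma> y)) = residue_class k (f y * (\<sigma> x * \<sigma> y))" by (simp add: residue_class_eq_iff)
    moreover have "\<sigma> x * \<sigma> y dvd 1" using mult_dvd_mono[OF su[OF xy(1)] su[OF xy(2)]] by simp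
    ultimately show ?thesis using canc by blast
  qed
  have "card E \<le> card W"
  proof (rule card_fixed_le_card_cosets[OF G f fin])
    show "\<exists>w\<in>W. \<exists>x\<in>carrier G. g = w \<otimes>\<^bsub>G\<^esub> f x" if gG: "g \<in> carrier G" for g
    proof -
      obtain w x where wx: "w \<in> W" "x dvd 1" "g * \<sigma> x = w * x"
        using cov[of g] gG by (auto simp: G_def)
      have "g = g * (\<sigma> x * inv\<^bsub>G\<^esub> (\<sigma> x))" using iG(1)[OF su[OF wx(2)]] by simp
      also have "\<dots> = w * f x" using wx(3) by (simp add: f_def mult.assoc[symmetric])
      finally show ?thesis using wx by (auto simp: G_def)
    qed
    show "residue_class k (f e) = residue_class k \<one>\<^bsub>G\<^esub>" if "e \<in> E" for e
      using E(3) that iG(1)[of e] by (auto simp: f_def G_def)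
    show "residue_class k (x \<otimes>\<^bsub>G\<^esub> z) = residue_class k (y \<otimes>\<^bsub>G\<^esub> z) \<longleftrightarrow> residue_class k x = residue_class k y"
      if "z \<in> carrier G" for x y z using canc[of z x y] that by (simp add: G_def)
    show "residue_class k (f x) = residue_class k (f y)"
      if "x \<in> carrier G" "y \<in> carrier G" "residue_class k x = residue_class k y" for x y
      using that by (intro fcl) (simp_all add: G_def)
    show "W \<subseteq> carrier G" using W(2) by (auto simp: G_def)
    show "E \<subseteq> carrier G" using E(3) by (auto simp: G_def)
  qed (fact W(1) E(1) inj)+
  then show False using E by simp
qed

section \<open>The triangular group\<close>

definition uinv :: "'a::comm_ring_1 \<Rightarrow> 'a" where
  "uinv u = (SOME v. u * v = 1)"

lemma uinv_right: "u dvd 1 \<Longrightarrow> u * uinv u = (1::'a::comm_ring_1)"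
  unfolding uinv_def by (rule someI_ex) (metis dvdE)

lemma uinv_left: "u dvd 1 \<Longrightarrow> uinv u * u = (1::'a::comm_ring_1)"
  using uinv_right[of u] by (simp add: mult.commute)

lemma uinv_dvd: "u dvd 1 \<Longrightarrow> uinv u dvd (1::'a::comm_ring_1)"
  using uinv_left[of u] by (metis dvd_triv_left)

lemma uinv_one: "uinv 1 = (1::'a::comm_ring_1)"
  using uinv_right[of "1::'a"] by simp

lemma unit_mult: "u dvd 1 \<Longrightarrow> v dvd 1 \<Longrightarrow> u * v dvd (1::'a::comm_ring_1)"
  using mult_dvd_mono[of u 1 v 1] by simp

lemma unit_nonzero: "u dvd 1 \<Longrightarrow> u \<noteq> (0::'a::idom)"
  by auto

lemma uinv_mult:
  assumes "u dvd 1" "v dvd (1::'a::idom)"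
  shows "uinv (u * v) = uinv u * uinv v"
proof -
  have "(u * v) * uinv (u * v) = 1" using assms by (intro uinv_right unit_mult)
  moreover have "(u * v) * (uinv u * uinv v) = (u * uinv u) * (v * uinv v)" by (simp add: mult_ac)
  then have "(u * v) * (uinv u * uinv v) = 1" using assms by (simp add: uinv_right)
  ultimately have "(u * v) * uinv (u * v) = (u * v) * (uinv u * uinv v)" by simp
  then show ?thesis using unit_nonzero[OF assms(1)] unit_nonzero[OF assms(2)] by simp
qed

section \<open>Triangular matrices form a group\<close>

lemma mat_mult_assoc:
  "mat_mult n (mat_mult n A B) C = mat_mult n A (mat_mult n B C)"
proof (intro ext)
  fix i j
  show "mat_mult n (mat_mult n A B) C i j = mat_mult n A (mat_mult n B C) i j"
  proof (cases "i \<in> {1..n} \<and> j \<in> {1..n}")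
    case True
    have "mat_mult n (mat_mult n A B) C i j = (\<Sum>k=1..n. (\<Sum>l=1..n. A i l * B l k) * C k j)"
      using True by (simp add: mat_mult_def)
    also have "\<dots> = (\<Sum>k=1..n. \<Sum>l=1..n. A i l * (B l k * C k j))"
      by (simp add: sum_distrib_right mult.assoc)
    also have "\<dots> = (\<Sum>l=1..n. \<Sum>k=1..n. A i l * (B l k * C k j))" by (rule sum.swap)
    also have "\<dots> = (\<Sum>l=1..n. A i l * (\<Sum>k=1..n. B l k * C k j))" by (simp add: sum_distrib_left)
    also have "\<dots> = mat_mult n A (mat_mult n B C) i j" using True by (simp add: mat_mult_def)
    finally show ?thesis .
  qed (auto simp: mat_mult_def)
qed

lemma S_set_zero: "A \<in> S_set n I \<Longrightarrow> \<not> (1 \<le> i \<and> i \<le> j \<and> j \<le> n) \<Longrightarrow> A i j = 0"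
proof -
  assume A: "A \<in> S_set n I" and ij: "\<not> (1 \<le> i \<and> i \<le> j \<and> j \<le> n)"
  have 1: "A i j = 0" if "i \<notin> {1..n} \<or> j \<notin> {1..n}" using A that unfolding S_set_def by blast
  have 2: "A i j = 0" if "i \<in> {1..n}" "j \<in> {1..n}" "j < i" using A that unfolding S_set_def by blast
  show ?thesis using 1 2 ij by (cases "i \<in> {1..n} \<and> j \<in> {1..n}") auto
qed

lemma S_set_diag: "A \<in> S_set n I \<Longrightarrow> 1 \<le> i \<Longrightarrow> i \<le> n \<Longrightarrow> A i i dvd 1"
  unfolding S_set_def by auto

lemma S_set_diag_one: "A \<in> S_set n I \<Longrightarrow> 1 \<le> i \<Longrightarrow> i \<le> n \<Longrightarrow> i \<notin> I \<Longrightarrow> A i i = 1"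
  unfolding S_set_def by auto

lemma S_setI:
  assumes "\<And>i j. \<not> (1 \<le> i \<and> i \<le> j \<and> j \<le> n) \<Longrightarrow> A i j = 0"
    "\<And>i. 1 \<le> i \<Longrightarrow> i \<le> n \<Longrightarrow> A i i dvd 1" "\<And>i. 1 \<le> i \<Longrightarrow> i \<le> n \<Longrightarrow> i \<notin> I \<Longrightarrow> A i i = 1"
  shows "A \<in> S_set n I"
  unfolding S_set_def using assms by auto

lemma mat_mult_triangular:
  assumes "A \<in> S_set n I" "B \<in> S_set n J"
  shows "mat_mult n A B i j = (\<Sum>k=i..j. A i k * B k j)"
proof (cases "i \<in> {1..n} \<and> j \<in> {1..n}")
  case True
  have "(\<Sum>k=1..n. A i k * B k j) = (\<Sum>k=i..j. A i k * B k j)"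
  proof (rule sum.mono_neutral_right)
    show "\<forall>k\<in>{1..n} - {i..j}. A i k * B k j = 0"
      using S_set_zero[OF assms(1), of i] S_set_zero[OF assms(2), of _ j] by auto
  qed (use True in auto)
  then show ?thesis using True by (simp add: mat_mult_def)
next
  case False
  have "A i k * B k j = 0" if "k \<in> {i..j}" for k
    using False that S_set_zero[OF assms(1), of i k] S_set_zero[OF assms(2), of k j] by (auto simp: not_le)
  then show ?thesis using False by (auto simp: mat_mult_def)
qed

lemma mat_mult_closed:
  assumes "A \<in> S_set n I" "B \<in> S_set n I"
  shows "mat_mult n A B \<in> S_set n I"
proof (rule S_setI)
  show "mat_mult n A B i j = 0" if "\<not> (1 \<le> i \<and> i \<le> j \<and> j \<le> n)" for i j
  proof (cases "i \<le> j")
    case True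
    then show ?thesis using that by (auto simp: mat_mult_def)
  qed (simp add: mat_mult_triangular[OF assms])
  show "mat_mult n A B i i dvd 1" if "1 \<le> i" "i \<le> n" for i
    using unit_mult[OF S_set_diag[OF assms(1) that] S_set_diag[OF assms(2) that]]
    by (simp add: mat_mult_triangular[OF assms])
  show "mat_mult n A B i i = 1" if "1 \<le> i" "i \<le> n" "i \<notin> I" for i
    using S_set_diag_one[OF assms(1) that] S_set_diag_one[OF assms(2) that]
    by (simp add: mat_mult_triangular[OF assms])
qed

lemma mat_one_in: "mat_one n \<in> S_set n I"
  by (rule S_setI) (auto simp: mat_one_def)

lemma mat_one_left: "A \<in> S_set n I \<Longrightarrow> mat_mult n (mat_one n) A = A"
proof (intro ext)
  fix i j assume A: "A \<in> S_set n I"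
  show "mat_mult n (mat_one n) A i j = A i j"
  proof (cases "1 \<le> i \<and> i \<le> j \<and> j \<le> n")
    case True
    then have "(\<Sum>k=1..n. mat_one n i k * A k j) = (\<Sum>k=1..n. if i = k then A k j else 0)"
      by (intro sum.cong) (auto simp: mat_one_def)
    then show ?thesis using True by (simp add: mat_mult_def)
  qed (use A S_set_zero[OF A] S_set_zero[OF mat_mult_closed[OF mat_one_in A]] in auto)
qed

text \<open>Forward substitution in each row of the inverse: column \<open>j\<close> of the product
  determines the entry with index \<open>j\<close>, whose coefficient is the diagonal entry of
  \<open>A\<close>, a unit. Columns treated earlier do not involve the new entry.\<close>

lemma mat_left_inverse:
  assumes A: "A \<in> S_set n (I :: nat set)"
  shows "\<exists>B\<in>S_set n I. mat_mult n B A = mat_one n"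
proof -
  have "\<exists>y. \<forall>j. i \<le> j \<and> j \<le> m \<longrightarrow> (\<Sum>k=i..j. y k * A k j) = (if j = i then 1 else 0)"
    if "1 \<le> i" "m \<le> n" for i m
    using that(2)
  proof (induction m)
    case 0
    then show ?case using that by auto
  next
    case (Suc m)
    then obtain y where y: "\<And>j. i \<le> j \<Longrightarrow> j \<le> m \<Longrightarrow> (\<Sum>k=i..j. y k * A k j) = (if j = i then 1 else 0)" by auto
    show ?case
    proof (cases "i \<le> Suc m")
      case False
      then show ?thesis by auto
    next
      case True
      define d where "d = (if Suc m = i then 1 else 0 :: 'a)"
      define y' where "y' = y(Suc m := (d - (\<Sum>k=i..m. y k * A k (Suc m))) * uinv (A (Suc m) (Suc m)))"
      have eq: "(\<Sum>k=i..j. y' k * A k l) = (\<Sum>k=i..j. y k * A k l)" if "j \<le> m" for j l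
        using that by (intro sum.cong) (auto simp: y'_def)
      have u: "uinv (A (Suc m) (Suc m)) * A (Suc m) (Suc m) = 1"
        using S_set_diag[OF A, of "Suc m"] Suc.prems by (simp add: uinv_left)
      have "(\<Sum>k=i..Suc m. y' k * A k (Suc m)) = (\<Sum>k=i..m. y k * A k (Suc m)) + y' (Suc m) * A (Suc m) (Suc m)"
        using True eq[of m] by simp
      also have "y' (Suc m) * A (Suc m) (Suc m) = d - (\<Sum>k=i..m. y k * A k (Suc m))"
        unfolding y'_def by (simp add: mult.assoc u)
      finally have "(\<Sum>k=i..Suc m. y' k * A k (Suc m)) = d" by simp
      then have "(\<Sum>k=i..j. y' k * A k j) = (if j = i then 1 else 0)" if "i \<le> j" "j \<le> Suc m" for j
        using y[of j] eq[of j j] that unfolding d_def by (cases "j = Suc m") (simp_all del: sum.cl_ivl_Suc)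
      then show ?thesis by blast
    qed
  qed
  then have "\<forall>i. \<exists>y. 1 \<le> i \<longrightarrow> (\<forall>j. i \<le> j \<and> j \<le> n \<longrightarrow> (\<Sum>k=i..j. y k * A k j) = (if j = i then 1 else 0))"
    by blast
  then obtain Y where Y: "\<And>i j. 1 \<le> i \<Longrightarrow> i \<le> j \<Longrightarrow> j \<le> n \<Longrightarrow> (\<Sum>k=i..j. Y i k * A k j) = (if j = i then 1 else 0)"
    by metis
  define B where "B i j = (if 1 \<le> i \<and> i \<le> j \<and> j \<le> n then Y i j else 0)" for i j
  have diag: "B i i * A i i = 1" if "1 \<le> i" "i \<le> n" for i
    using Y[of i i] that by (simp add: B_def)
  have B: "B \<in> S_set n I"
  proof (rule S_setI)
    show "B i i dvd 1" if "1 \<le> i" "i \<le> n" for i using diag[OF that] by (metis dvd_triv_left)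
    show "B i i = 1" if "1 \<le> i" "i \<le> n" "i \<notin> I" for i
      using diag[OF that(1,2)] S_set_diag_one[OF A that] by simp
  qed (auto simp: B_def)
  moreover have "mat_mult n B A = mat_one n"
  proof (intro ext)
    fix i j
    show "mat_mult n B A i j = mat_one n i j"
    proof (cases "1 \<le> i \<and> i \<le> j \<and> j \<le> n")
      case True
      then have "(\<Sum>k=i..j. B i k * A k j) = (\<Sum>k=i..j. Y i k * A k j)" by (intro sum.cong) (auto simp: B_def)
      then show ?thesis unfolding mat_mult_triangular[OF B A] using Y True by (auto simp: mat_one_def)
    next
      case False
      then show ?thesis using S_set_zero[OF mat_mult_closed[OF B A]] by (auto simp: mat_one_def)
    qed
  qed
  ultimately show ?thesis by blast
qed

lemma group_S_group: "group (S_group n I)"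
  by (rule groupI) (auto simp: S_group_def mat_mult_closed mat_one_in mat_mult_assoc mat_one_left intro: mat_left_inverse)

section \<open>Elementary and diagonal matrices\<close>

definition elem_mat :: "nat \<Rightarrow> nat \<Rightarrow> nat \<Rightarrow> 'a::comm_ring_1 \<Rightarrow> nat \<Rightarrow> nat \<Rightarrow> 'a" where
  "elem_mat n i j a = (\<lambda>r c. if r = i \<and> c = j then a else mat_one n r c)"

definition diag_mat :: "nat \<Rightarrow> (nat \<Rightarrow> 'a::comm_ring_1) \<Rightarrow> nat \<Rightarrow> nat \<Rightarrow> 'a" where
  "diag_mat n f = (\<lambda>r c. if r = c \<and> r \<in> {1..n} then f r else 0)"

lemma elem_mat_in: "1 \<le> i \<Longrightarrow> i < j \<Longrightarrow> j \<le> n \<Longrightarrow> elem_mat n i j a \<in> S_set n I"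
  by (rule S_setI) (auto simp: elem_mat_def mat_one_def)

lemma diag_mat_in:
  "(\<And>i. f i dvd 1) \<Longrightarrow> (\<And>i. i \<notin> I \<Longrightarrow> f i = 1) \<Longrightarrow> diag_mat n f \<in> S_set n I"
  by (rule S_setI) (auto simp: diag_mat_def)

lemma mult_elem_mat:
  assumes A: "A \<in> S_set n I" and ij: "1 \<le> i" "i < j" "j \<le> n"
  shows "mat_mult n A (elem_mat n i j a) r c = A r c + (if c = j then A r i * a else 0)"
proof (cases "r \<in> {1..n} \<and> c \<in> {1..n}")
  case True
  have "(\<Sum>k=1..n. A r k * elem_mat n i j a k c) = (\<Sum>k=1..n. (if k = c then A r k else 0) + (if k = i then (if c = j then A r k * a else 0) else 0))"
    using ij by (intro sum.cong) (auto simp: elem_mat_def mat_one_def)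
  also have "\<dots> = A r c + (if c = j then A r i * a else 0)"
    using True ij by (simp add: sum.distrib)
  finally show ?thesis using True by (simp add: mat_mult_def)
next
  case False
  then show ?thesis using S_set_zero[OF A, of r] ij by (auto simp: mat_mult_def)
qed

lemma elem_mat_mult:
  assumes A: "A \<in> S_set n I" and ij: "1 \<le> i" "i < j" "j \<le> n"
  shows "mat_mult n (elem_mat n i j a) A r c = A r c + (if r = i then a * A j c else 0)"
proof (cases "r \<in> {1..n} \<and> c \<in> {1..n}")
  case True
  have "(\<Sum>k=1..n. elem_mat n i j a r k * A k c) = (\<Sum>k=1..n. (if k = r then A k c else 0) + (if k = j then (if r = i then a * A k c else 0) else 0))"
    using ij True by (intro sum.cong) (auto simp: elem_mat_def mat_one_def)
  also have "\<dots> = A r c + (if r = i then a * A j c else 0)"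
    using True ij by (simp add: sum.distrib)
  finally show ?thesis using True by (simp add: mat_mult_def)
next
  case False
  then show ?thesis using S_set_zero[OF A, of _ c] S_set_zero[OF A, of r c] ij by (auto simp: mat_mult_def)
qed

lemma elem_mat_add:
  assumes ij: "1 \<le> i" "i < j" "j \<le> n"
  shows "mat_mult n (elem_mat n i j a) (elem_mat n i j b) = elem_mat n i j (a + b)"
proof (intro ext)
  fix r c
  show "mat_mult n (elem_mat n i j a) (elem_mat n i j b) r c = elem_mat n i j (a + b) r c"
    unfolding elem_mat_mult[OF elem_mat_in[OF ij] ij] using ij by (auto simp: elem_mat_def mat_one_def)
qed

lemma diag_mat_mult:
  assumes "A \<in> S_set n I"
  shows "mat_mult n (diag_mat n f) A r c = f r * A r c"
proof (cases "r \<in> {1..n} \<and> c \<in> {1..n}")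
  case True
  have "(\<Sum>k=1..n. diag_mat n f r k * A k c) = (\<Sum>k=1..n. if k = r then f r * A k c else 0)"
    using True by (intro sum.cong) (auto simp: diag_mat_def)
  then show ?thesis using True by (simp add: mat_mult_def)
next
  case False
  then show ?thesis using S_set_zero[OF assms, of r c] by (auto simp: mat_mult_def)
qed

lemma diag_mat_commute:
  assumes "diag_mat n f \<in> S_set n I" "diag_mat n g \<in> S_set n I"
  shows "mat_mult n (diag_mat n f) (diag_mat n g) = mat_mult n (diag_mat n g) (diag_mat n f)"
  by (intro ext, simp only: diag_mat_mult[OF assms(2)] diag_mat_mult[OF assms(1)]) (simp add: diag_mat_def)

text \<open>The block of rows and columns \<open>i\<close>, \<open>i + 1\<close> modulo scalars is an element \<open>(ch i g, vv i g)\<close> of the affine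
  group of the ring.\<close>

definition ch :: "nat \<Rightarrow> (nat \<Rightarrow> nat \<Rightarrow> 'a::comm_ring_1) \<Rightarrow> 'a" where
  "ch i g = g i i * uinv (g (Suc i) (Suc i))"

definition vv :: "nat \<Rightarrow> (nat \<Rightarrow> nat \<Rightarrow> 'a::comm_ring_1) \<Rightarrow> 'a" where
  "vv i g = g i (Suc i) * uinv (g (Suc i) (Suc i))"

section \<open>The group \<open>G\<close> and the affine coordinates of its elements\<close>

locale triangular_group =
  fixes n :: nat and I :: "nat set" and G :: "(nat \<Rightarrow> nat \<Rightarrow> 'a::idom) monoid" (structure)
  assumes G_eq: "G = S_group n I" and n4: "n \<ge> 4" and NG: "NG_condition n I"
begin

sublocale group G
  unfolding G_eq by (rule group_S_group)

lemma carrier_eq: "carrier G = S_set n I"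
  and mult_eq: "A \<otimes> B = mat_mult n A B"
  and one_eq: "\<one> = mat_one n"
  by (auto simp: G_eq S_group_def)

lemma zero_entry: "A \<in> carrier G \<Longrightarrow> \<not> (1 \<le> i \<and> i \<le> j \<and> j \<le> n) \<Longrightarrow> A i j = 0"
  unfolding carrier_eq by (rule S_set_zero)

lemma diag_unit: "A \<in> carrier G \<Longrightarrow> 1 \<le> i \<Longrightarrow> i \<le> n \<Longrightarrow> A i i dvd 1"
  unfolding carrier_eq by (rule S_set_diag)

lemma mult_entry: "A \<in> carrier G \<Longrightarrow> B \<in> carrier G \<Longrightarrow> (A \<otimes> B) i j = (\<Sum>k=i..j. A i k * B k j)"
  unfolding mult_eq by (rule mat_mult_triangular[of A n I B I]) (auto simp: carrier_eq)

lemma mult_diag_entry: "A \<in> carrier G \<Longrightarrow> B \<in> carrier G \<Longrightarrow> (A \<otimes> B) i i = A i i * B i i"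
  by (simp add: mult_entry)

lemma mult_superdiag_entry:
  "A \<in> carrier G \<Longrightarrow> B \<in> carrier G \<Longrightarrow>
    (A \<otimes> B) i (Suc i) = A i i * B i (Suc i) + A i (Suc i) * B (Suc i) (Suc i)"
  by (simp add: mult_entry)

lemma one_entry: "\<one> i j = (if i = j \<and> 1 \<le> i \<and> i \<le> n then 1 else 0)"
  by (auto simp: one_eq mat_one_def)

lemma ch_unit: "g \<in> carrier G \<Longrightarrow> 1 \<le> i \<Longrightarrow> i < n \<Longrightarrow> ch i g dvd 1"
  unfolding ch_def by (intro unit_mult uinv_dvd diag_unit) auto

lemma ch_mult:
  assumes "g \<in> carrier G" "h \<in> carrier G" "1 \<le> i" "i < n"
  shows "ch i (g \<otimes> h) = ch i g * ch i h"
  using assms uinv_mult[OF diag_unit[OF assms(1), of "Suc i"] diag_unit[OF assms(2), of "Suc i"]]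
  by (simp add: ch_def mult_diag_entry mult_ac)

lemma vv_mult:
  assumes "g \<in> carrier G" "h \<in> carrier G" "1 \<le> i" "i < n"
  shows "vv i (g \<otimes> h) = ch i g * vv i h + vv i g"
proof -
  have u: "h (Suc i) (Suc i) * uinv (h (Suc i) (Suc i)) = 1" using assms by (intro uinv_right diag_unit) auto
  have "vv i (g \<otimes> h) = ch i g * vv i h + g i (Suc i) * uinv (g (Suc i) (Suc i)) * (h (Suc i) (Suc i) * uinv (h (Suc i) (Suc i)))"
    using assms uinv_mult[OF diag_unit[OF assms(1), of "Suc i"] diag_unit[OF assms(2), of "Suc i"]]
    by (simp add: vv_def ch_def mult_diag_entry mult_superdiag_entry algebra_simps)
  then show ?thesis by (simp add: u vv_def)
qed

definition E :: "nat \<Rightarrow> nat \<Rightarrow> 'a \<Rightarrow> nat \<Rightarrow> nat \<Rightarrow> 'a" where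
  "E i j a = elem_mat n i j a"

lemma E_in: "1 \<le> i \<Longrightarrow> i < j \<Longrightarrow> j \<le> n \<Longrightarrow> E i j a \<in> carrier G"
  unfolding E_def carrier_eq by (rule elem_mat_in)

lemma E_entry: "E i j a r c = (if r = i \<and> c = j then a else if r = c \<and> 1 \<le> r \<and> r \<le> n then 1 else 0)"
  by (auto simp: E_def elem_mat_def mat_one_def)

lemma mult_E:
  "A \<in> carrier G \<Longrightarrow> 1 \<le> i \<Longrightarrow> i < j \<Longrightarrow> j \<le> n \<Longrightarrow> (A \<otimes> E i j a) r c = A r c + (if c = j then A r i * a else 0)"
  unfolding E_def carrier_eq mult_eq by (rule mult_elem_mat)

lemma E_mult:
  "A \<in> carrier G \<Longrightarrow> 1 \<le> i \<Longrightarrow> i < j \<Longrightarrow> j \<le> n \<Longrightarrow> (E i j a \<otimes> A) r c = A r c + (if r = i then a * A j c else 0)"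
  unfolding E_def carrier_eq mult_eq by (rule elem_mat_mult)

lemma E_add: "1 \<le> i \<Longrightarrow> i < j \<Longrightarrow> j \<le> n \<Longrightarrow> E i j a \<otimes> E i j b = E i j (a + b)"
  unfolding E_def mult_eq by (rule elem_mat_add)

text \<open>This is the Fitting subgroup; being the set of left Engel elements it is characteristic.\<close>

definition F :: "(nat \<Rightarrow> nat \<Rightarrow> 'a) set" where
  "F = {g \<in> carrier G. \<forall>i. 1 \<le> i \<and> i \<le> n \<longrightarrow> g i i = g n n}"

lemma F_carrier: "g \<in> F \<Longrightarrow> g \<in> carrier G"
  unfolding F_def by blast

lemma F_diag: "g \<in> F \<Longrightarrow> 1 \<le> i \<Longrightarrow> i \<le> n \<Longrightarrow> g i i = g n n"
  unfolding F_def by blast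

lemma F_I: "g \<in> carrier G \<Longrightarrow> (\<And>i. 1 \<le> i \<Longrightarrow> i \<le> n \<Longrightarrow> g i i = g n n) \<Longrightarrow> g \<in> F"
  unfolding F_def by blast

section \<open>Commutators and the Engel condition\<close>

text \<open>The usual commutator of \<open>g\<close> and \<open>x\<close>, with the last two
  inverses combined so that \<open>comm_eq\<close> characterises it without inverses; all entries of
  commutators are computed from that equation.\<close>

definition comm :: "(nat \<Rightarrow> nat \<Rightarrow> 'a) \<Rightarrow> (nat \<Rightarrow> nat \<Rightarrow> 'a) \<Rightarrow> nat \<Rightarrow> nat \<Rightarrow> 'a" where
  "comm g x = g \<otimes> x \<otimes> inv (x \<otimes> g)"

lemma comm_in: "g \<in> carrier G \<Longrightarrow> x \<in> carrier G \<Longrightarrow> comm g x \<in> carrier G"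
  by (simp add: comm_def)

lemma comm_eq: "g \<in> carrier G \<Longrightarrow> x \<in> carrier G \<Longrightarrow> comm g x \<otimes> (x \<otimes> g) = g \<otimes> x"
  by (simp add: comm_def m_assoc)

lemma comm_eqI:
  "g \<in> carrier G \<Longrightarrow> x \<in> carrier G \<Longrightarrow> z \<in> carrier G \<Longrightarrow> z \<otimes> (x \<otimes> g) = g \<otimes> x \<Longrightarrow> comm g x = z"
  by (metis comm_eq comm_in m_closed right_cancel)

lemma iso_comm:
  assumes "\<psi> \<in> iso G G" "g \<in> carrier G" "x \<in> carrier G"
  shows "\<psi> (comm g x) = comm (\<psi> g) (\<psi> x)"
proof -
  have h: "\<psi> \<in> hom G G" using assms by (auto simp: iso_def)
  have c: "\<psi> y \<in> carrier G" if "y \<in> carrier G" for y using hom_in_carrier[OF h that] .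
  have "\<psi> (comm g x) \<otimes> (\<psi> x \<otimes> \<psi> g) = \<psi> g \<otimes> \<psi> x"
    using comm_eq[OF assms(2,3)] comm_in[OF assms(2,3)] assms by (metis h hom_mult m_closed)
  then show ?thesis using comm_eqI c comm_in assms by metis
qed

lemma comm_diag: "g \<in> carrier G \<Longrightarrow> x \<in> carrier G \<Longrightarrow> 1 \<le> i \<Longrightarrow> i \<le> n \<Longrightarrow> comm g x i i = 1"
proof -
  assume *: "g \<in> carrier G" "x \<in> carrier G" "1 \<le> i" "i \<le> n"
  have "comm g x i i * (x i i * g i i) = 1 * (x i i * g i i)"
    using arg_cong[OF comm_eq[OF *(1,2)], of "\<lambda>A. A i i"] * comm_in[OF *(1,2)] by (simp add: mult_diag_entry mult.commute)
  moreover have "x i i * g i i \<noteq> 0" using unit_nonzero[OF diag_unit] * by simp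
  ultimately show ?thesis by (metis mult_cancel_right)
qed

primrec engel :: "(nat \<Rightarrow> nat \<Rightarrow> 'a) \<Rightarrow> (nat \<Rightarrow> nat \<Rightarrow> 'a) \<Rightarrow> nat \<Rightarrow> nat \<Rightarrow> nat \<Rightarrow> 'a" where
  "engel g x 0 = x"
| "engel g x (Suc k) = comm g (engel g x k)"

lemma engel_in: "g \<in> carrier G \<Longrightarrow> x \<in> carrier G \<Longrightarrow> engel g x k \<in> carrier G"
  by (induction k) (auto intro: comm_in)

lemma iso_engel:
  assumes "\<psi> \<in> iso G G" "g \<in> carrier G" "x \<in> carrier G"
  shows "\<psi> (engel g x k) = engel (\<psi> g) (\<psi> x) k"
  by (induction k) (auto simp: iso_comm[OF assms(1,2)] engel_in assms)

lemma ch_F: "g \<in> F \<Longrightarrow> 1 \<le> i \<Longrightarrow> i < n \<Longrightarrow> ch i g = 1"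
  unfolding ch_def using F_diag[of g i] F_diag[of g "Suc i"] uinv_right[OF diag_unit[OF F_carrier], of g n] n4 by simp

text \<open>The filtration by the number \<open>k - 1\<close> of vanishing superdiagonals:
  \<open>band 1\<close> is the unitriangular group and \<open>band n\<close> is trivial.\<close>

definition band :: "nat \<Rightarrow> (nat \<Rightarrow> nat \<Rightarrow> 'a) set" where
  "band k = {e \<in> carrier G. (\<forall>i. 1 \<le> i \<and> i \<le> n \<longrightarrow> e i i = 1) \<and> (\<forall>i j. i < j \<and> j < i + k \<longrightarrow> e i j = 0)}"

text \<open>Because \<open>g\<close> has constant diagonal, \<open>g \<otimes> e\<close> and
  \<open>e \<otimes> g\<close> agree up to and including the \<open>k\<close>-th superdiagonal, and
  the commutator measures their quotient.\<close>

lemma comm_band: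
  assumes g: "g \<in> F" and e: "e \<in> band k" and k: "k \<ge> 1"
  shows "comm g e \<in> band (Suc k)"
proof -
  have gc: "g \<in> carrier G" and ec: "e \<in> carrier G" using F_carrier[OF g] e by (auto simp: band_def)
  let ?h = "comm g e"
  have hc: "?h \<in> carrier G" using comm_in gc ec by blast
  have eg: "(g \<otimes> e) i j = (e \<otimes> g) i j" if ij: "1 \<le> i" "i < j" "j \<le> n" "j \<le> i + k" for i j
  proof -
    have "(g \<otimes> e) i j = (\<Sum>l=i..j. g i l * e l j)" by (rule mult_entry[OF gc ec])
    also have "\<dots> = (\<Sum>l\<in>{i, j}. g i l * e l j)"
      using ij e by (intro sum.mono_neutral_right) (auto simp: band_def)
    also have "\<dots> = g i i * e i j + g i j" using ij e by (simp add: band_def)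
    finally have 1: "(g \<otimes> e) i j = g i i * e i j + g i j" .
    have "(e \<otimes> g) i j = (\<Sum>l=i..j. e i l * g l j)" by (rule mult_entry[OF ec gc])
    also have "\<dots> = (\<Sum>l\<in>{i, j}. e i l * g l j)"
      using ij e by (intro sum.mono_neutral_right) (auto simp: band_def)
    also have "\<dots> = g i j + e i j * g j j" using ij e by (simp add: band_def)
    finally have 2: "(e \<otimes> g) i j = g i j + e i j * g j j" .
    have "g i i = g n n" "g j j = g n n" by (rule F_diag[OF g]; use ij in simp)+
    then show ?thesis using 1 2 by (simp add: mult.commute)
  qed
  \<comment> \<open>Induction on the distance from the diagonal: in the product
    \<open>?h \<otimes> (e \<otimes> g)\<close> the terms strictly between \<open>i\<close> and
    \<open>j\<close> are already known to vanish.\<close>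
  have "i < j \<and> j < i + Suc k \<longrightarrow> ?h i j = 0" for i j
  proof (induction "j - i" arbitrary: j rule: less_induct)
    case less
    show ?case
    proof
      assume ij: "i < j \<and> j < i + Suc k"
      show "?h i j = 0"
      proof (cases "1 \<le> i \<and> j \<le> n")
        case True
        have "(g \<otimes> e) i j = (\<Sum>l=i..j. ?h i l * (e \<otimes> g) l j)"
          using mult_entry[OF hc m_closed[OF ec gc], of i j] comm_eq[OF gc ec] by simp
        also have "\<dots> = (\<Sum>l\<in>{i, j}. ?h i l * (e \<otimes> g) l j)"
        proof (intro sum.mono_neutral_right ballI)
          fix l assume l: "l \<in> {i..j} - {i, j}"
          have "?h i l = 0" using less[of l] l ij by auto
          then show "?h i l * (e \<otimes> g) l j = 0" by simp
        qed (use ij in auto)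
        also have "\<dots> = (e \<otimes> g) i j + ?h i j * (e \<otimes> g) j j"
          using ij True comm_diag[OF gc ec, of i] by simp
        finally have "?h i j * (e \<otimes> g) j j = 0" using eg[of i j] ij True by simp
        moreover have "(e \<otimes> g) j j \<noteq> 0" using unit_nonzero[OF diag_unit[OF m_closed[OF ec gc]]] ij True by simp
        ultimately show ?thesis by simp
      qed (use zero_entry[OF hc] in auto)
    qed
  qed
  then show ?thesis using hc comm_diag[OF gc ec] by (auto simp: band_def)
qed

text \<open>The first commutator is unitriangular whatever \<open>x\<close> is, and every later one
  clears one more superdiagonal.\<close>

lemma engel_F:
  assumes "g \<in> F" "x \<in> carrier G"
  shows "engel g x n = \<one>"
proof -
  have gc: "g \<in> carrier G" using assms F_carrier by blast
  have b: "engel g x (Suc k) \<in> band (Suc k)" for k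
  proof (induction k)
    case 0
    then show ?case using comm_in[OF gc assms(2)] comm_diag[OF gc assms(2)] by (auto simp: band_def)
  next
    case (Suc k)
    then show ?case using comm_band[OF assms(1), of "engel g x (Suc k)" "Suc k"] by simp
  qed
  obtain k where k: "n = Suc k" using n4 by (cases n) auto
  have e: "engel g x n \<in> band n" using b[of k] k by simp
  show ?thesis
  proof (intro ext)
    fix i j
    show "engel g x n i j = \<one> i j"
    proof (cases "1 \<le> i \<and> i \<le> j \<and> j \<le> n")
      case True
      then show ?thesis using e by (cases "i = j") (auto simp: band_def one_entry)
    next
      case False
      then show ?thesis using zero_entry[of "engel g x n" i j] e by (auto simp: band_def one_entry)
    qed
  qed
qed

text \<open>Tested on the elementary matrices next to the diagonal: each bracket multiplies the
  entry \<open>vv i\<close> by \<open>ch i g - 1\<close>. In a domain the vanishing of a power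
  forces \<open>ch i g = 1\<close>, that is, equal neighbouring diagonal entries.\<close>

lemma F_if_engel:
  assumes g: "g \<in> carrier G" and *: "\<And>x. x \<in> carrier G \<Longrightarrow> engel g x n = \<one>"
  shows "g \<in> F"
proof -
  have step: "g i i = g (Suc i) (Suc i)" if i: "1 \<le> i" "i < n" for i
  proof -
    let ?x = "E i (Suc i) 1"
    have xc: "?x \<in> carrier G" using i by (intro E_in) auto
    have vv_E: "vv i ?x = 1" using i by (simp add: vv_def E_entry uinv_one)
    have "vv i (engel g ?x k) = (ch i g - 1) ^ k \<and> ch i (engel g ?x k) = 1" for k
    proof (induction k)
      case 0
      have "ch i ?x = 1" using i by (simp add: ch_def E_entry uinv_one)
      then show ?case using vv_E by simp
    next
      case (Suc k)
      let ?e = "engel g ?x k"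
      have ec: "?e \<in> carrier G" using engel_in g xc by blast
      have hc: "comm g ?e \<in> carrier G" using comm_in g ec by blast
      have ch1: "ch i (comm g ?e) = 1" using i comm_diag[OF g ec] by (simp add: ch_def uinv_one)
      have "vv i (comm g ?e \<otimes> (?e \<otimes> g)) = vv i (g \<otimes> ?e)" using comm_eq[OF g ec] by simp
      then have "vv i (comm g ?e) = (ch i g - 1) * vv i ?e"
        using ch1 Suc i g ec hc by (simp add: vv_mult algebra_simps)
      then show ?case using Suc ch1 by simp
    qed
    then have "(ch i g - 1) ^ n = vv i \<one>" using *[OF xc] by metis
    then have "ch i g = 1" using i by (simp add: vv_def one_entry)
    then have "g i i * (uinv (g (Suc i) (Suc i)) * g (Suc i) (Suc i)) = g (Suc i) (Suc i)"
      unfolding ch_def by (simp flip: mult.assoc)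
    then show ?thesis using uinv_left[OF diag_unit[OF g, of "Suc i"]] i by simp
  qed
  have "g i i = g n n" if "1 \<le> i" "i \<le> n" for i
    using that(2,1) by (induction rule: inc_induct) (auto simp: step)
  then show ?thesis using g F_I by blast
qed

lemma iso_inv: "\<psi> \<in> iso G G \<Longrightarrow> inv_into (carrier G) \<psi> \<in> iso G G"
  by (rule iso_set_sym)

lemma iso_surj: "\<psi> \<in> iso G G \<Longrightarrow> x \<in> carrier G \<Longrightarrow> \<exists>y\<in>carrier G. \<psi> y = x"
  by (metis (mono_tags, lifting) iso_def bij_betw_def imageE mem_Collect_eq)

lemma iso_carrier: "\<psi> \<in> iso G G \<Longrightarrow> x \<in> carrier G \<Longrightarrow> \<psi> x \<in> carrier G"
  by (auto simp: iso_def hom_def)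

lemma iso_mult: "\<psi> \<in> iso G G \<Longrightarrow> x \<in> carrier G \<Longrightarrow> y \<in> carrier G \<Longrightarrow> \<psi> (x \<otimes> y) = \<psi> x \<otimes> \<psi> y"
  by (auto simp: iso_def hom_def)

lemma iso_one: "\<psi> \<in> iso G G \<Longrightarrow> \<psi> \<one> = \<one>"
  using hom_one[of \<psi> G G] is_group by (auto simp: iso_def)

lemma iso_F:
  assumes "\<psi> \<in> iso G G" "g \<in> F"
  shows "\<psi> g \<in> F"
proof (rule F_if_engel)
  have gc: "g \<in> carrier G" using assms F_carrier by blast
  show "\<psi> g \<in> carrier G" using iso_carrier assms gc by blast
  fix x assume "x \<in> carrier G"
  then obtain y where y: "y \<in> carrier G" "\<psi> y = x" using iso_surj assms(1) by blast
  have "engel (\<psi> g) x n = \<psi> (engel g y n)" using iso_engel[OF assms(1) gc y(1)] y by simp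
  also have "\<dots> = \<one>" using engel_F[OF assms(2) y(1)] iso_one assms(1) by simp
  finally show "engel (\<psi> g) x n = \<one>" .
qed

lemma iso_inv_F: "\<psi> \<in> iso G G \<Longrightarrow> x \<in> F \<Longrightarrow> \<exists>y\<in>F. \<psi> y = x"
proof -
  assume *: "\<psi> \<in> iso G G" "x \<in> F"
  have "inv_into (carrier G) \<psi> x \<in> F" using iso_F[OF iso_inv] * by blast
  moreover have "\<psi> (inv_into (carrier G) \<psi> x) = x"
    using * F_carrier[of x] by (intro f_inv_into_f[of x \<psi> "carrier G"]) (auto simp: iso_def bij_betw_def)
  ultimately show ?thesis by blast
qed

text \<open>The second centre of \<open>F\<close>; \<open>P2\<close> below is its description by matrix entries.\<close>

definition Z2 :: "(nat \<Rightarrow> nat \<Rightarrow> 'a) set" where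
  "Z2 = {y \<in> F. \<forall>x\<in>F. \<forall>z\<in>F. comm y x \<otimes> z = z \<otimes> comm y x}"

lemma iso_Z2:
  assumes "\<psi> \<in> iso G G" "y \<in> Z2"
  shows "\<psi> y \<in> Z2"
proof -
  have yF: "y \<in> F" using assms by (simp add: Z2_def)
  have Fc: "F \<subseteq> carrier G" using F_carrier by blast
  have "comm (\<psi> y) x \<otimes> z = z \<otimes> comm (\<psi> y) x" if "x \<in> F" "z \<in> F" for x z
  proof -
    obtain x' z' where *: "x' \<in> F" "\<psi> x' = x" "z' \<in> F" "\<psi> z' = z" using iso_inv_F[OF assms(1)] \<open>x \<in> F\<close> \<open>z \<in> F\<close> by metis
    have "comm y x' \<otimes> z' = z' \<otimes> comm y x'" using assms(2) * by (auto simp: Z2_def)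
    moreover have c: "y \<in> carrier G" "x' \<in> carrier G" "z' \<in> carrier G" using yF * Fc by auto
    ultimately show ?thesis
      using * iso_mult[OF assms(1) comm_in[OF c(1,2)] c(3)] iso_mult[OF assms(1) c(3) comm_in[OF c(1,2)]]
        iso_comm[OF assms(1) c(1,2)] by simp
  qed
  then show ?thesis using iso_F[OF assms(1) yF] by (auto simp: Z2_def)
qed

section \<open>Products and conjugates inside \<open>F\<close>\<close>

lemma E_F: "1 \<le> i \<Longrightarrow> i < j \<Longrightarrow> j \<le> n \<Longrightarrow> E i j a \<in> F"
  by (rule F_I) (auto simp: E_in E_entry)

lemma mult_F: "g \<in> F \<Longrightarrow> h \<in> F \<Longrightarrow> g \<otimes> h \<in> F"
proof (rule F_I)
  assume *: "g \<in> F" "h \<in> F"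
  then show "g \<otimes> h \<in> carrier G" using F_carrier by simp
  fix i assume "1 \<le> i" "i \<le> n"
  then show "(g \<otimes> h) i i = (g \<otimes> h) n n"
    using * F_carrier F_diag[OF *(1), of i] F_diag[OF *(2), of i] by (simp only: mult_diag_entry)
qed

lemma inv_F: "g \<in> F \<Longrightarrow> inv g \<in> F"
proof (rule F_I)
  assume g: "g \<in> F"
  note gc = F_carrier[OF g]
  show ic: "inv g \<in> carrier G" using gc by simp
  have d: "g j j * (inv g) j j = 1" if "1 \<le> j" "j \<le> n" for j
    using mult_diag_entry[OF gc ic, of j] gc that by (simp add: one_entry)
  fix i assume i: "1 \<le> i" "i \<le> n"
  have "g i i * (inv g) i i = g i i * (inv g) n n" using d[OF i] d[of n] F_diag[OF g i] n4 by simp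
  then show "(inv g) i i = (inv g) n n" using unit_nonzero[OF diag_unit[OF gc i]] by simp
qed

lemma vv_E: "1 \<le> i \<Longrightarrow> i < n \<Longrightarrow> 1 \<le> j \<Longrightarrow> j < n \<Longrightarrow> vv i (E j (Suc j) a) = (if i = j then a else 0)"
  by (simp add: vv_def E_entry uinv_one)

lemma vv_mult_F: "g \<in> F \<Longrightarrow> h \<in> F \<Longrightarrow> 1 \<le> i \<Longrightarrow> i < n \<Longrightarrow> vv i (g \<otimes> h) = vv i g + vv i h"
  using ch_F[of g i] F_carrier by (simp add: vv_mult)

text \<open>So \<open>ch i\<close> is the weight of conjugation on the \<open>i\<close>-th
  superdiagonal entry. The form \<open>z \<otimes> s = s \<otimes> x\<close> lets an automorphism be
  applied without inverses.\<close>

lemma conj_F: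
  assumes "s \<in> carrier G" "x \<in> F"
  shows "\<exists>z\<in>F. z \<otimes> s = s \<otimes> x \<and> (\<forall>i. 1 \<le> i \<and> i < n \<longrightarrow> vv i z = ch i s * vv i x)"
proof -
  have xc: "x \<in> carrier G" using F_carrier assms by blast
  define z where "z = s \<otimes> x \<otimes> inv s"
  have zc: "z \<in> carrier G" using assms xc by (simp add: z_def)
  have zs: "z \<otimes> s = s \<otimes> x" using assms xc by (simp add: z_def m_assoc)
  have d: "z i i = x i i" if i: "1 \<le> i" "i \<le> n" for i
  proof -
    have "z i i * s i i = x i i * s i i"
      using arg_cong[OF zs, of "\<lambda>A. A i i"] assms xc zc by (simp add: mult_diag_entry mult.commute)
    then show ?thesis using unit_nonzero[OF diag_unit[OF assms(1) i]] by simp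
  qed
  have zF: "z \<in> F"
  proof (rule F_I[OF zc])
    fix i assume i: "1 \<le> i" "i \<le> n"
    show "z i i = z n n" using d[OF i] d[of n] F_diag[OF assms(2) i] n4 by simp
  qed
  have "vv i z = ch i s * vv i x" if i: "1 \<le> i" "i < n" for i
    using arg_cong[OF zs, of "vv i"] vv_mult[OF zc assms(1) i] vv_mult[OF assms(1) xc i] ch_F[OF zF i] by simp
  then show ?thesis using zF zs by blast
qed

section \<open>The second centre in matrix entries and the commutator pairing\<close>

definition P2 :: "(nat \<Rightarrow> nat \<Rightarrow> 'a) set" where
  "P2 = {y \<in> F. \<forall>i j. 1 \<le> i \<and> i < j \<and> j \<le> n \<and> (i, j) \<noteq> (1, n - 1) \<and> (i, j) \<noteq> (2, n) \<and> (i, j) \<noteq> (1, n) \<longrightarrow> y i j = 0}"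

definition ww1 :: "(nat \<Rightarrow> nat \<Rightarrow> 'a) \<Rightarrow> 'a" where "ww1 y = y 1 (n - 1) * uinv (y n n)"
definition ww2 :: "(nat \<Rightarrow> nat \<Rightarrow> 'a) \<Rightarrow> 'a" where "ww2 y = y 2 n * uinv (y n n)"
text \<open>The corner entry of the commutator of \<open>x\<close> and \<open>y\<close>, with
  diagonals normalised to 1: of the paths from \<open>1\<close> to \<open>n\<close> only those
  through \<open>2\<close> and through \<open>n - 1\<close> contribute.\<close>

definition pairing :: "(nat \<Rightarrow> nat \<Rightarrow> 'a) \<Rightarrow> (nat \<Rightarrow> nat \<Rightarrow> 'a) \<Rightarrow> 'a" where
  "pairing x y = vv 1 x * ww2 y - ww1 y * vv (n - 1) x"

lemma P2_entry:
  assumes y: "y \<in> P2"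
  shows "y k j = (if k = j \<and> 1 \<le> k \<and> k \<le> n then y n n else 0) + (if k = 1 \<and> j = n - 1 then y 1 (n - 1) else 0)
    + (if k = 2 \<and> j = n then y 2 n else 0) + (if k = 1 \<and> j = n then y 1 n else 0)"
proof -
  have yF: "y \<in> F" using y by (simp add: P2_def)
  consider "\<not> (1 \<le> k \<and> k \<le> j \<and> j \<le> n)" | "1 \<le> k" "k = j" "j \<le> n" | "1 \<le> k" "k < j" "j \<le> n" by linarith
  then show ?thesis
  proof cases
    case 1
    then show ?thesis using zero_entry[OF F_carrier[OF yF] 1] n4 by auto
  next
    case 2
    then show ?thesis using F_diag[OF yF, of k] n4 by auto
  next
    case 3
    show ?thesis
    proof (cases "(k, j) = (1, n - 1) \<or> (k, j) = (2, n) \<or> (k, j) = (1, n)")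
      case True
      then show ?thesis using n4 by auto
    next
      case False
      then have "y k j = 0" using y 3 unfolding P2_def by blast
      then show ?thesis using 3 False by auto
    qed
  qed
qed

lemma mult_P2:
  assumes x: "x \<in> carrier G" and y: "y \<in> P2"
  shows "(x \<otimes> y) i j = (if 1 \<le> j \<and> j \<le> n then x i j * y n n else 0) + (if j = n - 1 then x i 1 * y 1 (n - 1) else 0)
    + (if j = n then x i 2 * y 2 n + x i 1 * y 1 n else 0)"
proof (cases "i \<in> {1..n} \<and> j \<in> {1..n}")
  case True
  have "(x \<otimes> y) i j = (\<Sum>k=1..n. x i k * y k j)" using True by (simp add: mult_eq mat_mult_def)
  also have "\<dots> = (\<Sum>k=1..n. (if k = j then x i k * y n n else 0) + (if k = 1 then (if j = n - 1 then x i k * y 1 (n - 1) else 0) else 0)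
    + (if k = 2 then (if j = n then x i k * y 2 n else 0) else 0) + (if k = 1 then (if j = n then x i k * y 1 n else 0) else 0))"
    by (intro sum.cong refl, subst P2_entry[OF y]) (auto simp: algebra_simps)
  also have "\<dots> = x i j * y n n + (if j = n - 1 then x i 1 * y 1 (n - 1) else 0)
    + (if j = n then x i 2 * y 2 n else 0) + (if j = n then x i 1 * y 1 n else 0)"
    using True n4 by (simp add: sum.distrib)
  finally show ?thesis using True by simp
next
  case False
  have yc: "y \<in> carrier G" using y F_carrier by (auto simp: P2_def)
  have "(x \<otimes> y) i j = 0" using False by (auto simp: mult_eq mat_mult_def)
  moreover have "\<not> (1 \<le> i \<and> i \<le> n) \<Longrightarrow> x i k = 0" for k using zero_entry[OF x, of i k] by linarith
  ultimately show ?thesis using False n4 by auto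
qed

lemma P2_mult:
  assumes x: "x \<in> carrier G" and y: "y \<in> P2"
  shows "(y \<otimes> x) i j = (if 1 \<le> i \<and> i \<le> n then y n n * x i j else 0) + (if i = 1 then y 1 (n - 1) * x (n - 1) j + y 1 n * x n j else 0)
    + (if i = 2 then y 2 n * x n j else 0)"
proof (cases "i \<in> {1..n} \<and> j \<in> {1..n}")
  case True
  have "(y \<otimes> x) i j = (\<Sum>k=1..n. y i k * x k j)" using True by (simp add: mult_eq mat_mult_def)
  also have "\<dots> = (\<Sum>k=1..n. (if k = i then y n n * x k j else 0) + (if k = n - 1 then (if i = 1 then y 1 (n - 1) * x k j else 0) else 0)
    + (if k = n then (if i = 2 then y 2 n * x k j else 0) else 0) + (if k = n then (if i = 1 then y 1 n * x k j else 0) else 0))"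
    using True by (intro sum.cong refl, subst P2_entry[OF y]) (auto simp: algebra_simps)
  also have "\<dots> = y n n * x i j + (if i = 1 then y 1 (n - 1) * x (n - 1) j else 0)
    + (if i = 2 then y 2 n * x n j else 0) + (if i = 1 then y 1 n * x n j else 0)"
  proof -
    have "Suc 0 \<le> n - Suc 0" using n4 by simp
    then show ?thesis using True n4 by (simp add: sum.distrib)
  qed
  finally show ?thesis using True by simp
next
  case False
  have "(y \<otimes> x) i j = 0" using False by (auto simp: mult_eq mat_mult_def)
  moreover have "\<not> (1 \<le> j \<and> j \<le> n) \<Longrightarrow> x k j = 0" for k using zero_entry[OF x, of k j] by linarith
  ultimately show ?thesis using False n4 by auto
qed

text \<open>Off the diagonal \<open>y\<close> has at most three non-zero entries, in the upper right
  corner, and both diagonals are constant; so the two products can differ only at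
  \<open>(1, n)\<close>. Multiplying by \<open>E 1 n c\<close> changes exactly that entry, by
  \<open>c\<close> times the last diagonal entry.\<close>

lemma F_P2_commutation:
  assumes x: "x \<in> F" and y: "y \<in> P2"
  shows "x \<otimes> y = E 1 n (pairing x y) \<otimes> (y \<otimes> x)"
proof (intro ext)
  fix i j
  note xc = F_carrier[OF x]
  have yF: "y \<in> F" using y by (simp add: P2_def)
  note yc = F_carrier[OF yF]
  have E: "(E 1 n (pairing x y) \<otimes> (y \<otimes> x)) i j = (y \<otimes> x) i j + (if i = 1 then pairing x y * (y \<otimes> x) n j else 0)"
    using xc yc n4 by (intro E_mult) auto
  have nn: "(y \<otimes> x) n j = (if j = n then y n n * x n n else 0)"
  proof (cases "j = n")
    case True
    then show ?thesis using mult_diag_entry[OF yc xc] by simp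
  next
    case False
    then have "(y \<otimes> x) n j = 0" using zero_entry[of "y \<otimes> x" n j] xc yc by auto
    then show ?thesis using False by simp
  qed
  have px: "pairing x y * (y n n * x n n) = x 1 2 * y 2 n - y 1 (n - 1) * x (n - 1) n"
  proof -
    have u: "uinv (x n n) * x n n = 1" "uinv (y n n) * y n n = 1"
      using uinv_left[OF diag_unit[OF xc, of n]] uinv_left[OF diag_unit[OF yc, of n]] n4 by auto
    have "x 2 2 = x n n" using F_diag[OF x, of 2] n4 by simp
    then have v1: "vv 1 x * x n n = x 1 2" using u by (simp add: vv_def mult.assoc numeral_2_eq_2)
    have "Suc (n - 1) = n" using n4 by simp
    then have v2: "vv (n - 1) x * x n n = x (n - 1) n" using u by (simp add: vv_def mult.assoc)
    have w: "ww2 y * y n n = y 2 n" "ww1 y * y n n = y 1 (n - 1)" using u by (simp_all add: ww1_def ww2_def mult.assoc)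
    have "pairing x y * (y n n * x n n) = (vv 1 x * x n n) * (ww2 y * y n n) - (ww1 y * y n n) * (vv (n - 1) x * x n n)"
      by (simp add: pairing_def algebra_simps)
    then show ?thesis by (simp only: v1 v2 w)
  qed
  have diag: "x 1 1 = x n n" "x 2 2 = x n n" "x (n - 1) (n - 1) = x n n"
    using F_diag[OF x, of 1] F_diag[OF x, of 2] F_diag[OF x, of "n - 1"] n4 by simp_all
  have z: "x r c = 0" if "c < r" for r c using zero_entry[OF xc, of r c] that by simp
  have z': "x r c = 0" if "r = 0 \<or> r > n \<or> c = 0 \<or> c > n" for r c using zero_entry[OF xc, of r c] that by auto
  consider "i = 1" "j = n" | "i = 1" "j = n - 1" | "i = 1" "j \<noteq> n" "j \<noteq> n - 1" | "i = 2" "j = n" | "i = 2" "j \<noteq> n" | "i \<noteq> 1" "i \<noteq> 2" by blast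
  then show "(x \<otimes> y) i j = (E 1 n (pairing x y) \<otimes> (y \<otimes> x)) i j"
  proof cases
    case 1
    then show ?thesis unfolding E nn mult_P2[OF xc y] P2_mult[OF xc y] using px n4 diag by (simp add: algebra_simps)
  next
    case 2
    then show ?thesis unfolding E nn mult_P2[OF xc y] P2_mult[OF xc y] using n4 diag z[of "n - 1" n] by (auto simp: algebra_simps z)
  next
    case 3
    then show ?thesis unfolding E nn mult_P2[OF xc y] P2_mult[OF xc y]
      using n4 z[of j n] z[of j "n - 1"] z' by (cases "j < n") (auto simp: algebra_simps)
  next
    case 4
    then show ?thesis unfolding E nn mult_P2[OF xc y] P2_mult[OF xc y] using n4 diag z[of 1 2] by (auto simp: algebra_simps)
  next
    case 5
    then show ?thesis unfolding E nn mult_P2[OF xc y] P2_mult[OF xc y]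
      using n4 z[of j n] z[of 1 2] z' by (cases "j < n") (auto simp: algebra_simps)
  next
    case 6
    then show ?thesis unfolding E nn mult_P2[OF xc y] P2_mult[OF xc y]
      using n4 z[of 1 i] z[of 2 i] z' by (cases "i = 0") (auto simp: algebra_simps)
  qed
qed

lemma E1n_central:
  assumes "z \<in> F"
  shows "E 1 n c \<otimes> z = z \<otimes> E 1 n c"
proof (intro ext)
  fix r s
  note zc = F_carrier[OF assms]
  have 1: "z n s = 0" if "s \<noteq> n" using zero_entry[OF zc, of n s] that by auto
  have 2: "z r 1 = 0" if "r \<noteq> 1" using zero_entry[OF zc, of r 1] that by auto
  have 3: "z 1 1 = z n n" using F_diag[OF assms, of 1] n4 by simp
  have m: "(E 1 n c \<otimes> z) r s = z r s + (if r = 1 then c * z n s else 0)"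
     "(z \<otimes> E 1 n c) r s = z r s + (if s = n then z r 1 * c else 0)"
    using zc n4 by (intro E_mult mult_E; simp)+
  show "(E 1 n c \<otimes> z) r s = (z \<otimes> E 1 n c) r s"
    unfolding m using 1 2 3 by (cases "r = 1"; cases "s = n") (auto simp: mult.commute)
qed

text \<open>The test matrices carry the entry \<open>(i, j)\<close> to \<open>(i, n)\<close> or, if
  \<open>j = n\<close>, to \<open>(1, n)\<close>, where the opposite product does not see
  it.\<close>

lemma central_entry:
  assumes c: "c \<in> carrier G" and *: "\<And>z. z \<in> F \<Longrightarrow> c \<otimes> z = z \<otimes> c" and ij: "1 \<le> i" "i < j" "j \<le> n" "(i, j) \<noteq> (1, n)"
  shows "c i j = 0"
proof (cases "j = n")
  case False
  then have j: "j < n" using ij by simp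
  have "(c \<otimes> E j n 1) i n = (E j n 1 \<otimes> c) i n" using *[OF E_F[of j n 1]] ij j by simp
  then show ?thesis using ij j c by (simp add: mult_E E_mult)
next
  case True
  then have i: "1 < i" using ij by auto
  have "(c \<otimes> E 1 i 1) 1 n = (E 1 i 1 \<otimes> c) 1 n" using *[OF E_F[of 1 i 1]] ij i by simp
  then show ?thesis using ij i c True by (simp add: mult_E E_mult)
qed

text \<open>One inclusion is the commutation formula, whose commutators lie in the central root
  group \<open>E 1 n\<close>. Conversely, the commutators of \<open>y\<close> with \<open>F\<close>
  are central, hence concentrated at \<open>(1, n)\<close>, so \<open>y\<close> commutes with
  \<open>F\<close> in all other entries; elementary matrices then isolate the entries that must
  vanish.\<close>

lemma Z2_eq_P2: "Z2 = P2"
proof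
  show "P2 \<subseteq> Z2"
  proof
    fix y assume y: "y \<in> P2"
    have yF: "y \<in> F" using y by (simp add: P2_def)
    have "comm y x \<otimes> z = z \<otimes> comm y x" if "x \<in> F" "z \<in> F" for x z
    proof -
      note c = F_carrier[OF yF] F_carrier[OF that(1)]
      have E: "E 1 n a \<in> carrier G" for a using n4 by (intro E_in) auto
      have "E 1 n (- pairing x y) \<otimes> (x \<otimes> y) = (E 1 n (- pairing x y) \<otimes> E 1 n (pairing x y)) \<otimes> (y \<otimes> x)"
        using F_P2_commutation[OF that(1) y] E c by (simp add: m_assoc)
      also have "E 1 n (- pairing x y) \<otimes> E 1 n (pairing x y) = \<one>"
        using n4 E_add[of 1 n "- pairing x y" "pairing x y"] by (auto simp: fun_eq_iff E_entry one_entry)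
      finally have "comm y x = E 1 n (- pairing x y)" using c E by (intro comm_eqI) auto
      then show ?thesis using E1n_central[OF that(2)] by simp
    qed
    then show "y \<in> Z2" using yF by (auto simp: Z2_def)
  qed
  show "Z2 \<subseteq> P2"
  proof
    fix y assume y: "y \<in> Z2"
    have yF: "y \<in> F" using y by (simp add: Z2_def)
    note yc = F_carrier[OF yF]
    have eq: "(y \<otimes> x) i j = (x \<otimes> y) i j" if x: "x \<in> F" and ij: "1 \<le> i" "i < j" "j \<le> n" "(i, j) \<noteq> (1, n)" for x i j
    proof -
      note xc = F_carrier[OF x]
      let ?c = "comm y x"
      have cc: "?c \<in> carrier G" using comm_in yc xc by blast
      have c0: "?c i k = 0" if "i < k" "k \<le> j" for k
        using central_entry[OF cc, of i k] y x ij that by (auto simp: Z2_def)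
      have "(y \<otimes> x) i j = (\<Sum>k=i..j. ?c i k * (x \<otimes> y) k j)"
        using mult_entry[OF cc m_closed[OF xc yc]] comm_eq[OF yc xc] by simp
      also have "\<dots> = (\<Sum>k\<in>{i}. ?c i k * (x \<otimes> y) k j)"
        using ij c0 by (intro sum.mono_neutral_right) auto
      also have "\<dots> = (x \<otimes> y) i j" using comm_diag[OF yc xc, of i] ij by simp
      finally show ?thesis .
    qed
    have "y i j = 0" if ij: "1 \<le> i" "i < j" "j \<le> n" "(i, j) \<noteq> (1, n - 1)" "(i, j) \<noteq> (2, n)" "(i, j) \<noteq> (1, n)" for i j
    proof (cases "j = n")
      case True
      then have i: "3 \<le> i" using ij by (cases "i = 1"; cases "i = 2") auto
      have "(y \<otimes> E 2 i 1) 2 n = (E 2 i 1 \<otimes> y) 2 n" using i ij n4 by (intro eq E_F) auto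
      then show ?thesis using i ij yc True by (simp add: mult_E E_mult)
    next
      case False
      show ?thesis
      proof (cases "j = n - 1")
        case True
        then have i: "2 \<le> i" using ij by (cases "i = 1") auto
        have "(y \<otimes> E j n 1) i n = (E j n 1 \<otimes> y) i n" using i ij n4 True by (intro eq E_F) auto
        then show ?thesis using i ij yc True n4 by (simp add: mult_E E_mult)
      next
        case False
        then have j: "j < n - 1" using ij \<open>j \<noteq> n\<close> by auto
        have "(y \<otimes> E j (n - 1) 1) i (n - 1) = (E j (n - 1) 1 \<otimes> y) i (n - 1)" using ij n4 j by (intro eq E_F) auto
        then show ?thesis using ij yc j n4 by (simp add: mult_E E_mult)
      qed
    qed
    then show "y \<in> P2" using yF unfolding P2_def by blast
  qed
qed

lemma iso_P2: "\<psi> \<in> iso G G \<Longrightarrow> y \<in> P2 \<Longrightarrow> \<psi> y \<in> P2"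
  using iso_Z2 Z2_eq_P2 by simp

lemma iso_inv_P2: "\<psi> \<in> iso G G \<Longrightarrow> y \<in> P2 \<Longrightarrow> \<exists>x\<in>P2. \<psi> x = y"
proof -
  assume *: "\<psi> \<in> iso G G" "y \<in> P2"
  have yc: "y \<in> carrier G" using * F_carrier by (auto simp: P2_def)
  have "inv_into (carrier G) \<psi> y \<in> P2" using iso_P2[OF iso_inv] * by blast
  moreover have "\<psi> (inv_into (carrier G) \<psi> y) = y"
    using * yc by (intro f_inv_into_f[of y \<psi> "carrier G"]) (auto simp: iso_def bij_betw_def)
  ultimately show ?thesis by blast
qed

lemma E2n_P2: "E 2 n b \<in> P2" and E1n'_P2: "E 1 (n - 1) b \<in> P2"
  unfolding P2_def using n4 by (auto simp: E_F E_entry)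

lemma pairing_E:
  "pairing (E 1 2 a) (E 2 n b) = a * b"
  "pairing (E (n - 1) n a) (E 1 (n - 1) b) = - (b * a)"
  using n4 by (auto simp: pairing_def vv_def ww1_def ww2_def E_entry uinv_one)

lemma pairing_cancel:
  assumes "x \<in> F" "y \<in> P2" "x \<otimes> y = z \<otimes> (y \<otimes> x)" "z \<in> carrier G"
  shows "z = E 1 n (pairing x y)"
proof -
  have c: "x \<in> carrier G" "y \<in> carrier G" using assms F_carrier by (auto simp: P2_def)
  have "E 1 n (pairing x y) \<in> carrier G" using n4 by (intro E_in) auto
  then show ?thesis using F_P2_commutation[OF assms(1,2)] assms(3,4) c by (metis m_closed right_cancel)
qed

lemma iso_pairing:
  assumes \<psi>: "\<psi> \<in> iso G G" and "x \<in> F" "y \<in> P2"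
  shows "\<psi> (E 1 n (pairing x y)) = E 1 n (pairing (\<psi> x) (\<psi> y))"
proof (rule pairing_cancel)
  have c: "x \<in> carrier G" "y \<in> carrier G" using assms F_carrier by (auto simp: P2_def)
  have E: "E 1 n (pairing x y) \<in> carrier G" using n4 by (intro E_in) auto
  show "\<psi> x \<in> F" "\<psi> y \<in> P2" using assms iso_F iso_P2 by blast+
  show "\<psi> (E 1 n (pairing x y)) \<in> carrier G" using iso_carrier[OF \<psi> E] .
  show "\<psi> x \<otimes> \<psi> y = \<psi> (E 1 n (pairing x y)) \<otimes> (\<psi> y \<otimes> \<psi> x)"
    using arg_cong[OF F_P2_commutation[OF assms(2,3)], of \<psi>] c E iso_mult[OF \<psi>] by simp
qed

end

section \<open>The ring automorphism induced by a group automorphism\<close>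

text \<open>The three maps form an autotopism of the multiplication. Surjectivity of
  \<open>\<gamma>\<close> makes \<open>\<alpha> 1\<close> and \<open>\<beta> 1\<close> units;
  setting one argument to 1 expresses \<open>\<alpha>\<close> and \<open>\<beta>\<close> through
  \<open>\<gamma>\<close>, and dividing by \<open>\<gamma> 1\<close> leaves a multiplicative
  map.\<close>

lemma isotopy_ring_automorphism:
  fixes \<alpha> \<beta> \<gamma> :: "'a::idom \<Rightarrow> 'a"
  assumes bij: "bij \<gamma>" and add: "\<And>a b. \<gamma> (a + b) = \<gamma> a + \<gamma> b" and mult: "\<And>a b. \<gamma> (a * b) = \<alpha> a * \<beta> b"
    and \<sigma>: "\<sigma> = (\<lambda>a. \<gamma> a * uinv (\<gamma> 1))"
  shows "ring_automorphism \<sigma>" "\<alpha> 1 dvd 1" "\<alpha> a = \<alpha> 1 * \<sigma> a"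
proof -
  obtain b where "\<gamma> b = 1" using bij by (metis bij_pointE)
  then have "\<alpha> 1 * \<beta> b = 1" "\<beta> 1 * \<alpha> b = 1" using mult[of 1 b] mult[of b 1] by (auto simp: mult.commute)
  then have a1: "\<alpha> 1 dvd 1" and b1: "\<beta> 1 dvd 1" by (metis dvd_triv_left)+
  show "\<alpha> 1 dvd 1" by (rule a1)
  have g1: "\<gamma> 1 = \<alpha> 1 * \<beta> 1" using mult[of 1 1] by simp
  have u: "\<gamma> 1 dvd 1" unfolding g1 by (intro unit_mult a1 b1)
  have gs: "\<gamma> a = \<gamma> 1 * \<sigma> a" for a
    using uinv_right[OF u] unfolding \<sigma> by (metis mult.assoc mult.commute mult_1)
  have as: "\<alpha> a = \<alpha> 1 * \<sigma> a" for a
  proof -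
    have "\<alpha> a * \<beta> 1 = \<gamma> a" using mult[of a 1] by simp
    also have "\<dots> = (\<alpha> 1 * \<sigma> a) * \<beta> 1" unfolding gs[of a] g1 by (simp only: mult_ac)
    finally show ?thesis using unit_nonzero[OF b1] by (metis mult_cancel_right)
  qed
  then show "\<alpha> a = \<alpha> 1 * \<sigma> a" .
  have bs: "\<beta> b = \<beta> 1 * \<sigma> b" for b
  proof -
    have "\<alpha> 1 * \<beta> b = \<gamma> b" using mult[of 1 b] by simp
    also have "\<dots> = \<alpha> 1 * (\<beta> 1 * \<sigma> b)" unfolding gs[of b] g1 by (simp only: mult_ac)
    finally show ?thesis using unit_nonzero[OF a1] by (metis mult_cancel_left)
  qed
  have "\<sigma> (x * y) = \<sigma> x * \<sigma> y" for x y
  proof -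
    have "\<gamma> 1 * \<sigma> (x * y) = \<alpha> x * \<beta> y" using gs[of "x * y"] mult[of x y] by simp
    also have "\<dots> = (\<alpha> 1 * \<sigma> x) * (\<beta> 1 * \<sigma> y)" by (simp only: as[of x] bs[of y])
    also have "\<dots> = \<gamma> 1 * (\<sigma> x * \<sigma> y)" by (simp add: g1 mult_ac)
    finally show ?thesis using unit_nonzero[OF u] by simp
  qed
  moreover have "\<sigma> (x + y) = \<sigma> x + \<sigma> y" for x y by (simp add: \<sigma> add distrib_right)
  moreover have "\<sigma> 1 = 1" using uinv_right[OF u] by (simp add: \<sigma>)
  moreover have "bij \<sigma>"
  proof (rule bijI)
    show "inj \<sigma>" using bij_is_inj[OF bij] gs by (metis injD injI)
    show "surj \<sigma>"
    proof (rule surjI)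
      fix y
      have "\<gamma> (inv_into UNIV \<gamma> (\<gamma> 1 * y)) = \<gamma> 1 * y" using bij_is_surj[OF bij] by (simp add: surj_f_inv_f)
      then have "\<gamma> 1 * \<sigma> (inv_into UNIV \<gamma> (\<gamma> 1 * y)) = \<gamma> 1 * y" using gs by metis
      then show "\<sigma> (inv_into UNIV \<gamma> (\<gamma> 1 * y)) = y" using unit_nonzero[OF u] by simp
    qed
  qed
  ultimately show "ring_automorphism \<sigma>" by (auto simp: ring_automorphism_def)
qed

section \<open>Torus elements with prescribed weights\<close>

context triangular_group
begin

text \<open>By the (NG)-condition at least one of the positions \<open>1\<close>, \<open>2\<close>
  carries an arbitrary unit, and likewise one of \<open>n - 1\<close>, \<open>n\<close>. As
  \<open>n \<ge> 4\<close> the two pairs are disjoint, so both ratios can be prescribed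
  independently.\<close>

lemma torus_element:
  assumes "p dvd 1" "q dvd 1"
  shows "\<exists>f. diag_mat n f \<in> carrier G \<and> ch 1 (diag_mat n f) = p \<and> ch (n - 1) (diag_mat n f) = q"
proof -
  have S: "Suc (n - 1) = n" using n4 by simp
  have "1 \<in> {1..n - 1}" using n4 by simp
  then have "1 \<notin> I \<longrightarrow> 1 + 1 \<in> I" using NG unfolding NG_condition_def by blast
  then have "1 \<notin> I \<longrightarrow> 2 \<in> I" by (simp only: one_add_one)
  then obtain f1 where f1: "\<And>i. f1 i dvd (1::'a)" "\<And>i. i \<notin> I \<Longrightarrow> f1 i = 1" "f1 1 * uinv (f1 2) = p" "\<And>i. i \<notin> {1, 2} \<Longrightarrow> f1 i = 1"
  proof (cases "1 \<in> I")
    case True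
    show ?thesis by (rule that[of "\<lambda>i. if i = 1 then p else 1"]) (use assms True in \<open>auto simp: uinv_one\<close>)
  next
    case False
    have "uinv (uinv p) = p"
      using uinv_right[OF uinv_dvd[OF assms(1)]] uinv_right[OF assms(1)] by (metis mult.commute mult.left_commute mult_1)
    then show ?thesis using \<open>1 \<notin> I \<longrightarrow> 2 \<in> I\<close> False
      by (intro that[of "\<lambda>i. if i = 2 then uinv p else 1"]) (use assms uinv_dvd in auto)
  qed
  have "n - 1 \<notin> I \<longrightarrow> n \<in> I" using NG n4 S unfolding NG_condition_def by (auto dest!: bspec[of _ _ "n - 1"])
  then obtain f2 where f2: "\<And>i. f2 i dvd (1::'a)" "\<And>i. i \<notin> I \<Longrightarrow> f2 i = 1" "f2 (n - 1) * uinv (f2 n) = q" "\<And>i. i \<notin> {n - 1, n} \<Longrightarrow> f2 i = 1"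
  proof (cases "n - 1 \<in> I")
    case True
    show ?thesis by (rule that[of "\<lambda>i. if i = n - 1 then q else 1"]) (use assms True n4 in \<open>auto simp: uinv_one\<close>)
  next
    case False
    have "uinv (uinv q) = q"
      using uinv_right[OF uinv_dvd[OF assms(2)]] uinv_right[OF assms(2)] by (metis mult.commute mult.left_commute mult_1)
    then show ?thesis using \<open>n - 1 \<notin> I \<longrightarrow> n \<in> I\<close> False n4
      by (intro that[of "\<lambda>i. if i = n then uinv q else 1"]) (use assms uinv_dvd in auto)
  qed
  let ?f = "\<lambda>i. f1 i * f2 i"
  have "diag_mat n ?f \<in> carrier G" unfolding carrier_eq
    using f1(1,2) f2(1,2) by (intro diag_mat_in unit_mult) auto
  moreover have "ch 1 (diag_mat n ?f) = p"
    using f1(3) f2(4)[of 1] f2(4)[of 2] n4 by (simp add: ch_def diag_mat_def numeral_2_eq_2)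
  moreover have "ch (n - 1) (diag_mat n ?f) = q"
  proof -
    have "f1 (n - 1) = 1" "f1 n = 1" "1 \<le> n - 1" using n4 by (auto intro!: f1(4))
    then show ?thesis using f2(3) n4 S by (simp add: ch_def diag_mat_def)
  qed
  ultimately show ?thesis by blast
qed

lemma vv_diag_mat: "vv i (diag_mat n f) = 0"
  by (simp add: vv_def diag_mat_def)

lemma unipotent_diag_decomposition:
  assumes x: "x \<in> carrier G"
  shows "\<exists>y\<in>F. \<exists>f. diag_mat n f \<in> carrier G \<and> x = y \<otimes> diag_mat n f"
proof -
  define f where "f i = (if 1 \<le> i \<and> i \<le> n then x i i else 1)" for i
  have t: "diag_mat n f \<in> carrier G" unfolding carrier_eq
    using x diag_unit[OF x] S_set_diag_one[of x n I] by (intro diag_mat_in) (auto simp: f_def carrier_eq)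
  define y where "y = x \<otimes> inv (diag_mat n f)"
  have yc: "y \<in> carrier G" using x t by (simp add: y_def)
  have yx: "y \<otimes> diag_mat n f = x" using x t by (simp add: y_def m_assoc)
  have d: "y i i = 1" if i: "1 \<le> i" "i \<le> n" for i
  proof -
    have "y i i * x i i = 1 * x i i" using arg_cong[OF yx, of "\<lambda>A. A i i"] yc t i by (simp add: mult_diag_entry diag_mat_def f_def)
    then show ?thesis using unit_nonzero[OF diag_unit[OF x i]] by (metis mult_cancel_right)
  qed
  have "y \<in> F" using d n4 yc by (intro F_I) auto
  then show ?thesis using yx t by metis
qed

end

section \<open>The action of one automorphism on the corner and on the two end entries\<close>

text \<open>The unit \<open>u0\<close> makes the torus act non-trivially on both end entries;
  \<open>\<alpha>_not_both\<close> and \<open>vv_\<phi>_general\<close> rest on this.\<close>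

locale triangular_group_aut = triangular_group +
  fixes \<phi> u0
  assumes \<phi>: "\<phi> \<in> iso G G" and u0: "u0 dvd 1" "u0 \<noteq> (1::'a)"
begin

definition \<gamma> :: "'a \<Rightarrow> 'a" where "\<gamma> a = \<phi> (E 1 n a) 1 n"

lemma E1n_in: "E 1 n a \<in> carrier G"
  using n4 by (intro E_in) auto

text \<open>Every element of this root group is a value of the pairing, and automorphisms map
  pairing values to pairing values.\<close>

lemma iso_E1n:
  assumes "\<psi> \<in> iso G G"
  shows "\<psi> (E 1 n a) = E 1 n (\<psi> (E 1 n a) 1 n)"
proof -
  have "E 1 2 a \<in> F" using n4 by (intro E_F) auto
  then have "\<psi> (E 1 n (pairing (E 1 2 a) (E 2 n 1))) = E 1 n (pairing (\<psi> (E 1 2 a)) (\<psi> (E 2 n 1)))"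
    by (rule iso_pairing[OF assms _ E2n_P2])
  then have "\<psi> (E 1 n a) = E 1 n (pairing (\<psi> (E 1 2 a)) (\<psi> (E 2 n 1)))" by (simp only: pairing_E mult_1_right)
  then show ?thesis by (simp add: E_entry)
qed

lemma \<phi>_E1n: "\<phi> (E 1 n a) = E 1 n (\<gamma> a)"
  unfolding \<gamma>_def by (rule iso_E1n[OF \<phi>])

lemma E1n_inj: "E 1 n a = E 1 n b \<longleftrightarrow> a = b"
  by (metis E_entry)

lemma \<gamma>_add: "\<gamma> (a + b) = \<gamma> a + \<gamma> b"
proof -
  have add: "E 1 n c \<otimes> E 1 n d = E 1 n (c + d)" for c d using n4 by (intro E_add) auto
  have "\<phi> (E 1 n a \<otimes> E 1 n b) = \<phi> (E 1 n a) \<otimes> \<phi> (E 1 n b)" by (rule iso_mult[OF \<phi> E1n_in E1n_in])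
  then show ?thesis unfolding add \<phi>_E1n E1n_inj .
qed

lemma \<gamma>_zero: "\<gamma> 0 = 0"
  using \<gamma>_add[of 0 0] by (metis add_0_left add_right_cancel)

lemma \<gamma>_minus: "\<gamma> (- a) = - \<gamma> a"
  using \<gamma>_add[of a "- a"] \<gamma>_zero by (simp add: eq_neg_iff_add_eq_0 add.commute)

lemma \<phi>_inj: "x \<in> carrier G \<Longrightarrow> y \<in> carrier G \<Longrightarrow> \<phi> x = \<phi> y \<Longrightarrow> x = y"
  using \<phi> by (auto simp: iso_def bij_betw_def dest: inj_onD)

lemma \<gamma>_bij: "bij \<gamma>"
proof (rule bijI)
  show "inj \<gamma>"
  proof (rule injI)
    fix a b assume "\<gamma> a = \<gamma> b"
    then have "\<phi> (E 1 n a) = \<phi> (E 1 n b)" by (simp only: \<phi>_E1n)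
    then show "a = b" using \<phi>_inj[OF E1n_in E1n_in] E1n_inj by blast
  qed
  show "surj \<gamma>"
  proof (rule surjI)
    fix b
    let ?\<psi> = "inv_into (carrier G) \<phi>"
    have 1: "\<phi> (?\<psi> (E 1 n b)) = E 1 n b"
      using \<phi> E1n_in[of b] by (intro f_inv_into_f[of _ \<phi> "carrier G"]) (auto simp: iso_def bij_betw_def)
    have 2: "?\<psi> (E 1 n b) = E 1 n (?\<psi> (E 1 n b) 1 n)" by (rule iso_E1n[OF iso_inv[OF \<phi>]])
    have "E 1 n (\<gamma> (?\<psi> (E 1 n b) 1 n)) = \<phi> (E 1 n (?\<psi> (E 1 n b) 1 n))" by (rule \<phi>_E1n[symmetric])
    also have "\<dots> = E 1 n b" using 1 2 by simp
    finally show "\<gamma> (?\<psi> (E 1 n b) 1 n) = b" unfolding E1n_inj .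
  qed
qed

lemma \<gamma>_pairing:
  assumes "x \<in> F" "y \<in> P2"
  shows "\<gamma> (pairing x y) = pairing (\<phi> x) (\<phi> y)"
  using iso_pairing[OF \<phi> assms] unfolding \<phi>_E1n E1n_inj .

text \<open>The elements of \<open>F\<close> with both end entries zero form the kernel of the
  pairing against \<open>P2\<close>, and a kernel defined by the pairing is preserved.\<close>

lemma iso_vv_zero:
  assumes \<psi>: "\<psi> \<in> iso G G" and x: "x \<in> F" "vv 1 x = 0" "vv (n - 1) x = 0"
  shows "vv 1 (\<psi> x) = 0" "vv (n - 1) (\<psi> x) = 0"
proof -
  have "pairing (\<psi> x) y = 0" if y: "y \<in> P2" for y
  proof -
    obtain y' where y': "y' \<in> P2" "\<psi> y' = y" using iso_inv_P2[OF \<psi> y] by blast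
    have "E 1 n (pairing (\<psi> x) y) = \<psi> (E 1 n (pairing x y'))" using iso_pairing[OF \<psi> x(1) y'(1)] y' by simp
    also have "pairing x y' = 0" using x by (simp add: pairing_def)
    also have "E 1 n 0 = \<one>" using n4 by (auto simp: fun_eq_iff E_entry one_entry)
    also have "\<psi> \<one> = \<one>" using iso_one \<psi> by blast
    finally have "E 1 n (pairing (\<psi> x) y) 1 n = \<one> 1 n" by simp
    then show ?thesis using n4 by (simp add: E_entry one_entry)
  qed
  from this[OF E2n_P2[of 1]] this[OF E1n'_P2[of 1]]
  show "vv 1 (\<psi> x) = 0" "vv (n - 1) (\<psi> x) = 0"
    using n4 by (auto simp: pairing_def ww1_def ww2_def E_entry uinv_one)
qed

text \<open>With \<open>i\<close> and \<open>j\<close> in \<open>{1, n - 1}\<close> these are the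
  entries of the 2 by 2 matrix of additive maps by which \<open>\<phi>\<close> acts on the pair of
  end entries.\<close>

definition \<alpha> :: "nat \<Rightarrow> nat \<Rightarrow> 'a \<Rightarrow> 'a" where
  "\<alpha> i j a = vv i (\<phi> (E j (Suc j) a))"

lemma ends: "i \<in> {1, n - 1} \<Longrightarrow> 1 \<le> i \<and> i < n"
  using n4 by auto

text \<open>Splitting off the two elementary factors leaves an element of the kernel of the pairing,
  which contributes nothing.\<close>

lemma vv_\<phi>:
  assumes x: "x \<in> F" and i: "i \<in> {1, n - 1}"
  shows "vv i (\<phi> x) = \<alpha> i 1 (vv 1 x) + \<alpha> i (n - 1) (vv (n - 1) x)"
proof -
  have S: "Suc (n - 1) = n" using n4 by simp
  let ?a = "E 1 (Suc 1) (vv 1 x)" and ?b = "E (n - 1) (Suc (n - 1)) (vv (n - 1) x)"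
  have ab: "?a \<in> F" "?b \<in> F" using n4 by (auto intro!: E_F)
  define k where "k = inv (?a \<otimes> ?b) \<otimes> x"
  have kF: "k \<in> F" unfolding k_def by (intro mult_F inv_F ab x)
  have xk: "x = ?a \<otimes> ?b \<otimes> k" unfolding k_def
    using F_carrier[OF mult_F[OF ab]] F_carrier[OF x] inv_closed[OF F_carrier[OF mult_F[OF ab]]]
    by (metis l_one m_assoc r_inv)
  have dec: "vv r x = vv r ?a + vv r ?b + vv r k" if "r \<in> {1, n - 1}" for r
    using ends[OF that] arg_cong[OF xk, of "vv r"] vv_mult_F[OF mult_F[OF ab] kF, of r] vv_mult_F[OF ab, of r] by (simp del: One_nat_def)
  have ne: "1 \<le> n - 1" "n - 1 < n" "1 < n" "1 \<noteq> n - 1" using n4 by auto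
  have "vv 1 ?a = vv 1 x" "vv 1 ?b = 0" "vv (n - 1) ?a = 0" "vv (n - 1) ?b = vv (n - 1) x"
    using ne by (simp_all only: vv_E le_refl if_True if_False simp_thms ne(4)[symmetric])
  then have "vv 1 k = 0" "vv (n - 1) k = 0" using dec[of 1] dec[of "n - 1"] by simp_all
  then have k0: "vv i (\<phi> k) = 0" using iso_vv_zero[OF \<phi> kF] i by auto
  note ca = F_carrier[OF ab(1)] F_carrier[OF ab(2)] F_carrier[OF kF]
  have "\<phi> x = \<phi> ?a \<otimes> \<phi> ?b \<otimes> \<phi> k"
    using arg_cong[OF xk, of \<phi>] iso_mult[OF \<phi> m_closed[OF ca(1,2)] ca(3)] iso_mult[OF \<phi> ca(1,2)] by metis
  then show ?thesis using k0 ends[OF i] iso_F[OF \<phi> ab(1)] iso_F[OF \<phi> ab(2)] iso_F[OF \<phi> kF]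
    by (simp add: vv_mult_F mult_F \<alpha>_def)
qed

lemma \<alpha>_add: "i \<in> {1, n - 1} \<Longrightarrow> j \<in> {1, n - 1} \<Longrightarrow> \<alpha> i j (a + b) = \<alpha> i j a + \<alpha> i j b"
proof -
  assume i: "i \<in> {1, n - 1}" and j: "j \<in> {1, n - 1}"
  have EF: "E j (Suc j) c \<in> F" for c using ends[OF j] by (intro E_F) auto
  have "\<phi> (E j (Suc j) (a + b)) = \<phi> (E j (Suc j) a) \<otimes> \<phi> (E j (Suc j) b)"
    using ends[OF j] iso_mult[OF \<phi> F_carrier[OF EF] F_carrier[OF EF]] by (simp flip: E_add)
  then show ?thesis using vv_mult_F[OF iso_F[OF \<phi> EF] iso_F[OF \<phi> EF]] ends[OF i] by (simp add: \<alpha>_def)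
qed

lemma \<alpha>_zero: "i \<in> {1, n - 1} \<Longrightarrow> j \<in> {1, n - 1} \<Longrightarrow> \<alpha> i j 0 = 0"
  using \<alpha>_add[of i j 0 0] by (metis add_0_left add_right_cancel)

lemma \<alpha>_weight:
  assumes s: "s \<in> carrier G" and i: "i \<in> {1, n - 1}" and j: "j \<in> {1, n - 1}"
  shows "\<alpha> i j (ch j s * a) = ch i (\<phi> s) * \<alpha> i j a"
proof -
  let ?x = "E j (Suc j) a"
  have xF: "?x \<in> F" using ends[OF j] by (intro E_F) auto
  obtain z where z: "z \<in> F" "z \<otimes> s = s \<otimes> ?x" "\<forall>i. 1 \<le> i \<and> i < n \<longrightarrow> vv i z = ch i s * vv i ?x"
    using conj_F[OF s xF] by blast
  note c = F_carrier[OF xF] F_carrier[OF z(1)]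
  have "vv i (\<phi> z \<otimes> \<phi> s) = vv i (\<phi> s \<otimes> \<phi> ?x)"
    using z(2) iso_mult[OF \<phi> c(2) s] iso_mult[OF \<phi> s c(1)] by simp
  then have "vv i (\<phi> z) = ch i (\<phi> s) * vv i (\<phi> ?x)"
    using ch_F[OF iso_F[OF \<phi> z(1)]] ends[OF i] iso_carrier[OF \<phi>] c s by (simp add: vv_mult)
  moreover have "vv i (\<phi> z) = \<alpha> i j (ch j s * a)"
  proof -
    have v: "vv r z = (if r = j then ch j s * a else 0)" if "r \<in> {1, n - 1}" for r
      using z(3) ends[OF that] ends[OF j] by (simp add: vv_E)
    have "(1::nat) \<noteq> n - 1" using n4 by simp
    then show ?thesis unfolding vv_\<phi>[OF z(1) i] using v[of 1] v[of "n - 1"] j \<alpha>_zero[OF i] by auto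
  qed
  ultimately show ?thesis by (simp add: \<alpha>_def)
qed

text \<open>By \<open>\<alpha>_weight\<close> two non-zero entries in row \<open>i\<close> make
  \<open>ch i (\<phi> s)\<close> trivial whenever \<open>ch 1 s = 1\<close> and whenever
  \<open>ch (n - 1) s = 1\<close>. Every \<open>s\<close> is a product of two such elements, so
  \<open>ch i\<close> would be trivial on the image of \<open>\<phi>\<close>, that is, on all of
  \<open>G\<close>, against the existence of \<open>u0\<close>.\<close>

lemma \<alpha>_not_both:
  assumes i: "i \<in> {1, n - 1}" and a: "\<alpha> i 1 a \<noteq> 0" and b: "\<alpha> i (n - 1) b \<noteq> 0"
  shows False
proof -
  have e1: "(1::nat) \<in> {1, n - 1}" and e2: "n - 1 \<in> {1, n - 1}" by auto
  have c1: "ch i (\<phi> s) = 1" if "s \<in> carrier G" "ch 1 s = 1" for s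
    using \<alpha>_weight[OF that(1) i e1, of a] that(2) a by (metis mult_1 mult_cancel_right)
  have c2: "ch i (\<phi> s) = 1" if "s \<in> carrier G" "ch (n - 1) s = 1" for s
    using \<alpha>_weight[OF that(1) i e2, of b] that(2) b by (metis mult_1 mult_cancel_right)
  have all: "ch i (\<phi> s) = 1" if s: "s \<in> carrier G" for s
  proof -
    have "ch 1 s dvd 1" using ch_unit[OF s] n4 by simp
    then obtain f where f: "diag_mat n f \<in> carrier G" "ch 1 (diag_mat n f) = ch 1 s" "ch (n - 1) (diag_mat n f) = 1"
      using torus_element[of "ch 1 s" 1] by auto
    define r where "r = s \<otimes> inv (diag_mat n f)"
    have rc: "r \<in> carrier G" using s f by (simp add: r_def)
    have rs: "s = r \<otimes> diag_mat n f" using s f by (simp add: r_def m_assoc)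
    have "ch 1 s = ch 1 r * ch 1 s" using ch_mult[OF rc f(1), of 1] rs f(2) n4 by simp
    moreover have "ch 1 s \<noteq> 0" using unit_nonzero[OF \<open>ch 1 s dvd 1\<close>] .
    ultimately have "ch 1 r = 1" by simp
    then have "ch i (\<phi> r) = 1" using c1 rc by blast
    moreover have "ch i (\<phi> s) = ch i (\<phi> r) * ch i (\<phi> (diag_mat n f))"
      using ch_mult[of "\<phi> r" "\<phi> (diag_mat n f)" i] ends[OF i] iso_carrier[OF \<phi>] rc f(1) iso_mult[OF \<phi> rc f(1)] rs by simp
    ultimately show ?thesis using c2[OF f(1) f(3)] by simp
  qed
  obtain f where f: "diag_mat n f \<in> carrier G" "ch 1 (diag_mat n f) = u0" "ch (n - 1) (diag_mat n f) = u0"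
    using torus_element[OF u0(1) u0(1)] by blast
  then have "ch i (diag_mat n f) = u0" using i by auto
  moreover obtain s where "s \<in> carrier G" "\<phi> s = diag_mat n f" using iso_surj[OF \<phi> f(1)] by blast
  ultimately show False using all u0 by metis
qed

lemma \<alpha>_some:
  assumes i: "i \<in> {1, n - 1}"
  shows "\<exists>a. \<alpha> i 1 a \<noteq> 0 \<or> \<alpha> i (n - 1) a \<noteq> 0"
proof (rule ccontr)
  assume "\<not> ?thesis"
  then have "vv i (\<phi> x) = 0" if "x \<in> F" for x using vv_\<phi>[OF that i] by simp
  moreover have "E i (Suc i) 1 \<in> F" using ends[OF i] by (intro E_F) auto
  then obtain x where "x \<in> F" "\<phi> x = E i (Suc i) 1" using iso_inv_F[OF \<phi>] by blast
  ultimately show False using ends[OF i] vv_E[of i i 1] by fastforce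
qed

text \<open>Otherwise the image of an elementary matrix would lie in the kernel of the pairing, and
  so would its preimage.\<close>

lemma \<alpha>_column:
  assumes j: "j \<in> {1, n - 1}"
  shows "\<exists>a. \<alpha> 1 j a \<noteq> 0 \<or> \<alpha> (n - 1) j a \<noteq> 0"
proof (rule ccontr)
  assume *: "\<not> ?thesis"
  let ?x = "E j (Suc j) 1" and ?\<psi> = "inv_into (carrier G) \<phi>"
  have xF: "?x \<in> F" using ends[OF j] by (intro E_F) auto
  have "?\<psi> (\<phi> ?x) = ?x" using \<phi> F_carrier[OF xF] by (intro inv_into_f_f) (auto simp: iso_def bij_betw_def)
  moreover have "vv 1 (\<phi> ?x) = 0" "vv (n - 1) (\<phi> ?x) = 0" using * by (auto simp: \<alpha>_def)
  ultimately have "vv j ?x = 0" using iso_vv_zero[OF iso_inv[OF \<phi>] iso_F[OF \<phi> xF]] j by auto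
  then show False using ends[OF j] vv_E[of j j 1] by simp
qed

text \<open>Each row has exactly one entry that is not identically zero and no column vanishes: the
  matrix is diagonal or antidiagonal.\<close>

lemma \<alpha>_monomial:
  "(\<forall>a. \<alpha> 1 (n - 1) a = 0) \<and> (\<forall>a. \<alpha> (n - 1) 1 a = 0) \<or> (\<forall>a. \<alpha> 1 1 a = 0) \<and> (\<forall>a. \<alpha> (n - 1) (n - 1) a = 0)"
proof -
  have e: "(1::nat) \<in> {1, n - 1}" "n - 1 \<in> {1, n - 1}" by auto
  show ?thesis
    using \<alpha>_not_both[OF e(1)] \<alpha>_not_both[OF e(2)] \<alpha>_some[OF e(1)] \<alpha>_some[OF e(2)]
      \<alpha>_column[OF e(1)] \<alpha>_column[OF e(2)] by metis
qed

definition \<sigma> :: "'a \<Rightarrow> 'a" where "\<sigma> a = \<gamma> a * uinv (\<gamma> 1)"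

lemma \<sigma>_fun: "\<sigma> = (\<lambda>a. \<gamma> a * uinv (\<gamma> 1))"
  by (simp add: fun_eq_iff \<sigma>_def)

lemma ch_\<phi>:
  assumes i: "i \<in> {1, n - 1}" and j: "j \<in> {1, n - 1}" and m: "\<And>a b. \<gamma> (a * b) = \<alpha> i j a * \<beta> b"
    and s: "s \<in> carrier G"
  shows "ch i (\<phi> s) = \<sigma> (ch j s)"
proof -
  note iso = isotopy_ring_automorphism[OF \<gamma>_bij \<gamma>_add m \<sigma>_fun]
  have "\<alpha> i j 1 * \<sigma> (ch j s) = \<alpha> i j 1 * ch i (\<phi> s)"
    using \<alpha>_weight[OF s i j, of 1] iso(3)[of "ch j s"] by (simp add: mult.commute)
  then show ?thesis using unit_nonzero[OF iso(2)] by simp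
qed

text \<open>The factor in \<open>F\<close> gives the \<open>\<sigma>\<close>-term. For the diagonal
  factor, its image commutes with that of a fixed torus element of weight \<open>u0\<close>; two
  commuting affine maps, one with multiplier \<open>\<sigma> u0 \<noteq> 1\<close>, have translation
  parts tied to each other by their multipliers. Hence the contribution depends on
  \<open>ch i (\<phi> x)\<close> alone.\<close>

lemma vv_\<phi>_general:
  assumes i: "i \<in> {1, n - 1}" and j: "j \<in> {1, n - 1}" and m: "\<And>a b. \<gamma> (a * b) = \<alpha> i j a * \<beta> b"
    and other: "\<And>k a. k \<in> {1, n - 1} \<Longrightarrow> k \<noteq> j \<Longrightarrow> \<alpha> i k a = 0"
  shows "\<exists>\<tau>. \<forall>x\<in>carrier G. vv i (\<phi> x) = \<alpha> i j 1 * \<sigma> (vv j x) + \<tau> (ch i (\<phi> x))"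
proof -
  note iso = isotopy_ring_automorphism[OF \<gamma>_bij \<gamma>_add m \<sigma>_fun]
  note ii = ends[OF i]
  obtain f0 where f0: "diag_mat n f0 \<in> carrier G" "ch 1 (diag_mat n f0) = u0" "ch (n - 1) (diag_mat n f0) = u0"
    using torus_element[OF u0(1) u0(1)] by blast
  let ?d = "diag_mat n f0"
  have "ch j ?d = u0" using f0 j by auto
  then have c0: "ch i (\<phi> ?d) = \<sigma> u0" using ch_\<phi>[OF i j m f0(1)] by simp
  have s1: "\<sigma> u0 \<noteq> 1" using u0(2) ring_automorphismD(1,2)[OF iso(1)] by (metis bij_is_inj injD)
  \<comment> \<open>Division by \<open>\<sigma> u0 - 1\<close> need not be possible in the ring, but
    a solution is unique when it exists, and for the values that occur it does.\<close>
  define \<tau> where "\<tau> c = (SOME v. (\<sigma> u0 - 1) * v = (c - 1) * vv i (\<phi> ?d))" for c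
  have diag: "vv i (\<phi> (diag_mat n f)) = \<tau> (ch i (\<phi> (diag_mat n f)))" if f: "diag_mat n f \<in> carrier G" for f
  proof -
    let ?t = "diag_mat n f"
    have "?d \<otimes> ?t = ?t \<otimes> ?d" unfolding mult_eq using f0(1) f by (intro diag_mat_commute) (auto simp: carrier_eq)
    then have "\<phi> ?d \<otimes> \<phi> ?t = \<phi> ?t \<otimes> \<phi> ?d" using iso_mult[OF \<phi>] f f0(1) by metis
    then have "vv i (\<phi> ?d \<otimes> \<phi> ?t) = vv i (\<phi> ?t \<otimes> \<phi> ?d)" by simp
    then have e: "(\<sigma> u0 - 1) * vv i (\<phi> ?t) = (ch i (\<phi> ?t) - 1) * vv i (\<phi> ?d)"
      using ii iso_carrier[OF \<phi>] f f0(1) c0 by (simp add: vv_mult algebra_simps)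
    then have "(\<sigma> u0 - 1) * \<tau> (ch i (\<phi> ?t)) = (ch i (\<phi> ?t) - 1) * vv i (\<phi> ?d)"
      unfolding \<tau>_def by (rule someI)
    then have "(\<sigma> u0 - 1) * \<tau> (ch i (\<phi> ?t)) = (\<sigma> u0 - 1) * vv i (\<phi> ?t)" using e by simp
    then show ?thesis using s1 by simp
  qed
  have "vv i (\<phi> x) = \<alpha> i j 1 * \<sigma> (vv j x) + \<tau> (ch i (\<phi> x))" if x: "x \<in> carrier G" for x
  proof -
    obtain y f where y: "y \<in> F" "diag_mat n f \<in> carrier G" "x = y \<otimes> diag_mat n f"
      using unipotent_diag_decomposition[OF x] by blast
    note yc = F_carrier[OF y(1)]
    have vx: "vv j x = vv j y" using y(3) vv_mult[OF yc y(2)] ends[OF j] by (simp add: vv_diag_mat)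
    have px: "\<phi> x = \<phi> y \<otimes> \<phi> (diag_mat n f)" using y iso_mult[OF \<phi> yc y(2)] by simp
    have c1: "ch i (\<phi> y) = 1" using ch_F[OF iso_F[OF \<phi> y(1)]] ii by simp
    have pc: "\<phi> y \<in> carrier G" "\<phi> (diag_mat n f) \<in> carrier G" using iso_carrier[OF \<phi>] yc y by auto
    have "ch i (\<phi> x) = ch i (\<phi> (diag_mat n f))" using px c1 ch_mult[OF pc] ii by simp
    moreover have "vv i (\<phi> x) = vv i (\<phi> (diag_mat n f)) + vv i (\<phi> y)" using px c1 vv_mult[OF pc] ii by simp
    moreover have "vv i (\<phi> y) = \<alpha> i j (vv j y)"
    proof -
      have "(1::nat) \<noteq> n - 1" using n4 by simp
      then show ?thesis unfolding vv_\<phi>[OF y(1) i] using j other[of 1] other[of "n - 1"] by auto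
    qed
    ultimately show ?thesis using diag[OF y(2)] iso(3)[of "vv j y"] vx by simp
  qed
  then show ?thesis by blast
qed

end

section \<open>Twisted conjugacy classes\<close>

text \<open>Two solutions differ by a unit fixed by \<open>\<sigma>\<close>.\<close>

lemma finite_twisted_units:
  fixes \<sigma> :: "'a::idom \<Rightarrow> 'a"
  assumes \<sigma>: "ring_automorphism \<sigma>" and fixed: "finite {u. u dvd 1 \<and> \<sigma> u = u}" and p: "p dvd 1" and k: "k dvd 1"
  shows "finite {c. c dvd 1 \<and> p * \<sigma> c = c * k}"
proof (cases "\<exists>c0. c0 dvd 1 \<and> p * \<sigma> c0 = c0 * k")
  case True
  then obtain c0 where c0: "c0 dvd 1" "p * \<sigma> c0 = c0 * k" by blast
  note s = ring_automorphismD[OF \<sigma>]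
  have "{c. c dvd 1 \<and> p * \<sigma> c = c * k} \<subseteq> (\<lambda>e. e * c0) ` {u. u dvd 1 \<and> \<sigma> u = u}"
  proof
    fix c assume "c \<in> {c. c dvd 1 \<and> p * \<sigma> c = c * k}"
    then have c: "c dvd 1" "p * \<sigma> c = c * k" by auto
    define e where "e = c * uinv c0"
    have ec: "e * c0 = c" using uinv_left[OF c0(1)] by (simp add: e_def mult.assoc)
    have nz: "p * \<sigma> c0 \<noteq> 0" using c0 unit_nonzero[OF c0(1)] unit_nonzero[OF k] by simp
    have "\<sigma> e * (p * \<sigma> c0) = p * \<sigma> c" using s(4)[of e c0] ec by (simp add: mult_ac)
    also have "\<dots> = e * (p * \<sigma> c0)" using c(2) c0(2) by (simp only: ec[symmetric] mult.assoc)
    finally have "\<sigma> e = e" using nz by simp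
    moreover have "e dvd 1" unfolding e_def by (intro unit_mult c uinv_dvd c0)
    ultimately show "c \<in> (\<lambda>e. e * c0) ` {u. u dvd 1 \<and> \<sigma> u = u}" using ec by force
  qed
  then show ?thesis using fixed finite_subset by blast
next
  case False
  then have "{c. c dvd 1 \<and> p * \<sigma> c = c * k} = {}" by blast
  then show ?thesis by (simp only: finite.emptyI)
qed

section \<open>Finite generation passes from the group to the ring\<close>

context triangular_group
begin

text \<open>The matrices with all entries in \<open>?A\<close> are closed under multiplication and
  include the generators with their inverses, so all of \<open>G\<close> has entries in
  \<open>?A\<close>; an elementary matrix has an arbitrary one.\<close>

lemma fg_ring:
  assumes "finitely_generated G"
  shows "\<exists>xs. gen_ring xs = (UNIV :: 'a set)"
proof -
  obtain S where S: "finite S" "S \<subseteq> carrier G" "generate G S = carrier G"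
    using assms by (auto simp: finitely_generated_def)
  define X where "X = (\<lambda>(g, i, j). g i j) ` ((S \<union> m_inv G ` S) \<times> {0..n} \<times> {0..n})"
  have "finite X" using S by (auto simp: X_def)
  then obtain xs where xs: "set xs = X" using finite_list by blast
  let ?A = "gen_ring xs"
  note A = sub_ring_gen_ring[of xs]
  have ent: "g i j \<in> ?A" if g: "g \<in> S \<union> m_inv G ` S" for g i j
  proof (cases "i \<le> n \<and> j \<le> n")
    case True
    then have "(g, i, j) \<in> (S \<union> m_inv G ` S) \<times> {0..n} \<times> {0..n}" using g by simp
    then have "g i j \<in> X" unfolding X_def by (rule rev_image_eqI) simp
    then show ?thesis using gen_ring_contains[of xs] xs by blast
  next
    case False
    have "g \<in> carrier G" using g S by auto
    then have "g i j = 0" using False by (intro zero_entry) auto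
    then show ?thesis using sub_ring_zero[OF A] by simp
  qed
  have "h \<in> carrier G \<and> (\<forall>i j. h i j \<in> ?A)" if "h \<in> generate G S" for h
    using that
  proof induction
    case one
    have "\<one> i j \<in> ?A" for i j using sub_ring_zero[OF A] sub_ring_one[OF A] by (simp add: one_entry)
    then show ?case using one_closed by blast
  next
    case (incl h)
    then show ?case using ent S by auto
  next
    case (inv h)
    then show ?case using ent S by auto
  next
    case (eng h1 h2)
    have "(h1 \<otimes> h2) i j \<in> ?A" for i j
      unfolding mult_entry[OF eng.IH(1)[THEN conjunct1] eng.IH(2)[THEN conjunct1]]
      using eng.IH by (intro sub_ring_sum[OF A] sub_ring_mult[OF A]) blast+
    then show ?case using eng.IH m_closed by blast
  qed
  then have "E 1 2 r 1 2 \<in> ?A" for r using S(3) E_in[of 1 2 r] n4 by auto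
  then have "?A = UNIV" by (auto simp: E_entry)
  then show ?thesis by blast
qed

end

section \<open>The two contradictions from finitely many twisted classes\<close>

context triangular_group_aut
begin

text \<open>Over a finite set of twisted classes only finitely many
  values of \<open>ch 1 x\<close> can occur for the conjugating elements \<open>x\<close>, so that the additive parameter \<open>r\<close> is
  confined to finitely many cosets.\<close>

lemma contradiction_preserving:
  assumes fg: "gen_ring xs = (UNIV :: 'a set)" and inf: "infinite (UNIV :: 'a set)"
    and W: "finite W" "W \<subseteq> carrier G" and cov: "\<And>g. g \<in> carrier G \<Longrightarrow> \<exists>w\<in>W. \<exists>x\<in>carrier G. g \<otimes> \<phi> x = x \<otimes> w"
    and s: "ring_automorphism s" and l: "l dvd 1"
    and ch1: "\<And>x. x \<in> carrier G \<Longrightarrow> ch 1 (\<phi> x) = s (ch 1 x)"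
    and vv1: "\<And>x. x \<in> carrier G \<Longrightarrow> vv 1 (\<phi> x) = l * s (vv 1 x) + \<tau> (ch 1 (\<phi> x))"
  shows False
proof -
  have n1: "1 \<le> (1::nat)" "1 < n" using n4 by auto
  note pc = iso_carrier[OF \<phi>]
  \<comment> \<open>On torus elements the \<open>ch 1\<close> component of the covering says that
    the units are covered by finitely many cosets of the quotients \<open>x / s x\<close>.\<close>
  have fin: "finite {u. u dvd 1 \<and> s u = u}"
  proof (rule finite_fixed_units[OF fg s, of "ch 1 ` W"])
    show "\<exists>w\<in>ch 1 ` W. \<exists>x. x dvd 1 \<and> u * s x = w * x" if u: "u dvd 1" for u
    proof -
      obtain f where f: "diag_mat n f \<in> carrier G" "ch 1 (diag_mat n f) = u"
        using torus_element[OF u, of 1] by auto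
      obtain w x where wx: "w \<in> W" "x \<in> carrier G" "diag_mat n f \<otimes> \<phi> x = x \<otimes> w" using cov[OF f(1)] by blast
      have wc: "w \<in> carrier G" using wx W by auto
      have "u * s (ch 1 x) = ch 1 w * ch 1 x"
        using arg_cong[OF wx(3), of "ch 1"] ch_mult[OF f(1) pc[OF wx(2)] n1] ch_mult[OF wx(2) wc n1] f(2) ch1[OF wx(2)]
        by (simp add: mult.commute)
      then show ?thesis using wx ch_unit[OF wx(2) n1] by blast
    qed
  qed (use W ch_unit n1 in auto)
  \<comment> \<open>The test element below has \<open>ch 1 = p\<close>, which cancels the factor
    \<open>l\<close> in front of \<open>s (vv 1 x)\<close>, and \<open>vv 1 = r\<close>.\<close>
  define p where "p = uinv l"
  have p: "p dvd 1" "p * l = 1" using uinv_dvd[OF l] uinv_left[OF l] by (auto simp: p_def)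
  define C where "C w = {c. c dvd 1 \<and> p * s c = c * ch 1 w}" for w
  have C: "finite (C w)" if "w \<in> W" for w
    unfolding C_def using finite_twisted_units[OF s fin p(1)] ch_unit[OF _ n1] W that by blast
  define V where "V = (\<lambda>(w, c). c * vv 1 w - p * \<tau> (s c)) ` (SIGMA w:W. C w)"
  have V: "finite V" unfolding V_def using W C by (intro finite_imageI finite_SigmaI) auto
  obtain r where r: "\<And>v x. v \<in> V \<Longrightarrow> r \<noteq> v + (x - s x)" using infinite_additive_cosets[OF fg inf s V] by blast
  obtain f where f: "diag_mat n f \<in> carrier G" "ch 1 (diag_mat n f) = p"
    using torus_element[OF p(1), of 1] by auto
  let ?g = "E 1 2 r \<otimes> diag_mat n f"
  have Ec: "E 1 2 r \<in> F" using n4 by (intro E_F) auto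
  have gc: "?g \<in> carrier G" using F_carrier[OF Ec] f by simp
  have chg: "ch 1 ?g = p" using ch_mult[OF F_carrier[OF Ec] f(1) n1] ch_F[OF Ec n1] f(2) by simp
  have vvg: "vv 1 ?g = r" using vv_mult[OF F_carrier[OF Ec] f(1) n1] vv_E[OF n1 n1, of r] vv_diag_mat[of 1 f]
    by (simp add: numeral_2_eq_2)
  obtain w x where wx: "w \<in> W" "x \<in> carrier G" "?g \<otimes> \<phi> x = x \<otimes> w" using cov[OF gc] by blast
  have wc: "w \<in> carrier G" using wx W by auto
  define c where "c = ch 1 x"
  have e1: "p * s c = c * ch 1 w"
    using arg_cong[OF wx(3), of "ch 1"] ch_mult[OF gc pc[OF wx(2)] n1] ch_mult[OF wx(2) wc n1] chg ch1[OF wx(2)]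
    by (simp add: c_def)
  have e2: "p * (l * s (vv 1 x) + \<tau> (s c)) + r = c * vv 1 w + vv 1 x"
    using arg_cong[OF wx(3), of "vv 1"] vv_mult[OF gc pc[OF wx(2)] n1] vv_mult[OF wx(2) wc n1] chg vvg vv1[OF wx(2)] ch1[OF wx(2)]
    by (simp add: c_def)
  have "p * (l * s (vv 1 x)) = s (vv 1 x)" using p(2) by (metis mult.assoc mult_1)
  then have "r = (c * vv 1 w - p * \<tau> (s c)) + (vv 1 x - s (vv 1 x))"
    using e2 unfolding distrib_left by (simp only:) (simp add: algebra_simps)
  moreover have "c \<in> C w" using e1 ch_unit[OF wx(2) n1] by (simp add: C_def c_def)
  then have "c * vv 1 w - p * \<tau> (s c) \<in> V" using wx(1) by (force simp: V_def)
  ultimately show False using r by blast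
qed

text \<open>The first and last components of the twisted conjugacy equation form a coupled system.
  With \<open>ch m g = 1\<close> and \<open>vv m g = 0\<close> the last one expresses the data of
  \<open>x\<close> at \<open>m\<close> through those at \<open>1\<close>; substitution leaves one
  equation of the preserving type for \<open>s \<circ> s\<close>.\<close>

lemma contradiction_swapping:
  fixes m
  assumes m: "m = n - 1"
    and fg: "gen_ring xs = (UNIV :: 'a set)" and inf: "infinite (UNIV :: 'a set)"
    and W: "finite W" "W \<subseteq> carrier G" and cov: "\<And>g. g \<in> carrier G \<Longrightarrow> \<exists>w\<in>W. \<exists>x\<in>carrier G. g \<otimes> \<phi> x = x \<otimes> w"
    and s: "ring_automorphism s" and l: "l1 dvd 1" "l2 dvd 1"
    and ch1: "\<And>x. x \<in> carrier G \<Longrightarrow> ch 1 (\<phi> x) = s (ch m x)"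
    and chm: "\<And>x. x \<in> carrier G \<Longrightarrow> ch m (\<phi> x) = s (ch 1 x)"
    and vv1: "\<And>x. x \<in> carrier G \<Longrightarrow> vv 1 (\<phi> x) = l1 * s (vv m x) + \<tau>1 (ch 1 (\<phi> x))"
    and vvm: "\<And>x. x \<in> carrier G \<Longrightarrow> vv m (\<phi> x) = l2 * s (vv 1 x) + \<tau>2 (ch m (\<phi> x))"
  shows False
proof -
  have n1: "1 \<le> (1::nat)" "1 < n" and nm: "1 \<le> m" "m < n" and m1: "m \<noteq> 1" using n4 m by auto
  note pc = iso_carrier[OF \<phi>]
  note sa = ring_automorphismD[OF s]
  have ss: "ring_automorphism (s \<circ> s)" by (rule ring_automorphism_comp[OF s s])
  have sun: "s u dvd 1" if "u dvd 1" for u using that sa(2,4) by (metis dvdE dvdI)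
  \<comment> \<open>The multiplier of \<open>w\<close> once \<open>ch m x\<close> has been
    eliminated.\<close>
  define K where "K w = ch 1 w * s (ch m w)" for w
  have K: "K w dvd 1" if "w \<in> W" for w
    unfolding K_def using that W ch_unit[OF _ n1] ch_unit[OF _ nm] by (intro unit_mult sun) auto
  have step: "p * (s \<circ> s) (ch 1 x) = ch 1 x * K w \<and> ch m x = s (ch 1 x) * uinv (ch m w)"
    if g: "g \<in> carrier G" "ch 1 g = p" "ch m g = 1" and x: "x \<in> carrier G" and w: "w \<in> carrier G" and e: "g \<otimes> \<phi> x = x \<otimes> w" for g p x w
  proof -
    have 1: "p * s (ch m x) = ch 1 x * ch 1 w"
      using arg_cong[OF e, of "ch 1"] ch_mult[OF g(1) pc[OF x] n1] ch_mult[OF x w n1] g(2) ch1[OF x] by simp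
    have 2: "s (ch 1 x) = ch m x * ch m w"
      using arg_cong[OF e, of "ch m"] ch_mult[OF g(1) pc[OF x] nm] ch_mult[OF x w nm] g(3) chm[OF x] by simp
    have "p * (s \<circ> s) (ch 1 x) = (p * s (ch m x)) * s (ch m w)" unfolding o_def 2 by (simp add: sa mult_ac)
    then have "p * (s \<circ> s) (ch 1 x) = ch 1 x * K w" unfolding 1 by (simp add: K_def mult_ac)
    moreover have "s (ch 1 x) * uinv (ch m w) = ch m x" unfolding 2
      using uinv_right[OF ch_unit[OF w nm]] by (simp add: mult.assoc)
    ultimately show ?thesis by simp
  qed
  have fin: "finite {u. u dvd 1 \<and> (s \<circ> s) u = u}"
  proof (rule finite_fixed_units[OF fg ss, of "K ` W"])
    show "\<exists>w\<in>K ` W. \<exists>x. x dvd 1 \<and> u * (s \<circ> s) x = w * x" if u: "u dvd 1" for u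
    proof -
      obtain f where f: "diag_mat n f \<in> carrier G" "ch 1 (diag_mat n f) = u" "ch m (diag_mat n f) = 1"
        using torus_element[OF u, of 1] m by auto
      obtain w x where wx: "w \<in> W" "x \<in> carrier G" "diag_mat n f \<otimes> \<phi> x = x \<otimes> w" using cov[OF f(1)] by blast
      have wc: "w \<in> carrier G" using wx W by auto
      have "u * (s \<circ> s) (ch 1 x) = K w * ch 1 x" using step[OF f wx(2) wc wx(3)] by (simp add: mult.commute)
      then show ?thesis using wx ch_unit[OF wx(2) n1] by blast
    qed
  qed (use W K in auto)
  \<comment> \<open>After the elimination \<open>(s \<circ> s) (vv 1 x)\<close> has the coefficient
    \<open>p * l1 * s l2\<close>, which this choice makes 1.\<close>
  define p where "p = uinv (l1 * s l2)"
  have ll: "l1 * s l2 dvd 1" using l sun by (intro unit_mult) auto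
  have p: "p dvd 1" "p * (l1 * s l2) = 1" using uinv_dvd[OF ll] uinv_left[OF ll] by (auto simp: p_def)
  define C where "C w = {c. c dvd 1 \<and> p * (s \<circ> s) c = c * K w}" for w
  have C: "finite (C w)" if "w \<in> W" for w
    unfolding C_def using finite_twisted_units[OF ss fin p(1) K[OF that]] .
  define cm where "cm w c = s c * uinv (ch m w)" for w c
  \<comment> \<open>What remains of the equation for \<open>r\<close> beside
    \<open>vv 1 x - (s \<circ> s) (vv 1 x)\<close>. It depends only on \<open>w\<close> and
    \<open>c = ch 1 x\<close>, because \<open>ch m x\<close> equals \<open>cm w c\<close>.\<close>
  define const where "const w c = c * vv 1 w - p * \<tau>1 (s (cm w c)) - p * l1 * s (\<tau>2 (s c) - cm w c * vv m w)" for w c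
  define V where "V = (\<lambda>(w, c). const w c) ` (SIGMA w:W. C w)"
  have V: "finite V" unfolding V_def using W C by (intro finite_imageI finite_SigmaI) auto
  obtain r where r: "\<And>v x. v \<in> V \<Longrightarrow> r \<noteq> v + (x - (s \<circ> s) x)" using infinite_additive_cosets[OF fg inf ss V] by blast
  obtain f where f: "diag_mat n f \<in> carrier G" "ch 1 (diag_mat n f) = p" "ch m (diag_mat n f) = 1"
    using torus_element[OF p(1), of 1] m by auto
  let ?g = "E 1 2 r \<otimes> diag_mat n f"
  have Ec: "E 1 2 r \<in> F" using n4 by (intro E_F) auto
  have gc: "?g \<in> carrier G" using F_carrier[OF Ec] f by simp
  have chg: "ch 1 ?g = p" using ch_mult[OF F_carrier[OF Ec] f(1) n1] ch_F[OF Ec n1] f(2) by simp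
  have chmg: "ch m ?g = 1" using ch_mult[OF F_carrier[OF Ec] f(1) nm] ch_F[OF Ec nm] f(3) by simp
  have vvg: "vv 1 ?g = r" using vv_mult[OF F_carrier[OF Ec] f(1) n1] vv_E[OF n1 n1, of r] vv_diag_mat[of 1 f]
    by (simp add: numeral_2_eq_2)
  have vvmg: "vv m ?g = 0" using vv_mult[OF F_carrier[OF Ec] f(1) nm] vv_E[OF nm n1, of r] vv_diag_mat[of m f] m1
    by (simp add: numeral_2_eq_2)
  obtain w x where wx: "w \<in> W" "x \<in> carrier G" "?g \<otimes> \<phi> x = x \<otimes> w" using cov[OF gc] by blast
  have wc: "w \<in> carrier G" using wx W by auto
  define c where "c = ch 1 x"
  note st = step[OF gc chg chmg wx(2) wc wx(3)]
  have cmx: "ch m x = cm w c" using st by (simp add: cm_def c_def)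
  have e1: "p * (l1 * s (vv m x) + \<tau>1 (s (cm w c))) + r = c * vv 1 w + vv 1 x"
    using arg_cong[OF wx(3), of "vv 1"] vv_mult[OF gc pc[OF wx(2)] n1] vv_mult[OF wx(2) wc n1] chg vvg vv1[OF wx(2)] ch1[OF wx(2)] cmx
    by (simp add: c_def)
  have e2: "l2 * s (vv 1 x) + \<tau>2 (s c) = cm w c * vv m w + vv m x"
    using arg_cong[OF wx(3), of "vv m"] vv_mult[OF gc pc[OF wx(2)] nm] vv_mult[OF wx(2) wc nm] chmg vvmg vvm[OF wx(2)] chm[OF wx(2)] cmx
    by (simp add: c_def)
  have "vv m x = l2 * s (vv 1 x) + (\<tau>2 (s c) - cm w c * vv m w)" using e2 by (simp add: algebra_simps)
  then have "s (vv m x) = s l2 * (s \<circ> s) (vv 1 x) + s (\<tau>2 (s c) - cm w c * vv m w)"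
    using sa(3)[of "l2 * s (vv 1 x)"] sa(4)[of l2 "s (vv 1 x)"] by simp
  then have "p * (l1 * s (vv m x)) = (p * (l1 * s l2)) * (s \<circ> s) (vv 1 x) + p * l1 * s (\<tau>2 (s c) - cm w c * vv m w)"
    by (simp only: algebra_simps)
  then have "p * (l1 * s (vv m x)) = (s \<circ> s) (vv 1 x) + p * l1 * s (\<tau>2 (s c) - cm w c * vv m w)"
    unfolding p(2) by simp
  then have "r = const w c + (vv 1 x - (s \<circ> s) (vv 1 x))" using e1 unfolding const_def by (simp add: algebra_simps)
  moreover have "c \<in> C w" using st ch_unit[OF wx(2) n1] by (simp add: C_def c_def)
  then have "const w c \<in> V" using wx(1) by (force simp: V_def)
  ultimately show False using r by blast
qed

lemma infinitely_many_twisted_classes: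
  assumes fg: "gen_ring xs = (UNIV :: 'a set)" and inf: "infinite (UNIV :: 'a set)"
  shows "reidemeister_infinite G \<phi>"
  unfolding reidemeister_infinite_def
proof
  assume fin: "finite (carrier G // twisted_conj G \<phi>)"
  have refl: "(g, g) \<in> twisted_conj G \<phi>" if "g \<in> carrier G" for g
  proof -
    have "g = \<one> \<otimes> g \<otimes> inv (\<phi> \<one>)" using that iso_one[OF \<phi>] by simp
    then show ?thesis unfolding twisted_conj_def using that one_closed by blast
  qed
  have "carrier G // twisted_conj G \<phi> = (\<lambda>g. twisted_conj G \<phi> `` {g}) ` carrier G" unfolding quotient_def by blast
  then obtain W where W: "W \<subseteq> carrier G" "finite W"
      "(\<lambda>g. twisted_conj G \<phi> `` {g}) ` carrier G = (\<lambda>g. twisted_conj G \<phi> `` {g}) ` W"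
    using finite_subset_image[of "(\<lambda>g. twisted_conj G \<phi> `` {g}) ` carrier G" "\<lambda>g. twisted_conj G \<phi> `` {g}" "carrier G"] fin
    by auto
  have cov: "\<exists>w\<in>W. \<exists>x\<in>carrier G. g \<otimes> \<phi> x = x \<otimes> w" if g: "g \<in> carrier G" for g
  proof -
    have "twisted_conj G \<phi> `` {g} \<in> (\<lambda>g. twisted_conj G \<phi> `` {g}) ` W" unfolding W(3)[symmetric] using g by blast
    then obtain w where w: "w \<in> W" "twisted_conj G \<phi> `` {g} = twisted_conj G \<phi> `` {w}" by blast
    \<comment> \<open>Reflexivity suffices: \<open>w\<close> lies in its own class, which is that of
      \<open>g\<close>.\<close>
    then have "(g, w) \<in> twisted_conj G \<phi>" using refl W(1) by blast
    then obtain x where x: "x \<in> carrier G" "g = x \<otimes> w \<otimes> inv (\<phi> x)" by (auto simp: twisted_conj_def)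
    have "g \<otimes> \<phi> x = x \<otimes> w" using x w W iso_carrier[OF \<phi> x(1)] by (simp add: m_assoc subset_iff)
    then show ?thesis using w x by blast
  qed
  have e: "(1::nat) \<in> {1, n - 1}" "n - 1 \<in> {1, n - 1}" by auto
  have ne: "(1::nat) \<noteq> n - 1" using n4 by simp
  have S: "Suc (n - 1) = n" using n4 by simp
  have E12F: "E 1 2 a \<in> F" and EmF: "E (n - 1) n a \<in> F" for a using n4 by (auto intro!: E_F)
  have \<alpha>1: "\<alpha> i 1 a = vv i (\<phi> (E 1 2 a))" and \<alpha>m: "\<alpha> i (n - 1) a = vv i (\<phi> (E (n - 1) n a))" for i a
    unfolding \<alpha>_def S by (simp_all add: numeral_2_eq_2)
  show False
  proof (rule disjE[OF \<alpha>_monomial])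
    assume z: "(\<forall>a. \<alpha> 1 (n - 1) a = 0) \<and> (\<forall>a. \<alpha> (n - 1) 1 a = 0)"
    \<comment> \<open>The product \<open>a * b\<close> is the pairing of \<open>E 1 2 a\<close> and
      \<open>E 2 n b\<close>; with \<open>\<alpha> (n - 1) 1 = 0\<close> only one of the two terms
      of the image pairing survives, and it separates \<open>a\<close> from
      \<open>b\<close>.\<close>
    have mul: "\<gamma> (a * b) = \<alpha> 1 1 a * ww2 (\<phi> (E 2 n b))" for a b
    proof -
      have "\<alpha> (n - 1) 1 a = 0" using z by blast
      then show ?thesis using \<gamma>_pairing[OF E12F E2n_P2, of a b, unfolded pairing_E] unfolding pairing_def \<alpha>1
        by (simp only: mult_zero_right diff_zero)
    qed
    note iso = isotopy_ring_automorphism[OF \<gamma>_bij \<gamma>_add mul \<sigma>_fun]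
    have "\<alpha> 1 k a = 0" if "k \<in> {1, n - 1}" "k \<noteq> 1" for k a using z that by auto
    then obtain \<tau> where \<tau>: "\<forall>x\<in>carrier G. vv 1 (\<phi> x) = \<alpha> 1 1 1 * \<sigma> (vv 1 x) + \<tau> (ch 1 (\<phi> x))"
      using vv_\<phi>_general[OF e(1) e(1) mul] by blast
    show False
      by (rule contradiction_preserving[OF fg inf W(2,1) cov iso(1,2) ch_\<phi>[OF e(1) e(1) mul] bspec[OF \<tau>]])
  next
    assume z: "(\<forall>a. \<alpha> 1 1 a = 0) \<and> (\<forall>a. \<alpha> (n - 1) (n - 1) a = 0)"
    have mul1: "\<gamma> (a * b) = \<alpha> (n - 1) 1 a * (- ww1 (\<phi> (E 2 n b)))" for a b
    proof -
      have "\<alpha> 1 1 a = 0" using z by blast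
      then show ?thesis using \<gamma>_pairing[OF E12F E2n_P2, of a b, unfolded pairing_E] unfolding pairing_def \<alpha>1
        by (simp add: mult.commute del: One_nat_def)
    qed
    \<comment> \<open>In the swapped case row \<open>1\<close> is reached from the other elementary
      matrix, paired with \<open>E 1 (n - 1) b\<close>; the sign is moved into the second
      factor.\<close>
    have mul2: "\<gamma> (a * b) = \<alpha> 1 (n - 1) a * (- ww2 (\<phi> (E 1 (n - 1) b)))" for a b
    proof -
      have "\<alpha> (n - 1) (n - 1) a = 0" using z by blast
      then have "- \<gamma> (a * b) = \<alpha> 1 (n - 1) a * ww2 (\<phi> (E 1 (n - 1) b))"
        using \<gamma>_pairing[OF EmF E1n'_P2, of a b, unfolded pairing_E \<gamma>_minus mult.commute[of b a]] unfolding pairing_def \<alpha>m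
        by (simp only: mult_zero_right diff_zero)
      then show ?thesis by (metis minus_minus mult_minus_right)
    qed
    note iso1 = isotopy_ring_automorphism[OF \<gamma>_bij \<gamma>_add mul1 \<sigma>_fun]
    note iso2 = isotopy_ring_automorphism[OF \<gamma>_bij \<gamma>_add mul2 \<sigma>_fun]
    have "\<alpha> 1 k a = 0" if "k \<in> {1, n - 1}" "k \<noteq> n - 1" for k a using z that by auto
    then obtain \<tau>1 where \<tau>1: "\<forall>x\<in>carrier G. vv 1 (\<phi> x) = \<alpha> 1 (n - 1) 1 * \<sigma> (vv (n - 1) x) + \<tau>1 (ch 1 (\<phi> x))"
      using vv_\<phi>_general[OF e(1) e(2) mul2] by blast
    have "\<alpha> (n - 1) k a = 0" if "k \<in> {1, n - 1}" "k \<noteq> 1" for k a using z that by auto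
    then obtain \<tau>2 where \<tau>2: "\<forall>x\<in>carrier G. vv (n - 1) (\<phi> x) = \<alpha> (n - 1) 1 1 * \<sigma> (vv 1 x) + \<tau>2 (ch (n - 1) (\<phi> x))"
      using vv_\<phi>_general[OF e(2) e(1) mul1] by blast
    show False
      by (rule contradiction_swapping[OF HOL.refl fg inf W(2,1) cov iso1(1) iso2(2) iso1(2)
            ch_\<phi>[OF e(1) e(2) mul2] ch_\<phi>[OF e(2) e(1) mul1] bspec[OF \<tau>1] bspec[OF \<tau>2]])
  qed
qed

end

section \<open>Infinitude and non-trivial units of the rings in question\<close>

lemma CHAR_0_infinite: "CHAR('a::idom) = 0 \<Longrightarrow> infinite (UNIV :: 'a set)"
proof
  assume c: "CHAR('a) = 0" and f: "finite (UNIV :: 'a set)"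
  have "inj (of_nat :: nat \<Rightarrow> 'a)"
  proof (rule injI)
    fix x y :: nat assume eq: "of_nat x = (of_nat y :: 'a)"
    have "x = y" if "x \<le> y" "of_nat x = (of_nat y :: 'a)" for x y
    proof -
      have "of_nat (y - x) = (0 :: 'a)" using that by (simp add: of_nat_diff)
      then have "CHAR('a) dvd y - x" by (simp only: of_nat_eq_0_iff_char_dvd)
      then show ?thesis using c that by simp
    qed
    then show "x = y" using eq by (metis nat_le_linear)
  qed
  then have "finite (UNIV :: nat set)" using f by (meson finite_subset finite_imageD subset_UNIV)
  then show False by simp
qed

lemma CHAR_0_minus_one: "CHAR('a::idom) = 0 \<Longrightarrow> - 1 \<noteq> (1::'a)"
proof
  assume c: "CHAR('a) = 0" and "- 1 = (1::'a)"
  then have "of_nat 2 = (0::'a)" by (simp add: neg_eq_iff_add_eq_0)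
  then show False using c by (simp only: of_nat_eq_0_iff_char_dvd) simp
qed

lemma loc_poly_ring_infinite:
  fixes h :: "'a::idom \<Rightarrow> 'f::{field,finite} poly fract"
  assumes h: "ring_iso_to h (loc_poly_ring fs)"
  shows "infinite (UNIV :: 'a set)"
proof
  assume "finite (UNIV :: 'a set)"
  then have "finite (loc_poly_ring fs)" using h unfolding ring_iso_to_def by (metis bij_betw_finite)
  moreover have "range (\<lambda>k. Fract (monom 1 k) 1) \<subseteq> loc_poly_ring fs"
    unfolding loc_poly_ring_def by (auto intro!: exI[of _ "monom 1 _"] exI[of _ "\<lambda>_. 0"])
  moreover have "inj (\<lambda>k. Fract (monom (1::'f) k) 1)"
    by (rule injI) (simp add: eq_fract monom_eq_iff')
  ultimately show False by (meson finite_subset finite_imageD infinite_UNIV_nat)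
qed

text \<open>The inverted polynomial \<open>fs ! 0\<close> is a unit of the localisation, and it
  differs from 1 because an irreducible element is not a unit of the polynomial ring.\<close>

lemma loc_poly_ring_unit:
  fixes h :: "'a::idom \<Rightarrow> 'f::{field,finite} poly fract"
  assumes h: "ring_iso_to h (loc_poly_ring fs)" and fs: "length fs \<ge> 1" "irreducible (fs ! 0)"
  shows "\<exists>u::'a. u dvd 1 \<and> u \<noteq> 1"
proof -
  have f0: "fs ! 0 \<noteq> 0" "\<not> fs ! 0 dvd 1" using fs by (auto simp: irreducible_def)
  have 1: "Fract (fs ! 0) 1 \<in> loc_poly_ring fs"
    unfolding loc_poly_ring_def by (auto intro!: exI[of _ "fs ! 0"] exI[of _ "\<lambda>_. 0"])
  have "(\<Prod>i<length fs. (fs ! i) ^ (if i = 0 then 1 else 0)) = fs ! 0"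
  proof -
    have "(\<Prod>i<length fs. (fs ! i) ^ (if i = 0 then 1 else 0)) = (\<Prod>i<length fs. if i = 0 then fs ! 0 else 1)"
      by (intro prod.cong) auto
    moreover have "fs \<noteq> []" using fs by auto
    ultimately show ?thesis by simp
  qed
  then have 2: "Fract 1 (fs ! 0) \<in> loc_poly_ring fs"
    unfolding loc_poly_ring_def by (intro CollectI exI[of _ 1] exI[of _ "\<lambda>i. if i = 0 then 1 else 0"]) simp
  have b: "h ` UNIV = loc_poly_ring fs" "inj h" using h by (auto simp: ring_iso_to_def bij_betw_def)
  obtain u where u: "h u = Fract (fs ! 0) 1" using 1 b(1) by (metis imageE)
  obtain v where v: "h v = Fract 1 (fs ! 0)" using 2 b(1) by (metis imageE)
  have "h (u * v) = h 1" using h u v f0 by (simp add: ring_iso_to_def eq_fract One_fract_def)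
  then have uv: "u * v = 1" using b(2) by (simp add: inj_def)
  have "u \<noteq> 1"
  proof
    assume "u = 1"
    then have "Fract (fs ! 0) 1 = 1" using u h by (simp add: ring_iso_to_def)
    then have "fs ! 0 = 1" by (simp add: eq_fract One_fract_def)
    then show False using f0 by simp
  qed
  then show ?thesis using uv by (metis dvd_triv_left)
qed

text \<open>The type \<open>'f\<close> is the field with \<open>q\<close> elements and
  \<open>fs\<close> lists the inverted polynomials, so that \<open>length fs\<close> stands for
  \<open>l - 1\<close>.\<close>

theorem theorem1p4:
  fixes n :: nat and I :: "nat set"

  assumes n4: "n \<ge> 4"
    and I_sub: "I \<subseteq> {1..n}"
    and NG: "NG_condition n I"
    and R_cases: "CHAR('a::idom) = 0 \<or>
       (\<exists>(fs :: 'f::{field,finite} poly list) (h :: 'a \<Rightarrow> 'f poly fract).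
          length fs \<ge> 1 \<and>
          (\<forall>i<length fs. lead_coeff (fs ! i) = 1 \<and> irreducible (fs ! i)) \<and>
          (\<forall>i<length fs. \<forall>j<length fs. i \<noteq> j \<longrightarrow> coprime (fs ! i) (fs ! j)) \<and>
          ring_iso_to h (loc_poly_ring fs))"
    and fg: "finitely_generated (S_group n I :: (nat \<Rightarrow> nat \<Rightarrow> 'a) monoid)"
  shows "property_R_infinity (S_group n I :: (nat \<Rightarrow> nat \<Rightarrow> 'a) monoid)"
proof -
  have ring: "infinite (UNIV :: 'a set) \<and> (\<exists>u::'a. u dvd 1 \<and> u \<noteq> 1)"
    using R_cases
  proof
    assume c: "CHAR('a) = 0"
    have "(- 1 :: 'a) dvd 1" by simp
    then show ?thesis using CHAR_0_infinite[OF c] CHAR_0_minus_one[OF c] by blast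
  next
    assume "\<exists>(fs :: 'f poly list) (h :: 'a \<Rightarrow> 'f poly fract).
          length fs \<ge> 1 \<and>
          (\<forall>i<length fs. lead_coeff (fs ! i) = 1 \<and> irreducible (fs ! i)) \<and>
          (\<forall>i<length fs. \<forall>j<length fs. i \<noteq> j \<longrightarrow> coprime (fs ! i) (fs ! j)) \<and>
          ring_iso_to h (loc_poly_ring fs)"
    then obtain fs :: "'f poly list" and h :: "'a \<Rightarrow> 'f poly fract" where
      *: "length fs \<ge> 1" "\<forall>i<length fs. irreducible (fs ! i)" "ring_iso_to h (loc_poly_ring fs)" by blast
    then have "irreducible (fs ! 0)" by (simp add: Suc_le_eq)
    then show ?thesis using loc_poly_ring_infinite[OF *(3)] loc_poly_ring_unit[OF *(3,1)] by blast
  qed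
  then obtain u0 :: 'a where u0: "u0 dvd 1" "u0 \<noteq> 1" by blast
  interpret triangular_group n I "S_group n I :: (nat \<Rightarrow> nat \<Rightarrow> 'a) monoid"
    by unfold_locales (simp_all add: n4 NG)
  obtain xs where xs: "gen_ring xs = (UNIV :: 'a set)" using fg_ring[OF fg] by blast
  show ?thesis
    unfolding property_R_infinity_def
  proof
    fix \<phi> :: "(nat \<Rightarrow> nat \<Rightarrow> 'a) \<Rightarrow> nat \<Rightarrow> nat \<Rightarrow> 'a"
    assume \<phi>: "\<phi> \<in> iso (S_group n I) (S_group n I)"
    interpret triangular_group_aut n I "S_group n I :: (nat \<Rightarrow> nat \<Rightarrow> 'a) monoid" \<phi> u0
      by unfold_locales (simp_all add: \<phi> u0)
    show "reidemeister_infinite (S_group n I) \<phi>"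
      using infinitely_many_twisted_classes[OF xs] ring by blast
  qed
qed

end
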